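(* Let $K$ be an imaginary quadratic number field. As $\delta\to+\infty$, we have the estimate $$\frac{1}{\delta^4}\ \le\ \mu(\,]\delta,+\infty[\,)-2\int_0^{2\ln|\omega_K|}(1-f_s(\delta))\,e^{-2s}\,ds\ \le\ \frac{1}{\delta^4}+\operatorname{O}\Big(\frac{|\omega_K|}{\delta^5}\Big).$$
   Context: $K\subset\mathbb{C}$ is an imaginary quadratic number field with ring of integers $\mathcal{O}_K$ and discriminant $D_K$. Set $\omega_K=i\frac{\sqrt{|D_K|}}{2}$ if $D_K\equiv0\bmod 4$ and $\omega_K=\frac{1+i\sqrt{|D_K|}}{2}$ if $D_K\equiv1\bmod4$, so $\mathcal{O}_K=\mathbb{Z}[\omega_K]$. $\operatorname{pr}_{\mathcal{O}_K}:\mathbb{C}\to\mathbb{C}/\mathcal{O}_K$ is the canonical projection, $dx$ is the Haar measure on $\mathbb{C}/\mathcal{O}_K$ of total mass $\frac{\sqrt{|D_K|}}{2}$, and $d$ is the quotient distance on $\mathbb{C}/\mathcal{O}_K$ induced by the Euclidean distance. For $t\ge0$, $\mathcal{F}_t=\{\operatorname{pr}_{\mathcal{O}_K}(\frac pq): p,q\in\mathcal{O}_K,\ p\mathcal{O}_K+q\mathcal{O}_K=\mathcal{O}_K,\ 0<|q|\le e^{t/2}\}$, and (for $t$ large enough that $\mathcal{F}_t$ has at least two elements) $\mu_t=\frac{1}{\operatorname{card}\mathcal{F}_t}\sum_{r\in\mathcal{F}_t}\Delta_{e^td(r,\mathcal{F}_t\smallsetminus\{r\})}$, where $\Delta_x$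 is the Dirac mass at $x$. The measure $\mu$ is the probability measure on $[0,+\infty[$ which is the narrow limit of $\mu_t$ as $t\to+\infty$ (this limit exists). For $z\in\mathbb{C}$ and $r,R>0$, $A(z,r,R)=\{w\in\mathbb{C}:r\le|w-z|\le R\}$ (empty if $r>R$). $\widehat{\mathcal{O}_K^{\,2}}$ is the set of pairs $(p,q)\in\mathcal{O}_K^2$ with $p\mathcal{O}_K+q\mathcal{O}_K=\mathcal{O}_K$. For real $s,\delta>0$, $$f_s(\delta)=\frac{2}{\sqrt{|D_K|}}\,dx\Big(\bigcup_{\substack{(p,q)\in\widehat{\mathcal{O}_K^{\,2}}\\ p\ne0}}\operatorname{pr}_{\mathcal{O}_K}\Big(A\Big(\frac qp,\frac{e^s}{\delta},\frac{e^{s/2}}{|p|}\Big)\Big)\Big).$$ *)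

theory Defs
  imports "HOL-Probability.Probability" "HOL-Computational_Algebra.Computational_Algebra"
begin

definition imaginary_quadratic_field :: "complex set \<Rightarrow> bool" where
  "imaginary_quadratic_field K \<longleftrightarrow>
     1 \<in> K \<and> (\<forall>x\<in>K. \<forall>y\<in>K. x - y \<in> K \<and> x * y \<in> K) \<and> (\<forall>x\<in>K. inverse x \<in> K) \<and>
     vector_space.dim (\<lambda>(c::rat) (z::complex). of_rat c * z) K = 2 \<and>
     \<not> K \<subseteq> \<real>"

definition ring_of_integers :: "complex set \<Rightarrow> complex set" where
  "ring_of_integers K = {z \<in> K. algebraic_int z}"

(* The discriminant is the square of the determinant of the matrix of the two embeddings
   of K (the inclusion and complex conjugation) evaluated on a Z-basis of the ring of integers. *)
definition discriminant :: "complex set \<Rightarrow> int" where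
  "discriminant K = (THE D. \<exists>b c. ring_of_integers K = {of_int m * b + of_int n * c | m n :: int. True} \<and>
     of_int D = (b * cnj c - c * cnj b)\<^sup>2)"

definition omega :: "complex set \<Rightarrow> complex" where
  "omega K = (let s = complex_of_real (sqrt \<bar>real_of_int (discriminant K)\<bar>) in
     if discriminant K mod 4 = 0 then \<i> * s / 2 else (1 + \<i> * s) / 2)"

(* Points of the quotient of the complex plane by the ring of integers are cosets. *)
definition pr :: "complex set \<Rightarrow> complex \<Rightarrow> complex set" where
  "pr K z = {z + a | a. a \<in> ring_of_integers K}"

definition torus :: "complex set \<Rightarrow> complex set set" where
  "torus K = range (pr K)"

(* The Borel sigma-algebra of the quotient topology. *)
definition torus_borel :: "complex set \<Rightarrow> complex set measure" where
  "torus_borel K = sigma (torus K) {U. U \<subseteq> torus K \<and> open (pr K -` U)}"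

(* For a coset x, the coset z + x is the image of x under addition of z. *)
definition torus_haar :: "complex set \<Rightarrow> complex set measure" where
  "torus_haar K = (THE M. sets M = sets (torus_borel K) \<and>
     (\<forall>A\<in>sets M. \<forall>z. emeasure M ((\<lambda>x. (+) z ` x) ` A) = emeasure M A) \<and>
     emeasure M (torus K) = ennreal (sqrt \<bar>real_of_int (discriminant K)\<bar> / 2))"

(* Between cosets, setdist is the quotient distance. *)
definition torus_dist :: "complex set \<Rightarrow> complex set \<Rightarrow> real" where
  "torus_dist x y = setdist x y"

definition primitive_pairs :: "complex set \<Rightarrow> (complex \<times> complex) set" where
  "primitive_pairs K = {(p, q). p \<in> ring_of_integers K \<and> q \<in> ring_of_integers K \<and>
     {p * a + q * b | a b. a \<in> ring_of_integers K \<and> b \<in> ring_of_integers K} = ring_of_integers K}"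

definition farey :: "complex set \<Rightarrow> real \<Rightarrow> complex set set" where
  "farey K t = {pr K (p / q) | p q. (p, q) \<in> primitive_pairs K \<and> 0 < cmod q \<and> cmod q \<le> exp (t / 2)}"

(* The average of the Dirac masses at the rescaled gaps, on the Borel sets of [0, infinity).
   It is meaningful only when the set of Farey points has at least two elements,
   that is, for all large t. *)
definition gap_measure :: "complex set \<Rightarrow> real \<Rightarrow> real measure" where
  "gap_measure K t = distr (uniform_count_measure (farey K t)) (restrict_space borel {0..})
     (\<lambda>r. exp t * (INF r'\<in>farey K t - {r}. torus_dist r r'))"

(* Narrow convergence is tested on the bounded continuous functions on [0, infinity). *)
definition is_limit_gap_measure :: "complex set \<Rightarrow> real measure \<Rightarrow> bool" where
  "is_limit_gap_measure K \<mu> \<longleftrightarrow>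
     prob_space \<mu> \<and> sets \<mu> = sets (restrict_space borel {0..}) \<and>
     (\<forall>g :: real \<Rightarrow> real. continuous_on {0..} g \<longrightarrow> bounded (g ` {0..}) \<longrightarrow>
        ((\<lambda>t. integral\<^sup>L (gap_measure K t) g) \<longlongrightarrow> integral\<^sup>L \<mu> g) at_top)"

definition annulus :: "complex \<Rightarrow> real \<Rightarrow> real \<Rightarrow> complex set" where
  "annulus z r R = {w. r \<le> cmod (w - z) \<and> cmod (w - z) \<le> R}"

definition covered_fraction :: "complex set \<Rightarrow> real \<Rightarrow> real \<Rightarrow> real" where
  "covered_fraction K s \<delta> = 2 / sqrt \<bar>real_of_int (discriminant K)\<bar> *
     measure (torus_haar K)
       (\<Union>(p, q) \<in> {(p, q) \<in> primitive_pairs K. p \<noteq> 0}.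
          pr K ` annulus (q / p) (exp s / \<delta>) (exp (s / 2) / cmod p))"

end

theory Submission
  imports Defs "HOL-Real_Asymp.Real_Asymp"
begin

text \<open>
  Write \<open>N = exp (t / 2)\<close>. A Farey point \<open>p / q\<close> with \<open>|q| \<le> N\<close> is encoded by the pair
  \<open>(b, q)\<close>, where \<open>b\<close> is an inverse of \<open>p\<close> modulo \<open>q\<close>, reduced so that \<open>b / q\<close> lies in a fixed
  fundamental parallelogram. If \<open>p * b - q * a = 1\<close>, then the other Farey points are the
  \<open>(P * a - Q * p) / (P * b - Q * q)\<close> with \<open>(P, Q)\<close> unimodular and \<open>P \<noteq> 0\<close>, and the distance from
  \<open>p / q\<close> to such a point is \<open>|P| / (|q| * |P * b - Q * q|)\<close>. So the rescaled gap at \<open>p / q\<close> exceeds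
  \<open>\<delta>\<close> if and only if the point \<open>b / q\<close> avoids a family of annuli centred at the \<open>Q / P\<close>, and this
  condition depends on \<open>(b, q) / N\<close> only (\<open>exists_near_iff_covered\<close>). Each Farey point has as many
  codes as there are units (\<open>card_fibre\<close>). The numerators have disappeared: the gap statistics are
  counts of unimodular pairs in the dilates of a fixed region of \<open>\<real>\<^sup>4\<close>.

  Unimodular pairs are equidistributed (\<open>primitive4_jordan\<close>). Indeed a pair is unimodular unless it
  is bad at some rational prime \<open>p\<close>, meaning that \<open>p\<close> and the two entries generate a proper ideal.
  A pair that is bad at \<open>p\<close> has both norms divisible by \<open>p\<close>, which leaves at most \<open>4 * p\<^sup>2\<close> of the
  \<open>p\<^sup>4\<close> residue classes. Sieving by the primes up to \<open>Y\<close> gives a periodic set, whose density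
  stays bounded below as \<open>Y\<close> grows, and the pairs removed by larger primes number only
  \<open>O(N\<^sup>4 / Y) + O(N\<^sup>3)\<close> (\<open>card_tail4\<close>).

  The volume of the region is an integral over \<open>q\<close> in the unit disc. Over \<open>q\<close> lie the \<open>b\<close> for which
  \<open>b / q\<close> is uncovered, an area of \<open>|q|\<^sup>2\<close> times the uncovered fraction of the torus, which is
  \<open>1 - f\<^sub>s(\<delta>)\<close> for \<open>s = - 2 * ln |q|\<close>. Under the weight \<open>|q|\<^sup>2\<close> on the disc, \<open>s\<close> is exponentially
  distributed with rate \<open>2\<close>. Hence \<open>\<mu>(]\<delta>, \<infinity>[)\<close> is the integral of \<open>2 * exp (- 2 * s) * (1 - f\<^sub>s(\<delta>))\<close>
  over \<open>s > 0\<close> (\<open>limit_gap_measure_tail\<close> and \<open>covered_fraction_eq\<close>).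

  It remains to evaluate this integral beyond \<open>s = 2 * ln |\<omega>|\<close>. Put \<open>u = exp (s / 2)\<close>. For \<open>u > \<delta>\<close>
  all annuli are empty and \<open>f\<^sub>s(\<delta>) = 0\<close>; this range contributes exactly \<open>1 / \<delta>\<^sup>4\<close>. For
  \<open>|\<omega>| \<le> u \<le> \<delta> - 4 * |\<omega>|\<close> the annuli centred at lattice points already cover the plane, so that
  \<open>f\<^sub>s(\<delta>) = 1\<close> (\<open>uncovered_empty\<close>). The range in between contributes \<open>O(|\<omega>| / \<delta>\<^sup>5)\<close>, with a
  constant that is independent of the field (\<open>gap_tail_estimate\<close>).
\<close>

section \<open>Lattice rings in the plane\<close>

text \<open>
  The two hypotheses make \<open>\<int>[\<omega>] = \<int> + \<int> * \<omega>\<close> a ring that is closed under conjugation and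
  discrete in the plane. The counting and the volume computation concern such a ring; the number
  field enters only through \<open>quadratic_integers\<close>.
\<close>
locale quadratic_lattice =
  fixes \<omega> :: complex and \<tau> \<nu> :: int
  assumes Im_pos: "Im \<omega> > 0"
    and omega_sq: "\<omega> * \<omega> = of_int \<tau> * \<omega> - of_int \<nu>"
begin

definition emb :: "int \<times> int \<Rightarrow> complex"
  where "emb v = of_int (fst v) + of_int (snd v) * \<omega>"

definition \<O> :: "complex set"
  where "\<O> = range emb"

definition norm_form :: "int \<times> int \<Rightarrow> int"
  where "norm_form v = fst v * fst v + \<tau> * fst v * snd v + \<nu> * (snd v * snd v)"

definition unimodular :: "complex \<Rightarrow> complex \<Rightarrow> bool"
  where "unimodular b q \<longleftrightarrow> (\<exists>x\<in>\<O>. \<exists>y\<in>\<O>. b * x + q * y = 1)"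

text \<open>
  The ideal generated by \<open>b\<close>, \<open>q\<close> and the rational prime \<open>p\<close> is proper. Testing at rational primes
  replaces the factorization into prime ideals.
\<close>
definition bad_at :: "nat \<Rightarrow> complex \<Rightarrow> complex \<Rightarrow> bool"
  where "bad_at p b q \<longleftrightarrow> \<not> (\<exists>x\<in>\<O>. \<exists>y\<in>\<O>. \<exists>z\<in>\<O>. b * x + q * y + of_nat p * z = 1)"

lemma Re_omega: "2 * Re \<omega> = of_int \<tau>"
proof -
  have "Im (\<omega> * \<omega>) = Im (of_int \<tau> * \<omega> - of_int \<nu>)" using omega_sq by simp
  hence "2 * Re \<omega> * Im \<omega> = of_int \<tau> * Im \<omega>" by simp
  thus ?thesis using Im_pos by simp
qed

lemma cnj_omega: "cnj \<omega> = of_int \<tau> - \<omega>"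
  using Re_omega by (simp add: complex_eq_iff)

lemma omega_cnj: "\<omega> * cnj \<omega> = of_int \<nu>"
  by (simp add: cnj_omega algebra_simps omega_sq)

lemma emb_in [simp, intro]: "emb v \<in> \<O>"
  by (simp add: \<O>_def)

lemma OI: "z = of_int m + of_int n * \<omega> \<Longrightarrow> z \<in> \<O>"
  using emb_in[of "(m, n)"] by (simp add: emb_def)

lemma OE:
  assumes "z \<in> \<O>"
  obtains m n where "z = of_int m + of_int n * \<omega>"
  using assms that by (auto simp: \<O>_def emb_def)

lemma O_of_int [simp, intro]: "of_int k \<in> \<O>"
  by (rule OI[of _ k 0]) simp

lemma O_of_nat [simp, intro]: "of_nat k \<in> \<O>"
  using O_of_int[of "int k"] by (simp del: O_of_int)

lemma O_0 [simp, intro]: "0 \<in> \<O>" using O_of_int[of 0] by (simp del: O_of_int)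
lemma O_1 [simp, intro]: "1 \<in> \<O>" using O_of_int[of 1] by (simp del: O_of_int)

lemma O_omega [simp, intro]: "\<omega> \<in> \<O>" by (rule OI[of _ 0 1]) simp

lemma O_add [intro]: "x \<in> \<O> \<Longrightarrow> y \<in> \<O> \<Longrightarrow> x + y \<in> \<O>"
  by (elim OE, rule_tac m = "m + ma" and n = "n + na" in OI) (simp add: algebra_simps)

lemma O_minus [intro]: "x \<in> \<O> \<Longrightarrow> - x \<in> \<O>"
  by (elim OE, rule_tac m = "- m" and n = "- n" in OI) (simp add: algebra_simps)

lemma O_diff [intro]: "x \<in> \<O> \<Longrightarrow> y \<in> \<O> \<Longrightarrow> x - y \<in> \<O>"
  using O_add[of x "- y"] O_minus[of y] by simp

lemma O_mult [intro]: assumes "x \<in> \<O>" "y \<in> \<O>" shows "x * y \<in> \<O>"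
proof -
  obtain m n where 1: "x = of_int m + of_int n * \<omega>" using assms(1) by (rule OE)
  obtain k l where 2: "y = of_int k + of_int l * \<omega>" using assms(2) by (rule OE)
  have "x * y = of_int (m * k) + of_int (m * l + n * k) * \<omega> + of_int (n * l) * (\<omega> * \<omega>)"
    by (simp add: 1 2 algebra_simps)
  also have "\<dots> = of_int (m * k - n * l * \<nu>) + of_int (m * l + n * k + n * l * \<tau>) * \<omega>"
    unfolding omega_sq by (simp add: algebra_simps)
  finally show ?thesis by (rule OI)
qed

lemma O_cnj [intro]: assumes "x \<in> \<O>" shows "cnj x \<in> \<O>"
proof -
  obtain m n where 1: "x = of_int m + of_int n * \<omega>" using assms(1) by (rule OE)
  show ?thesis by (rule OI[of _ "m + n * \<tau>" "- n"]) (simp add: 1 cnj_omega algebra_simps)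
qed

lemma emb_cnj: "emb v * cnj (emb v) = of_int (norm_form v)"
proof -
  have "emb v * cnj (emb v) = of_int (fst v * fst v) + of_int (fst v * snd v) * (\<omega> + cnj \<omega>)
      + of_int (snd v * snd v) * (\<omega> * cnj \<omega>)"
    by (simp add: emb_def algebra_simps)
  also have "\<dots> = of_int (norm_form v)"
    unfolding omega_cnj by (simp add: cnj_omega norm_form_def algebra_simps)
  finally show ?thesis .
qed

lemma norm_form_eq: "of_int (norm_form v) = (cmod (emb v))\<^sup>2"
proof -
  have "complex_of_real (of_int (norm_form v)) = complex_of_real ((cmod (emb v))\<^sup>2)"
    using emb_cnj[of v] complex_norm_square[of "emb v"] by simp
  thus ?thesis using of_real_eq_iff by blast
qed

lemma emb_eq_0: "emb v = 0 \<longleftrightarrow> v = (0, 0)"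
proof
  assume "emb v = 0"
  hence "Im (emb v) = 0" "Re (emb v) = 0" by auto
  thus "v = (0, 0)" using Im_pos by (cases v) (auto simp: emb_def)
qed (simp add: emb_def)

lemma emb_diff: "emb (u - v) = emb u - emb v"
  by (simp add: emb_def algebra_simps)

lemma inj_emb: "inj emb"
proof
  fix u v assume "emb u = emb v"
  hence "emb (u - v) = 0" by (simp add: emb_diff)
  thus "u = v" by (simp add: emb_eq_0 zero_prod_def[symmetric])
qed

lemma norm_form_pos: "v \<noteq> (0, 0) \<Longrightarrow> norm_form v > 0"
proof -
  assume "v \<noteq> (0, 0)"
  hence "(cmod (emb v))\<^sup>2 > 0" by (simp add: emb_eq_0)
  thus ?thesis unfolding norm_form_eq[symmetric] by simp
qed

lemma O_norm_ge_1: assumes "z \<in> \<O>" "z \<noteq> 0" shows "cmod z \<ge> 1"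
proof -
  obtain v where v: "z = emb v" using assms(1) by (auto simp: \<O>_def)
  hence "norm_form v \<ge> 1" using norm_form_pos[of v] emb_eq_0[of v] assms(2) by force
  hence "(cmod z)\<^sup>2 \<ge> 1" using norm_form_eq[of v] v by (metis of_int_1_le_iff)
  thus ?thesis by (simp add: power2_nonneg_ge_1_iff)
qed

lemma not_bad_at_iff:
  "\<not> bad_at p b q \<longleftrightarrow> (\<exists>x\<in>\<O>. \<exists>y\<in>\<O>. \<exists>z\<in>\<O>. b * x + q * y + of_nat p * z = 1)"
  unfolding bad_at_def by (rule not_not)

text \<open>
  The norm of an entry lies in the ideal of the pair. If it were prime to \<open>p\<close>, a Bezout relation
  would put \<open>1\<close> into the ideal generated by the pair and \<open>p\<close>.
\<close>
lemma bad_at_dvd: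
  assumes p: "prime p" and bad: "bad_at p (emb v) q" and q: "q \<in> \<O>"
  shows "int p dvd norm_form v"
proof (rule ccontr)
  assume "\<not> int p dvd norm_form v"
  hence "coprime (int p) (norm_form v)" using p by (simp add: prime_imp_coprime)
  then obtain r s where rs: "r * int p + s * norm_form v = 1"
    using bezout_int[of "int p" "norm_form v"] by auto
  have "emb v * (cnj (emb v) * of_int s) = of_int (norm_form v) * of_int s"
    by (simp only: mult.assoc[symmetric] emb_cnj)
  hence "emb v * (cnj (emb v) * of_int s) + q * 0 + of_nat p * of_int r
      = of_int (r * int p + s * norm_form v)"
    by (simp add: mult.commute)
  also have "\<dots> = 1" by (simp only: rs of_int_1)
  finally have 1: "emb v * (cnj (emb v) * of_int s) + q * 0 + of_nat p * of_int r = 1" .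
  have "\<not> bad_at p (emb v) q"
    unfolding not_bad_at_iff
    by (rule bexI[OF _ O_mult[OF O_cnj[OF emb_in] O_of_int]], rule bexI[OF _ O_0],
        rule bexI[OF _ O_of_int], rule 1)
  thus False using bad by contradiction
qed

lemma bad_at_sym: "bad_at p b q \<longleftrightarrow> bad_at p q b"
proof -
  have "\<not> bad_at p q b" if "\<not> bad_at p b q" for b q
  proof -
    from that obtain x y z where xyz: "x \<in> \<O>" "y \<in> \<O>" "z \<in> \<O>" "b * x + q * y + of_nat p * z = 1"
      unfolding not_bad_at_iff by (elim bexE)
    from xyz(4) have "q * y + b * x + of_nat p * z = 1" by (simp only: add.commute)
    thus ?thesis unfolding not_bad_at_iff using xyz(1-3) by (intro bexI)
  qed
  thus ?thesis by blast
qed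

text \<open>
  The ideal of a nonzero pair contains a positive integer, for instance a norm. Let \<open>n\<close> be the least
  one. If a prime \<open>p\<close> divided \<open>n = p * m\<close>, then multiplying a relation \<open>1 \<in> (b, q, p)\<close> by \<open>m\<close> would put
  the smaller number \<open>m\<close> into the ideal; so \<open>n = 1\<close>.
\<close>
lemma unimodular_iff_not_bad:
  assumes b: "b \<in> \<O>" and q: "q \<in> \<O>"
  shows "unimodular b q \<longleftrightarrow> (\<forall>p. prime p \<longrightarrow> \<not> bad_at p b q)"
proof
  assume "unimodular b q"
  then obtain x y where "x \<in> \<O>" "y \<in> \<O>" "b * x + q * y = 1" by (auto simp: unimodular_def)
  hence "\<And>p. b * x + q * y + of_nat p * 0 = 1" by simp
  thus "\<forall>p. prime p \<longrightarrow> \<not> bad_at p b q" unfolding bad_at_def using \<open>x \<in> \<O>\<close> \<open>y \<in> \<O>\<close> by blast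
next
  assume good: "\<forall>p. prime p \<longrightarrow> \<not> bad_at p b q"
  define I where "I = {b * x + q * y | x y. x \<in> \<O> \<and> y \<in> \<O>}"
  have I_add: "u + v \<in> I" if "u \<in> I" "v \<in> I" for u v
  proof -
    from that obtain x y x' y' where "u = b * x + q * y" "v = b * x' + q * y'"
      "x \<in> \<O>" "y \<in> \<O>" "x' \<in> \<O>" "y' \<in> \<O>" by (auto simp: I_def)
    hence "u + v = b * (x + x') + q * (y + y')" "x + x' \<in> \<O>" "y + y' \<in> \<O>"
      by (auto simp: algebra_simps)
    thus ?thesis unfolding I_def by blast
  qed
  have I_mult: "u * c \<in> I" if "u \<in> I" "c \<in> \<O>" for u c
  proof -
    from that obtain x y where "u = b * x + q * y" "x \<in> \<O>" "y \<in> \<O>" by (auto simp: I_def)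
    hence "u * c = b * (x * c) + q * (y * c)" "x * c \<in> \<O>" "y * c \<in> \<O>"
      using that by (auto simp: algebra_simps)
    thus ?thesis unfolding I_def by blast
  qed
  have bI: "b \<in> I" and qI: "q \<in> I"
    unfolding I_def by (rule CollectI, rule exI[of _ 1], rule exI[of _ 0], simp,
      rule CollectI, rule exI[of _ 0], rule exI[of _ 1], simp)
  have "\<exists>n>0. of_nat n \<in> I"
  proof -
    have "b \<noteq> 0 \<or> q \<noteq> 0"
    proof (rule ccontr)
      assume "\<not> (b \<noteq> 0 \<or> q \<noteq> 0)"
      then obtain z where z: "z \<in> \<O>" "2 * z = 1"
        using good[rule_format, of 2] by (auto simp: bad_at_def)
      hence "cmod (2 * z) = 1" by simp
      hence "cmod z = 1/2" by (simp add: norm_mult)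
      thus False using O_norm_ge_1[OF z(1)] by fastforce
    qed
    then obtain c where c: "c \<in> I" "c \<noteq> 0" "c \<in> \<O>" using bI qI b q by blast
    then obtain v where v: "c = emb v" by (auto simp: \<O>_def)
    have "c * cnj c \<in> I" using c I_mult O_cnj by blast
    moreover have "norm_form v > 0" using norm_form_pos[of v] c v emb_eq_0 by blast
    ultimately show ?thesis using emb_cnj[of v] v
      by (intro exI[of _ "nat (norm_form v)"]) simp
  qed
  define n where "n = (LEAST n. n > 0 \<and> of_nat n \<in> I)"
  have n: "n > 0" "of_nat n \<in> I"
    using LeastI_ex[OF \<open>\<exists>n>0. of_nat n \<in> I\<close>] by (auto simp: n_def)
  have least: "n \<le> m" if "m > 0" "of_nat m \<in> I" for m
    unfolding n_def using that by (intro Least_le) auto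
  have "n = 1"
  proof (rule ccontr)
    assume "n \<noteq> 1"
    then obtain p where p: "prime p" "p dvd n" using prime_factor_nat by blast
    then obtain m where m: "n = p * m" by auto
    obtain x y z where xyz: "x \<in> \<O>" "y \<in> \<O>" "z \<in> \<O>" "b * x + q * y + of_nat p * z = 1"
      using good[rule_format, OF p(1)] by (auto simp: bad_at_def)
    have "of_nat m = (b * x + q * y) * of_nat m + of_nat n * z"
    proof -
      have "of_nat m = (b * x + q * y + of_nat p * z) * of_nat m" by (simp add: xyz)
      thus ?thesis by (simp add: m algebra_simps)
    qed
    also have "\<dots> \<in> I"
      by (intro I_add I_mult n bI qI xyz O_of_nat)
    finally have "of_nat m \<in> I" .
    moreover have "m > 0" using n m by simp
    ultimately have "n \<le> m" by (rule least[rotated])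
    moreover have "p > 1" using p prime_gt_1_nat by blast
    ultimately show False using m n by simp
  qed
  hence "1 \<in> I" using n(2) by simp
  then obtain x y where xy: "1 = b * x + q * y" "x \<in> \<O>" "y \<in> \<O>"
    unfolding I_def by (elim CollectE exE conjE)
  show "unimodular b q"
    unfolding unimodular_def
    by (rule bexI[OF _ xy(2)], rule bexI[OF _ xy(3)], rule xy(1)[symmetric])
qed

lemma not_bad_1_0: "\<not> bad_at p 1 0"
  unfolding not_bad_at_iff
  by (rule bexI[OF _ O_1], rule bexI[OF _ O_0], rule bexI[OF _ O_0]) simp

lemma bad_at_cong:
  assumes "c \<in> \<O>" "d \<in> \<O>" "b' = b + of_nat p * c" "q' = q + of_nat p * d" "bad_at p b q"
  shows "bad_at p b' q'"
proof (rule ccontr)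
  assume "\<not> bad_at p b' q'"
  then obtain x y z where xyz: "x \<in> \<O>" "y \<in> \<O>" "z \<in> \<O>" "b' * x + q' * y + of_nat p * z = 1"
    unfolding not_bad_at_iff by (elim bexE)
  have 1: "b * x + q * y + of_nat p * (c * x + d * y + z) = 1"
    using xyz(4) unfolding assms(3,4) by (simp add: algebra_simps)
  have 2: "c * x + d * y + z \<in> \<O>" by (intro O_add O_mult assms xyz)
  have "\<not> bad_at p b q" unfolding not_bad_at_iff
    by (rule bexI[OF _ xyz(1)], rule bexI[OF _ xyz(2)], rule bexI[OF _ 2], rule 1)
  thus False using assms(5) by simp
qed

end

section \<open>Integer points of periodic sets in boxes\<close>

type_synonym int4 = "(int \<times> int) \<times> (int \<times> int)"
type_synonym real4 = "(real \<times> real) \<times> (real \<times> real)"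

lemma card_int_open_interval:
  fixes x y :: real assumes "x \<le> y"
  shows "finite {j::int. x < of_int j \<and> of_int j < y}"
    and "\<bar>real (card {j::int. x < of_int j \<and> of_int j < y}) - (y - x)\<bar> \<le> 1"
proof -
  have eq: "{j::int. x < of_int j \<and> of_int j < y} = {\<lfloor>x\<rfloor> + 1..\<lceil>y\<rceil> - 1}"
    by (auto simp: floor_less_iff less_ceiling_iff) linarith+
  show "finite {j::int. x < of_int j \<and> of_int j < y}" unfolding eq by simp
  have card: "card {j::int. x < of_int j \<and> of_int j < y} = nat (\<lceil>y\<rceil> - 1 - \<lfloor>x\<rfloor>)"
    unfolding eq by simp
  have le: "\<lfloor>x\<rfloor> \<le> \<lceil>y\<rceil>" using assms by linarith
  show "\<bar>real (card {j::int. x < of_int j \<and> of_int j < y}) - (y - x)\<bar> \<le> 1"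
  proof (cases "\<lfloor>x\<rfloor> = \<lceil>y\<rceil>")
    case True
    hence "y = x" using assms by linarith
    thus ?thesis using card True by simp
  next
    case False
    hence "real (nat (\<lceil>y\<rceil> - 1 - \<lfloor>x\<rfloor>)) = of_int \<lceil>y\<rceil> - 1 - of_int \<lfloor>x\<rfloor>" using le by simp
    thus ?thesis unfolding card by linarith
  qed
qed

lemma card_int_progression:
  fixes x y :: real and M :: nat and r :: int assumes "x \<le> y" "M > 0"
  shows "finite {k::int. k mod int M = r mod int M \<and> x < of_int k \<and> of_int k < y}" (is "finite ?S")
    and "\<bar>real (card {k::int. k mod int M = r mod int M \<and> x < of_int k \<and> of_int k < y}) - (y - x) / real M\<bar> \<le> 1"
proof -
  define J where "J = {j::int. (x - of_int (r mod int M)) / M < of_int j \<and> of_int j < (y - of_int (r mod int M)) / M}"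
  have M: "real M > 0" using assms by simp
  have iff: "j \<in> J \<longleftrightarrow> x < of_int (r mod int M + int M * j) \<and> of_int (r mod int M + int M * j) < y" for j
    unfolding J_def mem_Collect_eq pos_divide_less_eq[OF M] pos_less_divide_eq[OF M]
    by (simp add: algebra_simps)
  have eq: "?S = (\<lambda>j. r mod int M + int M * j) ` J"
  proof (intro set_eqI iffI)
    fix k assume k: "k \<in> ?S"
    have kj: "k = r mod int M + int M * (k div int M)"
      using k mod_mult_div_eq[of k "int M"] by simp
    hence "k div int M \<in> J" unfolding iff using k by simp
    thus "k \<in> (\<lambda>j. r mod int M + int M * j) ` J" using kj by blast
  next
    fix k assume "k \<in> (\<lambda>j. r mod int M + int M * j) ` J"
    then obtain j where j: "j \<in> J" "k = r mod int M + int M * j" by blast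
    thus "k \<in> ?S" unfolding iff by simp
  qed
  have inj: "inj_on (\<lambda>j. r mod int M + int M * j) J" using assms(2) by (auto simp: inj_on_def)
  have le: "(x - of_int (r mod int M)) / M \<le> (y - of_int (r mod int M)) / M"
    using assms by (simp add: divide_right_mono)
  show "finite ?S" unfolding eq J_def using card_int_open_interval(1)[OF le] by simp
  have "card ?S = card J" unfolding eq by (rule card_image[OF inj])
  thus "\<bar>real (card ?S) - (y - x) / real M\<bar> \<le> 1"
    using card_int_open_interval(2)[OF le] by (simp add: J_def diff_divide_distrib)
qed

lemma card_int_progression_asymp:
  fixes a b :: real and M :: nat assumes "a \<le> b" "M > 0"
  shows "((\<lambda>N::real. real (card {k::int. k mod int M = r mod int M \<and> a * N < of_int k \<and> of_int k < b * N}) / N)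
    \<longlongrightarrow> (b - a) / M) at_top"
proof -
  define c where "c = (\<lambda>N::real. real (card {k::int. k mod int M = r mod int M \<and> a * N < of_int k \<and> of_int k < b * N}) / N)"
  have "((\<lambda>N. c N - (b - a) / M) \<longlongrightarrow> 0) at_top"
  proof (rule Lim_null_comparison[where g = "\<lambda>N. 1 / N"])
    show "\<forall>\<^sub>F N in at_top. norm (c N - (b - a) / real M) \<le> 1 / N"
      using eventually_gt_at_top[of 0]
    proof eventually_elim
      case (elim N)
      have "\<bar>c N * N - (b * N - a * N) / real M\<bar> \<le> 1"
        using card_int_progression(2)[of "a * N" "b * N" M r] assms elim
        by (simp add: c_def mult_right_mono)
      also have "c N * N - (b * N - a * N) / real M = N * (c N - (b - a) / real M)"
        by (simp add: algebra_simps diff_divide_distrib)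
      finally have "N * \<bar>c N - (b - a) / real M\<bar> \<le> 1" using elim by (simp add: abs_mult)
      thus ?case using elim by (simp add: pos_le_divide_eq mult.commute)
    qed
    show "((\<lambda>N::real. 1 / N) \<longlongrightarrow> 0) at_top" by real_asymp
  qed
  thus ?thesis unfolding c_def by (simp add: LIM_zero_iff)
qed

definition scale4 :: "real \<Rightarrow> int4 \<Rightarrow> real4"
  where "scale4 N v = ((of_int (fst (fst v)) / N, of_int (snd (fst v)) / N),
                       (of_int (fst (snd v)) / N, of_int (snd (snd v)) / N))"

definition mod4 :: "nat \<Rightarrow> int4 \<Rightarrow> int4"
  where "mod4 M v = ((fst (fst v) mod int M, snd (fst v) mod int M),
                     (fst (snd v) mod int M, snd (snd v) mod int M))"

definition cube4 :: "nat \<Rightarrow> int4 set"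
  where "cube4 M = ({0..<int M} \<times> {0..<int M}) \<times> ({0..<int M} \<times> {0..<int M})"

definition box4 :: "real4 \<Rightarrow> real4 \<Rightarrow> bool"
  where "box4 a b \<longleftrightarrow> fst (fst a) \<le> fst (fst b) \<and> snd (fst a) \<le> snd (fst b) \<and>
     fst (snd a) \<le> fst (snd b) \<and> snd (snd a) \<le> snd (snd b)"

definition vol4 :: "real4 \<Rightarrow> real4 \<Rightarrow> real"
  where "vol4 a b = (fst (fst b) - fst (fst a)) * (snd (fst b) - snd (fst a)) *
     (fst (snd b) - fst (snd a)) * (snd (snd b) - snd (snd a))"

lemma finite_cube4: "finite (cube4 M)" by (simp add: cube4_def)

lemma mod4_in_cube4: "M > 0 \<Longrightarrow> mod4 M v \<in> cube4 M" by (simp add: mod4_def cube4_def)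

lemma mod4_cube4: "v \<in> cube4 M \<Longrightarrow> mod4 M v = v" by (auto simp: mod4_def cube4_def)

lemma mod4_mod4: "m dvd M \<Longrightarrow> mod4 m (mod4 M v) = mod4 m v"
  by (simp add: mod4_def mod_mod_cancel)

lemma card_residue_box:
  fixes a b :: real4 and R :: int4
  assumes ab: "box4 a b" and M: "M > 0"
  defines "C \<equiv> \<lambda>N. {v. mod4 M v = mod4 M R \<and> scale4 N v \<in> box a b}"
  shows "N > 0 \<Longrightarrow> finite (C N)"
    and "((\<lambda>N. real (card (C N)) / N ^ 4) \<longlongrightarrow> vol4 a b / real M ^ 4) at_top"
proof -
  define I where "I = (\<lambda>r x y N. {k::int. k mod int M = r mod int M \<and> x * N < of_int k \<and> of_int k < y * (N::real)})"
  have C: "C N = (I (fst (fst R)) (fst (fst a)) (fst (fst b)) N \<times> I (snd (fst R)) (snd (fst a)) (snd (fst b)) N) \<times>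
    (I (fst (snd R)) (fst (snd a)) (fst (snd b)) N \<times> I (snd (snd R)) (snd (snd a)) (snd (snd b)) N)"
    if "N > 0" for N
    using that by (auto simp: C_def I_def mod4_def scale4_def box_prod box_real mem_Times_iff
      pos_less_divide_eq pos_divide_less_eq)
  show "finite (C N)" if "N > 0"
    unfolding C[OF that] I_def using ab M that
    by (intro finite_cartesian_product card_int_progression(1)) (auto simp: box4_def intro!: mult_right_mono)
  have "((\<lambda>N. (real (card (I (fst (fst R)) (fst (fst a)) (fst (fst b)) N)) / N) *
      (real (card (I (snd (fst R)) (snd (fst a)) (snd (fst b)) N)) / N) *
      (real (card (I (fst (snd R)) (fst (snd a)) (fst (snd b)) N)) / N) *
      (real (card (I (snd (snd R)) (snd (snd a)) (snd (snd b)) N)) / N))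
    \<longlongrightarrow> (fst (fst b) - fst (fst a)) / M * ((snd (fst b) - snd (fst a)) / M) *
     ((fst (snd b) - fst (snd a)) / M) * ((snd (snd b) - snd (snd a)) / M)) at_top"
    unfolding I_def using ab M
    by (intro tendsto_mult card_int_progression_asymp) (auto simp: box4_def)
  also have "(fst (fst b) - fst (fst a)) / M * ((snd (fst b) - snd (fst a)) / M) *
     ((fst (snd b) - fst (snd a)) / M) * ((snd (snd b) - snd (snd a)) / M) = vol4 a b / real M ^ 4"
    by (simp add: vol4_def power4_eq_xxxx)
  finally show "((\<lambda>N. real (card (C N)) / N ^ 4) \<longlongrightarrow> vol4 a b / real M ^ 4) at_top"
  proof (rule Lim_transform_eventually)
    show "\<forall>\<^sub>F N in at_top. (real (card (I (fst (fst R)) (fst (fst a)) (fst (fst b)) N)) / N) *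
      (real (card (I (snd (fst R)) (snd (fst a)) (snd (fst b)) N)) / N) *
      (real (card (I (fst (snd R)) (fst (snd a)) (fst (snd b)) N)) / N) *
      (real (card (I (snd (snd R)) (snd (snd a)) (snd (snd b)) N)) / N) = real (card (C N)) / N ^ 4"
      using eventually_gt_at_top[of 0]
      by eventually_elim (simp add: C card_cartesian_product power4_eq_xxxx)
  qed
qed

definition periodic4 :: "nat \<Rightarrow> int4 set \<Rightarrow> bool"
  where "periodic4 M S \<longleftrightarrow> (\<forall>v. v \<in> S \<longleftrightarrow> mod4 M v \<in> S)"

lemma periodic4D: "periodic4 M S \<Longrightarrow> mod4 M v \<in> S \<longleftrightarrow> v \<in> S"
  unfolding periodic4_def by blast

definition density4 :: "nat \<Rightarrow> int4 set \<Rightarrow> real"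
  where "density4 M S = card (S \<inter> cube4 M) / real M ^ 4"

lemma periodic_box_count:
  assumes ab: "box4 a b" and M: "M > 0" and S: "periodic4 M S"
  shows "N > 0 \<Longrightarrow> finite {v\<in>S. scale4 N v \<in> box a b}"
    and "((\<lambda>N. real (card {v\<in>S. scale4 N v \<in> box a b}) / N ^ 4) \<longlongrightarrow> density4 M S * vol4 a b) at_top"
proof -
  define C where "C = (\<lambda>R N. {v. mod4 M v = mod4 M R \<and> scale4 N v \<in> box a b})"
  have U: "{v\<in>S. scale4 N v \<in> box a b} = (\<Union>R\<in>S \<inter> cube4 M. C R N)" for N
  proof (intro set_eqI iffI)
    fix v assume "v \<in> {v\<in>S. scale4 N v \<in> box a b}"
    moreover from this have "mod4 M v \<in> S \<inter> cube4 M" using M mod4_in_cube4 by (simp add: periodic4D[OF S])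
    ultimately show "v \<in> (\<Union>R\<in>S \<inter> cube4 M. C R N)"
      by (auto simp: C_def mod4_mod4 intro!: bexI[of _ "mod4 M v"])
  next
    fix v assume "v \<in> (\<Union>R\<in>S \<inter> cube4 M. C R N)"
    thus "v \<in> {v\<in>S. scale4 N v \<in> box a b}" using periodic4D[OF S, of v] by (auto simp: C_def mod4_cube4)
  qed
  have fin: "finite (C R N)" if "N > 0" for R N
    unfolding C_def by (rule card_residue_box(1)[OF ab M that])
  show "finite {v\<in>S. scale4 N v \<in> box a b}" if "N > 0"
    unfolding U using fin[OF that] finite_cube4 by blast
  have card: "card {v\<in>S. scale4 N v \<in> box a b} = (\<Sum>R\<in>S \<inter> cube4 M. card (C R N))" if "N > 0" for N
    unfolding U
  proof (rule card_UN_disjoint)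
    show "\<forall>i\<in>S \<inter> cube4 M. \<forall>j\<in>S \<inter> cube4 M. i \<noteq> j \<longrightarrow> C i N \<inter> C j N = {}"
      by (auto simp: C_def mod4_cube4)
  qed (use fin[OF that] finite_cube4 in auto)
  have "((\<lambda>N. \<Sum>R\<in>S \<inter> cube4 M. real (card (C R N)) / N ^ 4) \<longlongrightarrow> (\<Sum>R\<in>S \<inter> cube4 M. vol4 a b / real M ^ 4)) at_top"
    unfolding C_def by (intro tendsto_sum card_residue_box(2)[OF ab M])
  also have "(\<Sum>R\<in>S \<inter> cube4 M. vol4 a b / real M ^ 4) = density4 M S * vol4 a b"
    by (simp add: density4_def)
  finally show "((\<lambda>N. real (card {v\<in>S. scale4 N v \<in> box a b}) / N ^ 4) \<longlongrightarrow> density4 M S * vol4 a b) at_top"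
  proof (rule Lim_transform_eventually)
    show "\<forall>\<^sub>F N in at_top. (\<Sum>R\<in>S \<inter> cube4 M. real (card (C R N)) / N ^ 4)
        = real (card {v\<in>S. scale4 N v \<in> box a b}) / N ^ 4"
      using eventually_gt_at_top[of 0] by eventually_elim (simp add: card sum_divide_distrib)
  qed
qed

text \<open>
  Both densities are the limit of the same normalized lattice point counts in the unit cube, which
  saves comparing the residue classes modulo \<open>M\<close> and \<open>M'\<close>.
\<close>
lemma density4_unique:
  assumes "M > 0" "M' > 0" "periodic4 M S" "periodic4 M' S"
  shows "density4 M S = density4 M' S"
proof -
  define a b :: real4 where "a = ((0,0),(0,0))" and "b = ((1,1),(1,1))"
  have ab: "box4 a b" "vol4 a b = 1" by (simp_all add: a_def b_def box4_def vol4_def)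
  have "density4 M S * vol4 a b = density4 M' S * vol4 a b"
    by (rule tendsto_unique[OF _ periodic_box_count(2)[OF ab(1) assms(1,3)]
      periodic_box_count(2)[OF ab(1) assms(2,4)]]) simp
  thus ?thesis by (simp add: ab)
qed

lemma periodic4_mono: "periodic4 M S \<Longrightarrow> M dvd M' \<Longrightarrow> periodic4 M' S"
  unfolding periodic4_def by (metis mod4_mod4)

lemma mod4_crt:
  assumes "coprime m n" "v \<in> cube4 (m * n)" "w \<in> cube4 (m * n)" "mod4 m v = mod4 m w" "mod4 n v = mod4 n w"
  shows "v = w"
proof -
  have *: "x = y" if "0 \<le> x" "x < int (m * n)" "0 \<le> y" "y < int (m * n)" "x mod int m = y mod int m"
    "x mod int n = y mod int n" for x y
  proof -
    have "int m dvd x - y" "int n dvd x - y" using that(5,6) by (simp_all only: mod_eq_dvd_iff)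
    hence "int (m * n) dvd x - y" using assms(1) by (simp add: divides_mult)
    hence "x mod int (m * n) = y mod int (m * n)" by (simp only: mod_eq_dvd_iff)
    thus ?thesis using that(1-4) by (simp only: mod_pos_pos_trivial)
  qed
  note bounds = assms(2,3)[unfolded cube4_def mem_Times_iff atLeastLessThan_iff]
  note mods = assms(4,5)[unfolded mod4_def prod.inject]
  have "fst (fst v) = fst (fst w)" using bounds mods by (rule_tac *) blast+
  moreover have "snd (fst v) = snd (fst w)" using bounds mods by (rule_tac *) blast+
  moreover have "fst (snd v) = fst (snd w)" using bounds mods by (rule_tac *) blast+
  moreover have "snd (snd v) = snd (snd w)" using bounds mods by (rule_tac *) blast+
  ultimately show ?thesis by (intro prod_eqI)
qed

text \<open>
  A point of the cube of side \<open>m * n\<close> is determined by its residues modulo \<open>m\<close> and \<open>n\<close>, so the density of \<open>S \<inter> T\<close> is at most the product of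
  the densities.
\<close>
lemma density4_Diff_ge:
  assumes "coprime m n" "m > 0" "n > 0" and S: "periodic4 m S" and T: "periodic4 n T"
  shows "density4 (m * n) (S - T) \<ge> density4 m S * (1 - density4 n T)"
proof -
  have per: "periodic4 (m * n) S" "periodic4 (m * n) T"
    by (rule periodic4_mono[OF S], simp) (rule periodic4_mono[OF T], simp)
  let ?Q = "cube4 (m * n)"
  have "card (S \<inter> T \<inter> ?Q) \<le> card ((S \<inter> cube4 m) \<times> (T \<inter> cube4 n))"
  proof (rule card_inj_on_le[where f = "\<lambda>v. (mod4 m v, mod4 n v)"])
    show "inj_on (\<lambda>v. (mod4 m v, mod4 n v)) (S \<inter> T \<inter> ?Q)"
      by (intro inj_onI, rule mod4_crt[OF assms(1)]) (simp_all only: Int_iff prod.inject)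
    show "(\<lambda>v. (mod4 m v, mod4 n v)) ` (S \<inter> T \<inter> ?Q) \<subseteq> (S \<inter> cube4 m) \<times> (T \<inter> cube4 n)"
      using assms(2,3) by (auto simp: periodic4D[OF S] periodic4D[OF T] mod4_in_cube4)
  qed (simp add: finite_cube4)
  hence "real (card (S \<inter> T \<inter> ?Q)) \<le> real (card (S \<inter> cube4 m)) * real (card (T \<inter> cube4 n))"
    unfolding card_cartesian_product of_nat_mult[symmetric] of_nat_le_iff .
  hence 1: "real (card (S \<inter> T \<inter> ?Q)) / real (m * n) ^ 4 \<le> density4 m S * density4 n T"
    unfolding density4_def times_divide_times_eq power_mult_distrib[symmetric] of_nat_mult
    by (intro divide_right_mono) simp_all
  have "card (S \<inter> ?Q) = card ((S - T) \<inter> ?Q) + card (S \<inter> T \<inter> ?Q)"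
  proof -
    have "S \<inter> ?Q = (S - T) \<inter> ?Q \<union> S \<inter> T \<inter> ?Q" by blast
    hence "card (S \<inter> ?Q) = card ((S - T) \<inter> ?Q \<union> S \<inter> T \<inter> ?Q)" by (rule arg_cong)
    also have "\<dots> = card ((S - T) \<inter> ?Q) + card (S \<inter> T \<inter> ?Q)"
      by (rule card_Un_disjoint) (use finite_cube4 in blast)+
    finally show ?thesis .
  qed
  hence "density4 (m * n) S = density4 (m * n) (S - T) + real (card (S \<inter> T \<inter> ?Q)) / real (m * n) ^ 4"
    by (simp add: density4_def add_divide_distrib)
  moreover have "density4 (m * n) S = density4 m S"
    by (rule density4_unique[OF _ assms(2) per(1) S]) (use assms(2,3) in simp)
  ultimately show ?thesis using 1 unfolding right_diff_distrib mult_1_right by linarith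
qed

section \<open>Sieving pairs by small primes\<close>

context quadratic_lattice
begin

definition primitive4 :: "int4 set"
  where "primitive4 = {v. unimodular (emb (fst v)) (emb (snd v))}"

definition bad4 :: "nat \<Rightarrow> int4 set"
  where "bad4 p = {v. bad_at p (emb (fst v)) (emb (snd v))}"

definition sifted4 :: "nat \<Rightarrow> int4 set"
  where "sifted4 Y = {v. \<forall>p\<le>Y. prime p \<longrightarrow> v \<notin> bad4 p}"

lemma emb_mod: "emb (m, n) = emb (m mod int p, n mod int p) + of_nat p * emb (m div int p, n div int p)"
proof -
  have "(of_int m :: complex) = of_int (m mod int p) + of_nat p * of_int (m div int p)" for m
    by (metis mod_mult_div_eq of_int_add of_int_mult of_int_of_nat_eq)
  from this[of m] this[of n] show ?thesis unfolding emb_def fst_conv snd_conv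
    by (simp add: ring_distribs)
qed

lemma periodic_bad4: "periodic4 p (bad4 p)"
  unfolding periodic4_def
proof
  fix v :: int4
  obtain a b c d where v: "v = ((a, b), (c, d))" by (metis surj_pair)
  have 1: "emb (a, b) = emb (a mod int p, b mod int p) + of_nat p * emb (a div int p, b div int p)"
    by (rule emb_mod)
  have 2: "emb (c, d) = emb (c mod int p, d mod int p) + of_nat p * emb (c div int p, d div int p)"
    by (rule emb_mod)
  have 3: "emb (a mod int p, b mod int p) = emb (a, b) + of_nat p * (- emb (a div int p, b div int p))"
    using 1 by simp
  have 4: "emb (c mod int p, d mod int p) = emb (c, d) + of_nat p * (- emb (c div int p, d div int p))"
    using 2 by simp
  show "v \<in> bad4 p \<longleftrightarrow> mod4 p v \<in> bad4 p"
    unfolding v bad4_def mem_Collect_eq mod4_def fst_conv snd_conv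
    using bad_at_cong[OF emb_in emb_in 1 2] bad_at_cong[OF O_minus[OF emb_in] O_minus[OF emb_in] 3 4]
    by (rule iffI[rotated])
qed

lemma periodic_sifted4: "periodic4 (fact Y) (sifted4 Y)"
  unfolding periodic4_def
proof
  fix v
  have "mod4 (fact Y) v \<in> bad4 p \<longleftrightarrow> v \<in> bad4 p" if "prime p" "p \<le> Y" for p
  proof -
    have "p dvd fact Y" using that by (simp add: prime_dvd_fact_iff)
    hence "periodic4 (fact Y) (bad4 p)" using periodic_bad4 periodic4_mono by blast
    thus ?thesis by (rule periodic4D)
  qed
  thus "v \<in> sifted4 Y \<longleftrightarrow> mod4 (fact Y) v \<in> sifted4 Y"
    unfolding sifted4_def mem_Collect_eq by blast
qed

definition roots_mod :: "nat \<Rightarrow> int \<Rightarrow> int set"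
  where "roots_mod p n = {m\<in>{0..<int p}. int p dvd norm_form (m, n)}"

lemma finite_roots_mod: "finite (roots_mod p n)"
  unfolding roots_mod_def by (rule finite_subset[of _ "{0..<int p}"]) auto

text \<open>
  For fixed \<open>n\<close> the norm form is a monic quadratic polynomial in \<open>m\<close>, so two roots modulo a prime
  either agree or have sum \<open>- \<tau> * n\<close>.
\<close>
lemma card_roots_mod:
  assumes "prime p"
  shows "card (roots_mod p n) \<le> 2"
proof (cases "roots_mod p n = {}")
  case False
  let ?Z = "roots_mod p"
  from False obtain r where r: "r \<in> ?Z n" by blast
  have "?Z n \<subseteq> {r, (- r - \<tau> * n) mod int p}"
  proof
    fix m assume m: "m \<in> ?Z n"
    have "int p dvd norm_form (m, n) - norm_form (r, n)"
      using r m by (intro dvd_diff) (auto simp: roots_mod_def)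
    also have "norm_form (m, n) - norm_form (r, n) = (m - r) * (m - (- r - \<tau> * n))"
      by (simp add: norm_form_def algebra_simps)
    finally have "int p dvd m - r \<or> int p dvd m - (- r - \<tau> * n)"
      using assms(1) by (simp add: prime_dvd_mult_iff)
    hence "m mod int p = r mod int p \<or> m mod int p = (- r - \<tau> * n) mod int p"
      by (simp only: mod_eq_dvd_iff)
    thus "m \<in> {r, (- r - \<tau> * n) mod int p}" using r m by (auto simp: roots_mod_def)
  qed
  hence "card (?Z n) \<le> card {r, (- r - \<tau> * n) mod int p}" by (intro card_mono) auto
  also have "\<dots> \<le> 2" by (simp add: card_insert_if)
  finally show ?thesis .
qed simp

text \<open>
  Both entries of a bad pair have norm divisible by \<open>p\<close>, and each of them has at most two residues in
  the first coordinate for every residue in the second.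
\<close>
lemma density_bad4:
  assumes p: "prime p"
  shows "density4 p (bad4 p) \<le> 4 / real p ^ 2"
proof -
  define Z where "Z = roots_mod p"
  define W where "W = (\<Union>n\<in>{0..<int p}. Z n \<times> {n})"
  have finZ: "finite (Z n)" for n unfolding Z_def by (rule finite_roots_mod)
  have finW: "finite W" unfolding W_def using finZ by blast
  have "card W \<le> (\<Sum>n\<in>{0..<int p}. card (Z n \<times> {n}))"
    unfolding W_def by (rule card_UN_le) simp
  also have "\<dots> \<le> (\<Sum>n\<in>{0..<int p}. 2)"
    by (intro sum_mono) (simp add: card_cartesian_product Z_def card_roots_mod[OF p])
  finally have W: "card W \<le> 2 * p" by simp
  have "bad4 p \<inter> cube4 p \<subseteq> W \<times> W"
  proof
    fix v assume v: "v \<in> bad4 p \<inter> cube4 p"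
    hence "int p dvd norm_form (fst v)" "int p dvd norm_form (snd v)"
      using bad_at_dvd[OF p, of "fst v" "emb (snd v)"] bad_at_dvd[OF p, of "snd v" "emb (fst v)"]
        bad_at_sym[of p "emb (fst v)"] by (auto simp: bad4_def)
    thus "v \<in> W \<times> W" using v by (auto simp: W_def Z_def roots_mod_def cube4_def)
  qed
  hence "card (bad4 p \<inter> cube4 p) \<le> card (W \<times> W)" by (intro card_mono) (use finW in auto)
  also have "\<dots> \<le> (2 * p) * (2 * p)" unfolding card_cartesian_product by (intro mult_mono W) auto
  finally have "real (card (bad4 p \<inter> cube4 p)) \<le> real (4 * (p * p))" unfolding of_nat_le_iff by simp
  hence "density4 p (bad4 p) \<le> real (4 * (p * p)) / real p ^ 4"
    unfolding density4_def by (rule divide_right_mono) simp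
  also have "\<dots> = 4 / real p ^ 2" using prime_gt_0_nat[OF p] by (simp add: power4_eq_xxxx power2_eq_square)
  finally show ?thesis .
qed

definition sift_density :: "nat \<Rightarrow> real"
  where "sift_density Y = density4 (fact Y) (sifted4 Y)"

lemma density4_nonneg: "density4 M S \<ge> 0" by (simp add: density4_def)

lemma sift_density_Suc:
  "sift_density (Suc Y) \<le> sift_density Y"
  "sift_density (Suc Y) \<ge> sift_density Y * (1 - 4 / real (Suc Y) ^ 2)"
proof -
  have per: "periodic4 (fact (Suc Y)) (sifted4 Y)"
    by (rule periodic4_mono[OF periodic_sifted4]) simp
  have eq: "density4 (fact (Suc Y)) (sifted4 Y) = sift_density Y"
    unfolding sift_density_def by (rule density4_unique) (use per periodic_sifted4 in auto)
  have sub: "sifted4 (Suc Y) \<subseteq> sifted4 Y" by (auto simp: sifted4_def)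
  have "card (sifted4 (Suc Y) \<inter> cube4 (fact (Suc Y))) \<le> card (sifted4 Y \<inter> cube4 (fact (Suc Y)))"
    by (intro card_mono) (use sub finite_cube4 in auto)
  hence "density4 (fact (Suc Y)) (sifted4 (Suc Y)) \<le> density4 (fact (Suc Y)) (sifted4 Y)"
    unfolding density4_def by (intro divide_right_mono) auto
  thus "sift_density (Suc Y) \<le> sift_density Y" unfolding eq by (simp add: sift_density_def)
  show "sift_density (Suc Y) \<ge> sift_density Y * (1 - 4 / real (Suc Y) ^ 2)"
  proof (cases "prime (Suc Y)")
    case False
    hence "sifted4 (Suc Y) = sifted4 Y" by (auto simp: sifted4_def le_Suc_eq)
    hence "sift_density (Suc Y) = sift_density Y" using eq by (simp add: sift_density_def)
    moreover have "sift_density Y * (1 - 4 / real (Suc Y) ^ 2) \<le> sift_density Y * 1"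
      by (intro mult_left_mono) (auto simp: sift_density_def density4_nonneg)
    ultimately show ?thesis by simp
  next
    case True
    have "sifted4 (Suc Y) = sifted4 Y - bad4 (Suc Y)" using True by (auto simp: sifted4_def le_Suc_eq)
    moreover have "fact (Suc Y) = fact Y * Suc Y" by simp
    ultimately have "sift_density (Suc Y) = density4 (fact Y * Suc Y) (sifted4 Y - bad4 (Suc Y))"
      by (simp only: sift_density_def)
    also have "\<dots> \<ge> density4 (fact Y) (sifted4 Y) * (1 - density4 (Suc Y) (bad4 (Suc Y)))"
    proof (rule density4_Diff_ge)
      have "\<not> Suc Y dvd fact Y" using True by (simp add: prime_dvd_fact_iff)
      thus "coprime (fact Y) (Suc Y)" using True using prime_imp_coprime coprime_commute by blast
    qed (use periodic_sifted4 periodic_bad4 in auto)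
    finally have "sift_density Y * (1 - density4 (Suc Y) (bad4 (Suc Y))) \<le> sift_density (Suc Y)"
      by (simp only: sift_density_def)
    moreover have "sift_density Y * (1 - 4 / real (Suc Y) ^ 2) \<le> sift_density Y * (1 - density4 (Suc Y) (bad4 (Suc Y)))"
      by (intro mult_left_mono diff_left_mono density_bad4 True) (simp add: sift_density_def density4_nonneg)
    ultimately show ?thesis by linarith
  qed
qed

text \<open>
  The bound of \<open>4 / p\<^sup>2\<close> on the density of bad pairs is void for \<open>p = 2\<close>. That some residue class modulo \<open>2\<close>
  survives is shown by the pair \<open>(1, 0)\<close>.
\<close>
lemma sift_density_2: "sift_density 2 \<ge> 1 / 16"
proof -
  have "((1,0),(0,0)) \<in> sifted4 2 \<inter> cube4 (fact 2)"
    using not_bad_1_0 by (simp add: sifted4_def bad4_def emb_def cube4_def)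
  hence "card (sifted4 2 \<inter> cube4 (fact 2)) \<noteq> 0" using finite_cube4 by (auto simp: card_eq_0_iff)
  hence "card (sifted4 2 \<inter> cube4 (fact 2)) \<ge> 1" by linarith
  thus ?thesis unfolding sift_density_def density4_def by (simp add: power4_eq_xxxx)
qed

text \<open>
  The factors \<open>1 - 4 / k\<^sup>2 = (k - 2) * (k + 2) / k\<^sup>2\<close> are taken over all \<open>k \<ge> 3\<close> and not only over the
  primes, because their product then telescopes. It decreases to a positive limit.
\<close>
lemma sift_density_lower: "sift_density (n + 2) \<ge> (real n + 3) * (real n + 4) / (96 * (real n + 2) * (real n + 1))"
proof (induction n)
  case 0
  show ?case using sift_density_2 by (simp add: numeral_2_eq_2)
next
  case (Suc n)
  have "(real (Suc n) + 3) * (real (Suc n) + 4) / (96 * (real (Suc n) + 2) * (real (Suc n) + 1))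
    = (real n + 3) * (real n + 4) / (96 * (real n + 2) * (real n + 1)) * (1 - 4 / (real n + 3) ^ 2)"
  proof -
    have "real n + 1 > 0" "real n + 2 > 0" "real n + 3 > 0" by linarith+
    thus ?thesis by (simp add: divide_simps power2_eq_square) (simp add: algebra_simps)
  qed
  also have "\<dots> \<le> sift_density (n + 2) * (1 - 4 / (real n + 3) ^ 2)"
  proof (intro mult_right_mono Suc.IH)
    have "(real n + 3) ^ 2 \<ge> 3 ^ 2" by (intro power_mono) auto
    thus "0 \<le> 1 - 4 / (real n + 3)\<^sup>2" by (simp add: field_simps)
  qed
  also have "\<dots> \<le> sift_density (Suc n + 2)"
    using sift_density_Suc(2)[of "n + 2"] by (simp add: add.commute)
  finally show ?case .
qed

lemma sift_density_limit:
  obtains d where "d > 0" "sift_density \<longlonglongrightarrow> d"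
proof -
  have dec: "decseq sift_density" by (intro decseq_SucI sift_density_Suc(1))
  have lb: "sift_density (n + 2) \<ge> 1 / 96" for n
  proof -
    have "1 / 96 \<le> (real n + 3) * (real n + 4) / (96 * (real n + 2) * (real n + 1))"
      by (subst pos_le_divide_eq) (auto simp: algebra_simps intro!: add_pos_nonneg)
    thus ?thesis using sift_density_lower[of n] by linarith
  qed
  have "0 \<le> sift_density n" for n by (simp add: sift_density_def density4_nonneg)
  then obtain d where d: "sift_density \<longlonglongrightarrow> d" using decseq_convergent[OF dec, of 0] by blast
  moreover have "(\<lambda>n. sift_density (n + 2)) \<longlonglongrightarrow> d" using d by (rule LIMSEQ_ignore_initial_segment)
  hence "1 / 96 \<le> d" by (rule LIMSEQ_le_const) (use lb in blast)
  ultimately show ?thesis using that[of d] by simp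
qed

end

section \<open>Pairs that are bad at a large prime\<close>

lemma sum_inverse_squares_tail:
  assumes "Y \<ge> 1"
  shows "(\<Sum>k\<in>{Y<..n}. 1 / real k ^ 2) \<le> 1 / real Y"
proof (cases "n \<le> Y")
  case True
  thus ?thesis by simp
next
  case False
  have "(\<Sum>k\<in>{Y<..Y + m}. 1 / real k ^ 2) \<le> 1 / real Y - 1 / real (Y + m)" for m
  proof (induction m)
    case (Suc m)
    have "(\<Sum>k\<in>{Y<..Y + Suc m}. 1 / real k ^ 2) = (\<Sum>k\<in>{Y<..Y + m}. 1 / real k ^ 2) + 1 / real (Y + Suc m) ^ 2"
    proof -
      have "{Y<..Y + Suc m} = insert (Y + Suc m) {Y<..Y + m}" by auto
      thus ?thesis by (simp add: add.commute)
    qed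
    also have "\<dots> \<le> 1 / real Y - 1 / real (Y + m) + 1 / real (Y + Suc m) ^ 2"
      using Suc.IH by simp
    also have "1 / real (Y + Suc m) ^ 2 \<le> 1 / real (Y + m) - 1 / real (Y + Suc m)"
    proof -
      define k where "k = real (Y + m)"
      have k: "k > 0" "real (Y + Suc m) = k + 1" using assms by (auto simp: k_def)
      have "1 / (k + 1) ^ 2 \<le> 1 / (k * (k + 1))"
        using k(1) by (intro divide_left_mono) (auto simp: power2_eq_square)
      also have "\<dots> = 1 / k - 1 / (k + 1)" using k(1) by (simp add: field_simps)
      finally show ?thesis unfolding k(2) k_def .
    qed
    finally show ?case by simp
  qed simp
  from this[of "n - Y"] have "(\<Sum>k\<in>{Y<..n}. 1 / real k ^ 2) \<le> 1 / real Y - 1 / real n"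
    using False by simp
  thus ?thesis by (rule order_trans) simp
qed

text \<open>
  Three different primes above \<open>X\<close> have product larger than \<open>X\<^sup>3 > c * X\<^sup>2\<close>.
\<close>
lemma card_large_prime_divisors:
  fixes n :: int and c X :: real
  assumes "n > 0" "of_int n \<le> c * X ^ 2" "X > c" "X \<ge> 1"
  shows "finite {p::nat. prime p \<and> X < real p \<and> int p dvd n}" (is "finite ?P")
    and "card {p::nat. prime p \<and> X < real p \<and> int p dvd n} \<le> 2"
proof -
  have "?P \<subseteq> {..nat n}"
  proof
    fix p assume "p \<in> ?P"
    hence "int p \<le> n" using zdvd_imp_le[of "int p" n] assms(1) by blast
    thus "p \<in> {..nat n}" by simp
  qed
  thus fin: "finite ?P" by (rule finite_subset) simp
  show "card ?P \<le> 2"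
  proof (rule ccontr)
    assume "\<not> card ?P \<le> 2"
    hence "3 \<le> card ?P" by simp
    then obtain T where T: "T \<subseteq> ?P" "card T = 3" "finite T" by (rule obtain_subset_with_card_n)
    then obtain p q r where pqr: "T = {p, q, r}" "p \<noteq> q" "p \<noteq> r" "q \<noteq> r"
      unfolding card_3_iff by blast
    have pr: "prime p" "prime q" "prime r" "X < p" "X < q" "X < r" "int p dvd n" "int q dvd n" "int r dvd n"
      using T pqr by auto
    have "coprime (int p) (int q)" "coprime (int (p * q)) (int r)"
      using pr pqr by (simp_all add: primes_coprime)
    moreover have "int (p * q) dvd n"
      unfolding of_nat_mult by (rule divides_mult[OF pr(7,8) \<open>coprime (int p) (int q)\<close>])
    ultimately have "int (p * q) * int r dvd n" by (intro divides_mult pr(9))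
    hence "int (p * q) * int r \<le> n" using assms(1) by (rule zdvd_imp_le)
    hence "real_of_int (int (p * q) * int r) \<le> of_int n" by (simp only: of_int_le_iff)
    hence 1: "real p * real q * real r \<le> of_int n" by (simp only: of_int_mult of_int_of_nat_eq of_nat_mult)
    have 2: "X * X \<le> real p * real q"
      by (rule mult_mono) (use pr(4,5) assms(4) in linarith)+
    have 3: "X * X * X \<le> real p * real q * real r"
      by (rule mult_mono[OF 2]) (use pr(6) assms(4) in simp_all)
    have "X * X ^ 2 \<le> c * X ^ 2"
      using 1 3 assms(2) unfolding power2_eq_square mult.assoc by linarith
    moreover have "X ^ 2 > 0" using assms(4) by simp
    ultimately have "X \<le> c" by (rule mult_right_le_imp_le)
    thus False using assms(3) by linarith
  qed
qed

lemma card_UN_le_real: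
  assumes "finite I" "\<And>i. i \<in> I \<Longrightarrow> finite (A i)" "\<And>i. i \<in> I \<Longrightarrow> real (card (A i)) \<le> b i"
  shows "real (card (\<Union>i\<in>I. A i)) \<le> sum b I"
proof -
  have "real (card (\<Union>i\<in>I. A i)) \<le> real (\<Sum>i\<in>I. card (A i))"
    unfolding of_nat_le_iff by (rule card_UN_le[OF assms(1)])
  also have "\<dots> \<le> sum b I" by (simp add: sum_mono assms(3))
  finally show ?thesis .
qed

lemma finite_box2: "finite {b::int \<times> int. \<bar>of_int (fst b)\<bar> < X \<and> \<bar>of_int (snd b)\<bar> < (X::real)}"
    (is "finite ?A")
  and card_box2: "X \<ge> 1 \<Longrightarrow> real (card {b::int \<times> int. \<bar>of_int (fst b)\<bar> < X \<and> \<bar>of_int (snd b)\<bar> < X}) \<le> (3 * X) ^ 2"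
proof -
  let ?I = "{j::int. - X < of_int j \<and> of_int j < X}"
  have eq: "?A = ?I \<times> ?I" by (auto simp: abs_less_iff)
  have fin: "finite ?I"
  proof (cases "X > 0")
    case True thus ?thesis by (intro card_int_open_interval(1)) simp
  next
    case False
    hence empty: "?I = {}" by auto
    show ?thesis unfolding empty by simp
  qed
  thus "finite ?A" unfolding eq by simp
  assume X: "X \<ge> 1"
  have "real (card ?I) \<le> 2 * X + 1" using card_int_open_interval(2)[of "- X" X] X by linarith
  hence "real (card ?I) \<le> 3 * X" using X by linarith
  hence "real (card ?I) * real (card ?I) \<le> (3 * X) * (3 * X)" using X by (intro mult_mono) auto
  thus "real (card ?A) \<le> (3 * X) ^ 2" unfolding eq by (simp add: card_cartesian_product power2_eq_square)
qed

context quadratic_lattice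
begin

definition divisible_box :: "nat \<Rightarrow> real \<Rightarrow> (int \<times> int) set"
  where "divisible_box p X = {b. \<bar>of_int (fst b)\<bar> < X \<and> \<bar>of_int (snd b)\<bar> < X \<and> int p dvd norm_form b}"

lemma finite_divisible_box: "finite (divisible_box p X)"
  unfolding divisible_box_def by (rule finite_subset[OF _ finite_box2[of X]]) auto

lemma card_divisible_box:
  assumes p: "prime p" and X: "X \<ge> 1"
  shows "real (card (divisible_box p X)) \<le> 3 * X * (2 * (2 * X / p + 1))"
proof -
  let ?I = "{j::int. - X < of_int j \<and> of_int j < X}"
  let ?K = "\<lambda>r. {m::int. m mod int p = r mod int p \<and> - X < of_int m \<and> of_int m < X}"
  have p0: "p > 0" using p prime_gt_0_nat by blast
  have finI: "finite ?I" and cI: "real (card ?I) \<le> 3 * X"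
    using card_int_open_interval[of "- X" X] X by (simp, linarith)
  have finK: "finite (?K r)" for r
    by (rule card_int_progression(1)) (use X p0 in simp_all)
  have cK: "real (card (?K r)) \<le> 2 * X / p + 1" for r
  proof -
    have "\<bar>real (card (?K r)) - (X - - X) / p\<bar> \<le> 1"
      by (rule card_int_progression(2)) (use X p0 in simp_all)
    moreover have "(X - - X) / p = 2 * X / p" by simp
    ultimately show ?thesis by linarith
  qed
  have sub: "divisible_box p X \<subseteq> (\<Union>n\<in>?I. \<Union>r\<in>roots_mod p n. ?K r \<times> {n})"
  proof
    fix b assume b: "b \<in> divisible_box p X"
    obtain m n where mn: "b = (m, n)" by (cases b)
    have "int p dvd norm_form (m mod int p, n)"
    proof -
      have "int p dvd m - m mod int p" by (rule dvd_minus_mod)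
      hence "int p dvd (m - m mod int p) * (m + m mod int p + \<tau> * n)" by (rule dvd_mult2)
      also have "\<dots> = norm_form (m, n) - norm_form (m mod int p, n)"
        by (simp add: norm_form_def algebra_simps)
      finally have 1: "int p dvd norm_form (m, n) - norm_form (m mod int p, n)" .
      have "int p dvd norm_form (m, n)" using b by (simp add: divisible_box_def mn)
      from dvd_diff[OF this 1] show ?thesis by simp
    qed
    hence "m mod int p \<in> roots_mod p n" using p0 by (simp add: roots_mod_def)
    thus "b \<in> (\<Union>n\<in>?I. \<Union>r\<in>roots_mod p n. ?K r \<times> {n})"
      using b by (auto simp: mn divisible_box_def abs_less_iff intro!: bexI[of _ n] bexI[of _ "m mod int p"])
  qed
  have inner: "real (card (\<Union>r\<in>roots_mod p n. ?K r \<times> {n})) \<le> 2 * (2 * X / p + 1)" for n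
  proof -
    have "real (card (\<Union>r\<in>roots_mod p n. ?K r \<times> {n})) \<le> (\<Sum>r\<in>roots_mod p n. 2 * X / p + 1)"
      using finK cK by (intro card_UN_le_real finite_roots_mod) (auto simp: card_cartesian_product)
    also have "\<dots> = real (card (roots_mod p n)) * (2 * X / p + 1)" by simp
    also have "\<dots> \<le> 2 * (2 * X / p + 1)"
      using card_roots_mod[OF p, of n] X by (intro mult_right_mono) auto
    finally show ?thesis .
  qed
  have finU: "finite (\<Union>r\<in>roots_mod p n. ?K r \<times> {n})" for n
    by (intro finite_UN_I finite_roots_mod finite_cartesian_product finK finite.intros)
  have "real (card (divisible_box p X)) \<le> real (card (\<Union>n\<in>?I. \<Union>r\<in>roots_mod p n. ?K r \<times> {n}))"
    unfolding of_nat_le_iff by (rule card_mono[OF _ sub]) (intro finite_UN_I finI finU)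
  also have "\<dots> \<le> (\<Sum>n\<in>?I. 2 * (2 * X / p + 1))"
    by (intro card_UN_le_real finI finU inner)
  also have "\<dots> = real (card ?I) * (2 * (2 * X / p + 1))" by simp
  also have "\<dots> \<le> 3 * X * (2 * (2 * X / p + 1))" using X cI by (intro mult_right_mono) auto
  finally show ?thesis .
qed

text \<open>
  The pairs with second entry \<open>0\<close> are left out because the norm \<open>0\<close> is divisible by every prime. There
  are only \<open>O(X\<^sup>2)\<close> of them in the box.
\<close>
definition tail4 :: "real \<Rightarrow> nat \<Rightarrow> int4 set"
  where "tail4 X Y = {v. \<bar>of_int (fst (fst v))\<bar> < X \<and> \<bar>of_int (snd (fst v))\<bar> < X \<and>
     \<bar>of_int (fst (snd v))\<bar> < X \<and> \<bar>of_int (snd (snd v))\<bar> < X \<and> snd v \<noteq> (0, 0) \<and>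
     (\<exists>p>Y. prime p \<and> v \<in> bad4 p)}"

text \<open>
  The primes are split at \<open>X\<close>. A prime \<open>p \<le> X\<close> admits at most \<open>(18 * X\<^sup>2 / p)\<^sup>2\<close> pairs, and the sum of
  \<open>1 / p\<^sup>2\<close> over \<open>p > Y\<close> is at most \<open>1 / Y\<close>. For \<open>p > X\<close> that sum over \<open>p\<close> would be useless, since the
  bound for one prime no longer decreases; instead every second entry \<open>q\<close> has at most two prime
  divisors of its norm beyond \<open>X\<close>, each allowing \<open>O(X)\<close> first entries.
\<close>
lemma card_tail4:
  assumes X: "X \<ge> 1" "X > 1 + \<bar>of_int \<tau>\<bar> + \<bar>of_int \<nu>\<bar>" and Y: "Y \<ge> 1"
  shows "finite (tail4 X Y)" "real (card (tail4 X Y)) \<le> 324 * X ^ 4 / Y + 324 * X ^ 3"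
proof -
  let ?D = "\<lambda>p. divisible_box p X"
  define Q where "Q = {b::int \<times> int. (\<bar>of_int (fst b)\<bar> < X \<and> \<bar>of_int (snd b)\<bar> < X) \<and> b \<noteq> (0, 0)}"
  define L where "L = (\<lambda>q. {p::nat. prime p \<and> X < real p \<and> int p dvd norm_form q})"
  define S where "S = {p::nat. prime p \<and> p \<in> {Y<..nat \<lfloor>X\<rfloor>}}"
  \<comment> \<open>\<open>A\<close> collects the pairs bad at a prime in \<open>]Y, X]\<close>, \<open>B\<close> those bad at a prime beyond \<open>X\<close>.\<close>
  define A where "A = (\<Union>p\<in>S. ?D p \<times> ?D p)"
  define B where "B = (\<Union>q\<in>Q. \<Union>p\<in>L q. ?D p \<times> {q})"
  have finQ: "finite Q" unfolding Q_def by (rule finite_subset[OF _ finite_box2[of X]]) auto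
  have cQ: "real (card Q) \<le> (3 * X) ^ 2"
  proof -
    have "card Q \<le> card {b::int \<times> int. \<bar>of_int (fst b)\<bar> < X \<and> \<bar>of_int (snd b)\<bar> < X}"
      unfolding Q_def by (intro card_mono finite_box2) auto
    thus ?thesis using card_box2[OF X(1)] by linarith
  qed
  have L: "finite (L q)" "card (L q) \<le> 2" if "q \<in> Q" for q
  proof -
    have 1: "norm_form q > 0" using that by (intro norm_form_pos) (simp add: Q_def)
    have 2: "of_int (norm_form q) \<le> (1 + \<bar>of_int \<tau>\<bar> + \<bar>of_int \<nu>\<bar>) * X ^ 2"
    proof -
      define m n :: real where "m = of_int (fst q)" and "n = of_int (snd q)"
      have mn: "\<bar>m\<bar> \<le> X" "\<bar>n\<bar> \<le> X" using that by (auto simp: Q_def m_def n_def)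
      have a: "\<bar>m * m\<bar> \<le> X * X" "\<bar>m * n\<bar> \<le> X * X" "\<bar>n * n\<bar> \<le> X * X"
        unfolding abs_mult using mn X(1) by (intro mult_mono; linarith)+
      have "real_of_int (norm_form q) = m * m + of_int \<tau> * (m * n) + of_int \<nu> * (n * n)"
        by (simp add: norm_form_def m_def n_def)
      also have "\<dots> \<le> \<bar>m * m\<bar> + \<bar>of_int \<tau>\<bar> * \<bar>m * n\<bar> + \<bar>of_int \<nu>\<bar> * \<bar>n * n\<bar>"
        unfolding abs_mult[of "of_int \<tau>", symmetric] abs_mult[of "of_int \<nu>", symmetric] by linarith
      also have "\<dots> \<le> X * X + \<bar>of_int \<tau>\<bar> * (X * X) + \<bar>of_int \<nu>\<bar> * (X * X)"
        by (intro add_mono mult_left_mono a) auto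
      finally show ?thesis by (simp add: power2_eq_square algebra_simps)
    qed
    show "finite (L q)" "card (L q) \<le> 2"
      unfolding L_def by (rule card_large_prime_divisors[OF 1 2 X(2,1)])+
  qed
  have finS: "finite S" unfolding S_def by simp
  have finA: "finite A" unfolding A_def
    by (intro finite_UN_I finS finite_cartesian_product finite_divisible_box)
  have finB: "finite B" unfolding B_def
    by (intro finite_UN_I finQ L(1) finite_cartesian_product finite_divisible_box) auto
  have sub: "tail4 X Y \<subseteq> A \<union> B"
  proof
    fix v assume v: "v \<in> tail4 X Y"
    then obtain p where p: "p > Y" "prime p" "v \<in> bad4 p" by (auto simp: tail4_def)
    have dv: "int p dvd norm_form (fst v)" "int p dvd norm_form (snd v)"
      using bad_at_dvd[OF p(2), of "fst v" "emb (snd v)"] bad_at_dvd[OF p(2), of "snd v" "emb (fst v)"]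
        bad_at_sym[of p "emb (fst v)"] p(3) by (auto simp: bad4_def)
    hence D: "fst v \<in> ?D p" "snd v \<in> ?D p" using v by (auto simp: divisible_box_def tail4_def)
    have sQ: "snd v \<in> Q" using v by (auto simp: tail4_def Q_def)
    show "v \<in> A \<union> B"
    proof (cases "real p \<le> X")
      case True
      hence "p \<in> S" using p by (auto simp: S_def le_nat_floor)
      thus ?thesis using D unfolding A_def by (intro UnI1 UN_I[of p]) (auto simp: mem_Times_iff)
    next
      case False
      hence "p \<in> L (snd v)" using p dv by (auto simp: L_def)
      thus ?thesis using D sQ unfolding B_def by (intro UnI2 UN_I[of "snd v"] UN_I[of p]) (auto simp: mem_Times_iff)
    qed
  qed
  show "finite (tail4 X Y)" by (rule finite_subset[OF sub]) (use finA finB in simp)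
  have cA: "real (card A) \<le> 324 * X ^ 4 / Y"
  proof -
    have "real (card A) \<le> (\<Sum>p\<in>S. 324 * X ^ 4 * (1 / real p ^ 2))"
      unfolding A_def
    proof (rule card_UN_le_real[OF finS])
      fix p assume p: "p \<in> S"
      show "finite (?D p \<times> ?D p)" by (intro finite_cartesian_product finite_divisible_box)
      have pp: "prime p" "real p \<le> X" using p X(1) by (auto simp: S_def le_nat_iff le_floor_iff)
      have p0: "real p > 0" using pp prime_gt_0_nat by simp
      have "real (card (?D p)) \<le> 3 * X * (2 * (2 * X / p + 1))" by (rule card_divisible_box[OF pp(1) X(1)])
      also have "\<dots> \<le> 3 * X * (2 * (3 * X / p))"
        using pp(2) p0 X(1) by (intro mult_left_mono) (auto simp: field_simps)
      also have "\<dots> = 18 * X ^ 2 / p" by (simp add: power2_eq_square)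
      finally have d: "real (card (?D p)) \<le> 18 * X ^ 2 / p" .
      have "real (card (?D p \<times> ?D p)) = real (card (?D p)) * real (card (?D p))"
        by (simp add: card_cartesian_product)
      also have "\<dots> \<le> (18 * X ^ 2 / p) * (18 * X ^ 2 / p)" using p0 by (intro mult_mono d) auto
      also have "\<dots> = 324 * X ^ 4 * (1 / real p ^ 2)" by (simp add: power2_eq_square power4_eq_xxxx)
      finally show "real (card (?D p \<times> ?D p)) \<le> 324 * X ^ 4 * (1 / real p ^ 2)" .
    qed
    also have "\<dots> \<le> (\<Sum>p\<in>{Y<..nat \<lfloor>X\<rfloor>}. 324 * X ^ 4 * (1 / real p ^ 2))"
      by (intro sum_mono2) (auto simp: S_def)
    also have "\<dots> \<le> 324 * X ^ 4 * (1 / real Y)"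
      unfolding sum_distrib_left[symmetric] by (intro mult_left_mono sum_inverse_squares_tail Y) auto
    finally show ?thesis by simp
  qed
  have cB: "real (card B) \<le> 324 * X ^ 3"
  proof -
    have inner: "real (card (\<Union>p\<in>L q. ?D p \<times> {q})) \<le> 2 * (18 * X)" if q: "q \<in> Q" for q
    proof -
      have "real (card (\<Union>p\<in>L q. ?D p \<times> {q})) \<le> (\<Sum>p\<in>L q. 18 * X)"
      proof (rule card_UN_le_real[OF L(1)[OF q]])
        fix p assume p: "p \<in> L q"
        show "finite (?D p \<times> {q})" by (intro finite_cartesian_product finite_divisible_box finite.intros)
        have pp: "prime p" "X < real p" using p by (auto simp: L_def)
        have "X / p \<le> 1" using pp(2) X(1) by simp
        hence "3 * X * (2 * (2 * X / p + 1)) \<le> 3 * X * (2 * 3)" using X(1) by (intro mult_left_mono) auto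
        thus "real (card (?D p \<times> {q})) \<le> 18 * X"
          using card_divisible_box[OF pp(1) X(1)] by (simp add: card_cartesian_product)
      qed
      also have "\<dots> = real (card (L q)) * (18 * X)" by simp
      also have "\<dots> \<le> 2 * (18 * X)" using L(2)[OF q] X(1) by (intro mult_right_mono) auto
      finally show ?thesis .
    qed
    have "real (card B) \<le> (\<Sum>q\<in>Q. 2 * (18 * X))"
      unfolding B_def by (rule card_UN_le_real[OF finQ _ inner])
         (intro finite_UN_I L(1) finite_cartesian_product finite_divisible_box finite.intros)
    also have "\<dots> = real (card Q) * (2 * (18 * X))" by simp
    also have "\<dots> \<le> (3 * X) ^ 2 * (2 * (18 * X))" using cQ X(1) by (intro mult_right_mono) auto
    finally show ?thesis by (simp add: power2_eq_square power3_eq_cube)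
  qed
  have "card (tail4 X Y) \<le> card (A \<union> B)" by (rule card_mono[OF _ sub]) (use finA finB in simp)
  also have "\<dots> \<le> card A + card B" by (rule card_Un_le)
  finally have "real (card (tail4 X Y)) \<le> real (card A) + real (card B)" by linarith
  thus "real (card (tail4 X Y)) \<le> 324 * X ^ 4 / Y + 324 * X ^ 3" using cA cB by linarith
qed

end

section \<open>Equidistribution of unimodular pairs\<close>

lemma abs_components_le_norm:
  fixes a :: real4
  shows "\<bar>fst (fst a)\<bar> \<le> norm a" "\<bar>snd (fst a)\<bar> \<le> norm a"
    "\<bar>fst (snd a)\<bar> \<le> norm a" "\<bar>snd (snd a)\<bar> \<le> norm a"
proof -
  have 1: "norm (fst a) \<le> norm a" "norm (snd a) \<le> norm a"
    using norm_fst_le[of "fst a" "snd a"] norm_snd_le[of "snd a" "fst a"] by simp_all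
  have 2: "\<bar>fst x\<bar> \<le> norm x" "\<bar>snd x\<bar> \<le> norm x" for x :: "real \<times> real"
    using norm_fst_le[of "fst x" "snd x"] norm_snd_le[of "snd x" "fst x"] by simp_all
  show "\<bar>fst (fst a)\<bar> \<le> norm a" "\<bar>snd (fst a)\<bar> \<le> norm a"
    "\<bar>fst (snd a)\<bar> \<le> norm a" "\<bar>snd (snd a)\<bar> \<le> norm a"
    by (rule order_trans[OF 2(1) 1(1)] order_trans[OF 2(2) 1(1)]
        order_trans[OF 2(1) 1(2)] order_trans[OF 2(2) 1(2)])+
qed

lemma scale4_in_box_bound:
  assumes "scale4 N v \<in> box a b" "N > 0" and A: "norm a \<le> A" "norm b \<le> A"
  shows "\<bar>of_int (fst (fst v))\<bar> < A * N" "\<bar>of_int (snd (fst v))\<bar> < A * N"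
    "\<bar>of_int (fst (snd v))\<bar> < A * N" "\<bar>of_int (snd (snd v))\<bar> < A * N"
proof -
  have *: "\<bar>x\<bar> < A * N" if "l < x / N \<and> x / N < u" "\<bar>l\<bar> \<le> norm a" "\<bar>u\<bar> \<le> norm b" for x l u
  proof -
    have "\<bar>x / N\<bar> < A" using that A by linarith
    hence "\<bar>x\<bar> / N < A" using assms(2) by simp
    thus ?thesis using assms(2) by (simp add: pos_divide_less_eq)
  qed
  have c: "fst (fst a) < of_int (fst (fst v)) / N \<and> of_int (fst (fst v)) / N < fst (fst b)"
    "snd (fst a) < of_int (snd (fst v)) / N \<and> of_int (snd (fst v)) / N < snd (fst b)"
    "fst (snd a) < of_int (fst (snd v)) / N \<and> of_int (fst (snd v)) / N < fst (snd b)"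
    "snd (snd a) < of_int (snd (snd v)) / N \<and> of_int (snd (snd v)) / N < snd (snd b)"
    using assms(1) unfolding scale4_def box_prod box_real mem_Times_iff fst_conv snd_conv greaterThanLessThan_iff
    by blast+
  note n = abs_components_le_norm
  show "\<bar>of_int (fst (fst v))\<bar> < A * N" by (rule *[OF c(1) n(1) n(1)])
  show "\<bar>of_int (snd (fst v))\<bar> < A * N" by (rule *[OF c(2) n(2) n(2)])
  show "\<bar>of_int (fst (snd v))\<bar> < A * N" by (rule *[OF c(3) n(3) n(3)])
  show "\<bar>of_int (snd (snd v))\<bar> < A * N" by (rule *[OF c(4) n(4) n(4)])
qed

lemma finite_scale4_box: "N > 0 \<Longrightarrow> finite {v. scale4 N v \<in> box a b}"
proof -
  assume N: "N > 0"
  define A where "A = norm a + norm b"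
  have A: "norm a \<le> A" "norm b \<le> A" by (simp_all add: A_def)
  let ?S = "{b::int \<times> int. \<bar>of_int (fst b)\<bar> < A * N \<and> \<bar>of_int (snd b)\<bar> < A * N}"
  have "{v. scale4 N v \<in> box a b} \<subseteq> ?S \<times> ?S"
  proof
    fix v assume "v \<in> {v. scale4 N v \<in> box a b}"
    hence "scale4 N v \<in> box a b" by (rule CollectD)
    from scale4_in_box_bound[OF this N A] show "v \<in> ?S \<times> ?S"
      unfolding mem_Times_iff mem_Collect_eq by blast
  qed
  moreover have "finite (?S \<times> ?S)" by (intro finite_cartesian_product finite_box2)
  ultimately show ?thesis by (rule finite_subset)
qed

lemma measure_lborel_box4:
  assumes "box4 a b"
  shows "measure lborel (box a b) = vol4 a b"
proof -
  have "measure lborel (box a b) = measure lborel (cbox a b)"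
    by (simp only: measure_lborel_box_eq measure_lborel_cbox_eq)
  also have "\<dots> = vol4 a b"
    using assms
    by (cases a; cases b; cases "fst a"; cases "snd a"; cases "fst b"; cases "snd b")
       (simp add: content_Pair vol4_def box4_def mult.assoc)
  finally show ?thesis .
qed

text \<open>
  The covering lemma of gauge integration, applied to the gauge that is \<open>V\<close> at the points of \<open>V\<close>,
  writes \<open>V\<close> as a countable union of nonoverlapping closed boxes. Finitely many of them exhaust the
  measure up to \<open>e\<close>, and passing to the interiors makes them disjoint.
\<close>
lemma open_approx_boxes:
  fixes V :: "'a::euclidean_space set"
  assumes V: "open V" "bounded V" and e: "e > 0"
  obtains F :: "'a set set" where "finite F" "\<And>K. K \<in> F \<Longrightarrow> K \<subseteq> V \<and> (\<exists>c d. K = box c d \<and> box c d \<noteq> {})"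
    "pairwise disjnt F" "(\<Sum>K\<in>F. measure lborel K) > measure lborel V - e"
proof (cases "V = {}")
  case True
  thus ?thesis using that[of "{}"] e by simp
next
  case False
  obtain B where B: "V \<subseteq> cbox (- B) B" using bounded_subset_cbox_symmetric[OF V(2)] by blast
  have "box (- B) B \<noteq> {}"
  proof -
    have "V \<subseteq> interior (cbox (- B) B)" using V(1) B by (rule interior_maximal[rotated])
    thus ?thesis using False unfolding interior_cbox by blast
  qed
  moreover have "gauge (\<lambda>x. if x \<in> V then V else ball x 1)" using V(1) by (auto simp: gauge_def)
  ultimately obtain D where D: "countable D" "\<Union>D \<subseteq> cbox (- B) B"
    "\<And>K. K \<in> D \<Longrightarrow> interior K \<noteq> {} \<and> (\<exists>c d. K = cbox c d)"
    "pairwise (\<lambda>A B. interior A \<inter> interior B = {}) D"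
    "\<And>K. K \<in> D \<Longrightarrow> \<exists>x\<in>V \<inter> K. K \<subseteq> (if x \<in> V then V else ball x 1)" "V \<subseteq> \<Union>D"
    by (rule covering_lemma[OF B]) (rule that, assumption+)
  have KV: "K \<subseteq> V" if "K \<in> D" for K using D(5)[OF that] by auto
  have VD: "V = \<Union>D" using KV D(6) by blast
  have Dne: "D \<noteq> {}" using False VD by blast
  define k where "k = from_nat_into D"
  have kD: "k i \<in> D" for i unfolding k_def using from_nat_into[OF Dne] .
  have rk: "range k = D" unfolding k_def by (rule range_from_nat_into[OF Dne D(1)])
  define U where "U = (\<lambda>n. \<Union>i\<le>n. k i)"
  have kset: "k i \<in> sets lborel" "k i \<in> lmeasurable" for i
    using D(3)[OF kD[of i]] by auto
  have Uset: "U n \<in> sets lborel" for n unfolding U_def using kset by (intro sets.finite_UN) auto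
  have "(\<lambda>n. emeasure lborel (U n)) \<longlonglongrightarrow> emeasure lborel (\<Union>n. U n)"
  proof (rule Lim_emeasure_incseq)
    show "range U \<subseteq> sets lborel" using Uset by blast
    show "incseq U" unfolding U_def incseq_def by (intro allI impI UN_mono) auto
  qed
  moreover have UV: "(\<Union>n. U n) = V"
  proof -
    have "(\<Union>n. U n) = \<Union>(range k)" unfolding U_def by blast
    thus ?thesis using rk VD by simp
  qed
  ultimately have lim: "(\<lambda>n. emeasure lborel (U n)) \<longlonglongrightarrow> emeasure lborel V" by simp
  have Vfin: "emeasure lborel V \<noteq> \<top>"
  proof -
    have "emeasure lborel V \<le> emeasure lborel (cbox (- B) B)" by (intro emeasure_mono B) simp
    thus ?thesis using emeasure_lborel_cbox_finite[of "- B" B] by (auto simp: top_unique)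
  qed
  have "(\<lambda>n. measure lborel (U n)) \<longlonglongrightarrow> measure lborel V"
    using lim unfolding emeasure_eq_ennreal_measure[OF Vfin]
    unfolding measure_def by (rule tendsto_enn2real) simp
  hence "\<forall>\<^sub>F n in sequentially. measure lborel (U n) > measure lborel V - e"
    using e by (intro order_tendstoD(1)) auto
  then obtain n where n: "measure lborel (U n) > measure lborel V - e"
    using eventually_happens'[OF sequentially_bot] by blast
  define F where "F = interior ` k ` {..n}"
  have inj: "inj_on interior (k ` {..n})"
  proof (rule inj_onI)
    fix K L assume KL: "K \<in> k ` {..n}" "L \<in> k ` {..n}" "interior K = interior L"
    hence "K \<in> D" "L \<in> D" using kD by auto
    moreover from this have "interior K \<noteq> {}" using D(3) by blast
    ultimately show "K = L" using D(4) KL(3) unfolding pairwise_def by (metis Int_absorb)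
  qed
  have mint: "measure lborel (interior K) = measure lborel K" if "K \<in> D" for K
    using D(3)[OF that] by (auto simp: interior_cbox measure_lborel_box_eq measure_lborel_cbox_eq)
  have "measure lborel (U n) \<le> (\<Sum>K\<in>k ` {..n}. measure lborel K)"
  proof -
    have "U n = (\<Union>K\<in>k ` {..n}. K)" unfolding U_def by blast
    moreover have "measure lborel (\<Union>K\<in>k ` {..n}. K) \<le> (\<Sum>K\<in>k ` {..n}. measure lborel K)"
      by (intro measure_UNION_le) (use kset(1) in auto)
    ultimately show ?thesis by simp
  qed
  also have "\<dots> = (\<Sum>K\<in>F. measure lborel K)"
    unfolding F_def sum.reindex[OF inj] o_def by (intro sum.cong refl) (use mint kD in auto)
  finally have "(\<Sum>K\<in>F. measure lborel K) > measure lborel V - e" using n by linarith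
  moreover have "finite F" unfolding F_def by simp
  moreover have "K \<subseteq> V \<and> (\<exists>c d. K = box c d \<and> box c d \<noteq> {})" if KF: "K \<in> F" for K
  proof -
    obtain i where "K = interior (k i)" using KF unfolding F_def by blast
    then obtain L where L: "L \<in> D" "K = interior L" using kD by blast
    obtain c d where cd: "L = cbox c d" using D(3)[OF L(1)] by blast
    have "K = box c d" "box c d \<noteq> {}" using D(3)[OF L(1)] L cd by (auto simp: interior_cbox)
    moreover have "K \<subseteq> V" using KV[OF L(1)] interior_subset[of L] L(2) by blast
    ultimately show ?thesis by blast
  qed
  moreover have "pairwise disjnt F"
  proof (rule pairwiseI)
    fix A B assume "A \<in> F" "B \<in> F" "A \<noteq> B"
    then obtain i j where ij: "A = interior (k i)" "B = interior (k j)" unfolding F_def by blast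
    hence "k i \<noteq> k j" using \<open>A \<noteq> B\<close> by metis
    thus "disjnt A B" using D(4) kD unfolding ij disjnt_def pairwise_def by blast
  qed
  ultimately show ?thesis using that by blast
qed

context quadratic_lattice
begin

text \<open>
  A unimodular pair survives the sieve by the primes up to \<open>Y\<close>. Conversely a survivor that is not
  unimodular is bad at a prime beyond \<open>Y\<close> or has second entry \<open>0\<close>. So the count differs from that of a
  periodic set by \<open>O(N\<^sup>4 / Y) + O(N\<^sup>3)\<close>; first \<open>Y\<close> is chosen, then \<open>N\<close>.
\<close>
lemma primitive4_box_asymp:
  assumes d: "sift_density \<longlonglongrightarrow> d" and ab: "box4 a b"
  shows "((\<lambda>N. real (card {v\<in>primitive4. scale4 N v \<in> box a b}) / N ^ 4) \<longlongrightarrow> d * vol4 a b) at_top"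
proof (rule tendstoI)
  fix e :: real assume e: "e > 0"
  define A where "A = 1 + norm a + norm b"
  have A: "A \<ge> 1" unfolding A_def by simp
  define P where "P = (\<lambda>N. {v\<in>primitive4. scale4 N v \<in> box a b})"
  define S where "S = (\<lambda>Y N. {v\<in>sifted4 Y. scale4 N v \<in> box a b})"
  define err where "err = (\<lambda>N. 324 * A ^ 3 / N + 9 * A ^ 2 / N ^ 2)"
  have "\<forall>\<^sub>F Y in sequentially. dist (sift_density Y * vol4 a b) (d * vol4 a b) < e / 4"
    by (rule tendstoD[OF tendsto_mult[OF d tendsto_const]]) (use e in simp)
  moreover have "\<forall>\<^sub>F Y in sequentially. 324 * A ^ 4 / real Y < e / 4"
    by (rule order_tendstoD(2)[of _ 0]) (use e in \<open>real_asymp, simp\<close>)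
  ultimately have "\<forall>\<^sub>F Y in sequentially. Y \<ge> 1 \<and> dist (sift_density Y * vol4 a b) (d * vol4 a b) < e / 4
      \<and> 324 * A ^ 4 / real Y < e / 4"
    using eventually_ge_at_top[of 1] by eventually_elim blast
  then obtain Y where Y: "Y \<ge> 1" "dist (sift_density Y * vol4 a b) (d * vol4 a b) < e / 4"
      "324 * A ^ 4 / real Y < e / 4"
    using eventually_happens'[OF sequentially_bot] by blast
  have "((\<lambda>N. real (card (S Y N)) / N ^ 4) \<longlongrightarrow> sift_density Y * vol4 a b) at_top"
    unfolding S_def sift_density_def by (rule periodic_box_count(2)[OF ab _ periodic_sifted4]) simp
  hence "\<forall>\<^sub>F N in at_top. dist (real (card (S Y N)) / N ^ 4) (sift_density Y * vol4 a b) < e / 4"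
    by (rule tendstoD) (use e in simp)
  moreover have "\<forall>\<^sub>F N in at_top. err N < e / 4"
    unfolding err_def by (rule order_tendstoD(2)[of _ 0]) (use e in \<open>real_asymp, simp\<close>)
  ultimately show "\<forall>\<^sub>F N in at_top. dist (real (card (P N)) / N ^ 4) (d * vol4 a b) < e"
    using eventually_ge_at_top[of 1] eventually_gt_at_top[of "1 + \<bar>of_int \<tau>\<bar> + \<bar>of_int \<nu>\<bar>"]
  proof eventually_elim
    case (elim N)
    have N: "N > 0" "N \<ge> 1" using elim by simp_all
    have X: "A * N \<ge> 1" "A * N > 1 + \<bar>of_int \<tau>\<bar> + \<bar>of_int \<nu>\<bar>"
    proof -
      have "A * N \<ge> 1 * N" using A N by (intro mult_right_mono) auto
      thus "A * N \<ge> 1" "A * N > 1 + \<bar>of_int \<tau>\<bar> + \<bar>of_int \<nu>\<bar>" using elim by linarith+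
    qed
    have finS: "finite (S Y N)" unfolding S_def by (rule finite_subset[OF _ finite_scale4_box[OF N(1), of a b]]) blast
    have PS: "P N \<subseteq> S Y N"
    proof
      fix v assume v: "v \<in> P N"
      hence "unimodular (emb (fst v)) (emb (snd v))" unfolding P_def primitive4_def by blast
      hence "\<forall>p. prime p \<longrightarrow> v \<notin> bad4 p"
        unfolding unimodular_iff_not_bad[OF emb_in emb_in] bad4_def by blast
      thus "v \<in> S Y N" using v unfolding S_def P_def sifted4_def by blast
    qed
    define Z where "Z = {b::int \<times> int. \<bar>of_int (fst b)\<bar> < A * N \<and> \<bar>of_int (snd b)\<bar> < A * N} \<times> {(0::int, 0::int)}"
    have finZ: "finite Z" unfolding Z_def by (intro finite_cartesian_product finite_box2) simp
    have cZ: "real (card Z) \<le> (3 * (A * N)) ^ 2"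
      unfolding Z_def using card_box2[OF X(1)] by (simp add: card_cartesian_product)
    have sub: "S Y N \<subseteq> P N \<union> (tail4 (A * N) Y \<union> Z)"
    proof
      fix v assume v: "v \<in> S Y N"
      hence bx: "scale4 N v \<in> box a b" unfolding S_def by blast
      have "norm a \<le> A" "norm b \<le> A" by (simp_all add: A_def)
      note bd = scale4_in_box_bound[OF bx N(1) this]
      show "v \<in> P N \<union> (tail4 (A * N) Y \<union> Z)"
      proof (cases "v \<in> primitive4")
        case True
        thus ?thesis using bx unfolding P_def by blast
      next
        case False
        hence "\<exists>p. prime p \<and> v \<in> bad4 p"
          unfolding primitive4_def bad4_def mem_Collect_eq unimodular_iff_not_bad[OF emb_in emb_in] by blast
        then obtain p where p: "prime p" "v \<in> bad4 p" by blast
        hence "p > Y" using v unfolding S_def sifted4_def by (metis (no_types, lifting) mem_Collect_eq not_le)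
        show ?thesis
        proof (cases "snd v = (0, 0)")
          case True
          hence "v \<in> Z" using bd unfolding Z_def mem_Times_iff by simp
          thus ?thesis by blast
        next
          case False
          hence "v \<in> tail4 (A * N) Y" using bd p \<open>p > Y\<close> unfolding tail4_def by blast
          thus ?thesis by blast
        qed
      qed
    qed
    have finP: "finite (P N)" by (rule finite_subset[OF PS finS])
    have "card (P N) \<le> card (S Y N)" by (rule card_mono[OF finS PS])
    hence up: "real (card (P N)) / N ^ 4 \<le> real (card (S Y N)) / N ^ 4"
      using N by (intro divide_right_mono) auto
    have "card (S Y N) \<le> card (P N \<union> (tail4 (A * N) Y \<union> Z))"
      by (rule card_mono[OF _ sub]) (intro finite_UnI finP finZ card_tail4(1)[OF X Y(1)])
    also have "\<dots> \<le> card (P N) + (card (tail4 (A * N) Y) + card Z)"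
      by (meson card_Un_le add_left_mono order_trans)
    finally have "real (card (S Y N)) \<le> real (card (P N)) + (324 * (A * N) ^ 4 / Y + 324 * (A * N) ^ 3 + (3 * (A * N)) ^ 2)"
      using card_tail4(2)[OF X Y(1)] cZ by linarith
    hence "real (card (S Y N)) / N ^ 4 \<le> (real (card (P N)) + (324 * (A * N) ^ 4 / Y + 324 * (A * N) ^ 3 + (3 * (A * N)) ^ 2)) / N ^ 4"
      using N by (intro divide_right_mono) auto
    also have "\<dots> = real (card (P N)) / N ^ 4 + (324 * A ^ 4 / Y + err N)"
      using N by (simp add: err_def field_simps power2_eq_square power3_eq_cube power4_eq_xxxx)
    finally have lo: "real (card (S Y N)) / N ^ 4 \<le> real (card (P N)) / N ^ 4 + (324 * A ^ 4 / Y + err N)" .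
    show ?case using up lo elim(1,2) Y(2,3) unfolding dist_real_def P_def[symmetric] by linarith
  qed
qed

lemma primitive4_open_liminf:
  assumes d: "sift_density \<longlonglongrightarrow> d" "d > 0" and V: "open V" "bounded V" and c: "c < d * measure lborel V"
  shows "\<forall>\<^sub>F N in at_top. real (card {v\<in>primitive4. scale4 N v \<in> V}) / N ^ 4 > c"
proof -
  define e where "e = measure lborel V - c / d"
  have "e > 0" using c d(2) by (simp add: e_def field_simps)
  obtain F where F: "finite F" "\<And>K. K \<in> F \<Longrightarrow> K \<subseteq> V \<and> (\<exists>c d. K = box c d \<and> box c d \<noteq> {})"
    "pairwise disjnt F" "(\<Sum>K\<in>F. measure lborel K) > measure lborel V - e"
    using open_approx_boxes[OF V \<open>e > 0\<close>] by blast
  have "c < d * (\<Sum>K\<in>F. measure lborel K)" using F(4) d(2) by (simp add: e_def field_simps)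
  also have "\<dots> = (\<Sum>K\<in>F. d * measure lborel K)" by (rule sum_distrib_left)
  finally have c': "c < (\<Sum>K\<in>F. d * measure lborel K)" .
  have "((\<lambda>N. \<Sum>K\<in>F. real (card {v\<in>primitive4. scale4 N v \<in> K}) / N ^ 4) \<longlongrightarrow> (\<Sum>K\<in>F. d * measure lborel K)) at_top"
  proof (rule tendsto_sum)
    fix K assume "K \<in> F"
    then obtain a b where K: "K = box a b" "box a b \<noteq> {}" using F(2) by blast
    have "box4 a b" using K(2) unfolding box4_def box_prod box_real by (auto simp: Times_eq_cancel2)
    from primitive4_box_asymp[OF d(1) this] measure_lborel_box4[OF this]
    show "((\<lambda>N. real (card {v\<in>primitive4. scale4 N v \<in> K}) / N ^ 4) \<longlongrightarrow> d * measure lborel K) at_top"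
      unfolding K(1) by simp
  qed
  from order_tendstoD(1)[OF this c'] eventually_gt_at_top[of 0] show ?thesis
  proof eventually_elim
    case (elim N)
    obtain B where "V \<subseteq> box (- B) B" using bounded_subset_box_symmetric[OF V(2)] by blast
    hence finV: "finite {v\<in>primitive4. scale4 N v \<in> V}"
      by (intro finite_subset[OF _ finite_scale4_box[OF elim(2), of "- B" B]]) blast
    have "(\<Sum>K\<in>F. card {v\<in>primitive4. scale4 N v \<in> K}) = card (\<Union>K\<in>F. {v\<in>primitive4. scale4 N v \<in> K})"
    proof (rule card_UN_disjoint[symmetric, OF F(1)])
      show "\<forall>i\<in>F. finite {v \<in> primitive4. scale4 N v \<in> i}"
        using F(2) by (intro ballI finite_subset[OF _ finV]) blast
      show "\<forall>i\<in>F. \<forall>j\<in>F. i \<noteq> j \<longrightarrow> {v \<in> primitive4. scale4 N v \<in> i} \<inter> {v \<in> primitive4. scale4 N v \<in> j} = {}"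
        using F(3) unfolding pairwise_def disjnt_def by blast
    qed
    also have "\<dots> \<le> card {v\<in>primitive4. scale4 N v \<in> V}"
      by (rule card_mono[OF finV]) (use F(2) in blast)
    finally have "real (\<Sum>K\<in>F. card {v\<in>primitive4. scale4 N v \<in> K}) / N ^ 4 \<le> real (card {v\<in>primitive4. scale4 N v \<in> V}) / N ^ 4"
      using elim(2) by (intro divide_right_mono of_nat_mono) auto
    thus ?case using elim(1) by (simp add: sum_divide_distrib)
  qed
qed

text \<open>
  Equidistribution for a set \<open>C\<close> whose boundary is negligible: open sets inside \<open>C\<close> and inside its
  complement in the box fill the whole measure of the box. The lower bound of \<open>primitive4_open_liminf\<close> for the first
  set bounds the count for \<open>C\<close> from below; for the second set it bounds the count from above,
  since the total count for the box is known.
\<close>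
lemma primitive4_jordan:
  assumes d: "sift_density \<longlonglongrightarrow> d" "d > 0" and ab: "box4 a b"
    and V: "open V1" "open V2" "V1 \<subseteq> C" "C \<subseteq> box a b" "V2 \<subseteq> box a b - C"
    and meas: "measure lborel V1 + measure lborel V2 = measure lborel (box a b)"
  shows "((\<lambda>N. real (card {v\<in>primitive4. scale4 N v \<in> C}) / N ^ 4) \<longlongrightarrow> d * measure lborel V1) at_top"
proof (rule tendstoI)
  fix e :: real assume e: "e > 0"
  have bdd: "bounded V1" "bounded V2" using V by (auto intro: bounded_subset[OF bounded_box[of a b]])
  have "\<forall>\<^sub>F N in at_top. real (card {v\<in>primitive4. scale4 N v \<in> V1}) / N ^ 4 > d * measure lborel V1 - e"
    by (rule primitive4_open_liminf[OF d V(1) bdd(1)]) (use e in simp)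
  moreover have "\<forall>\<^sub>F N in at_top. real (card {v\<in>primitive4. scale4 N v \<in> V2}) / N ^ 4 > d * measure lborel V2 - e / 2"
    by (rule primitive4_open_liminf[OF d V(2) bdd(2)]) (use e in simp)
  moreover have "\<forall>\<^sub>F N in at_top. real (card {v\<in>primitive4. scale4 N v \<in> box a b}) / N ^ 4 < d * measure lborel (box a b) + e / 2"
    using primitive4_box_asymp[OF d(1) ab] unfolding measure_lborel_box4[OF ab]
    by (rule order_tendstoD(2)) (use e in simp)
  ultimately show "\<forall>\<^sub>F N in at_top. dist (real (card {v\<in>primitive4. scale4 N v \<in> C}) / N ^ 4) (d * measure lborel V1) < e"
    using eventually_gt_at_top[of 0]
  proof eventually_elim
    case (elim N)
    let ?c = "\<lambda>X. card {v\<in>primitive4. scale4 N v \<in> X}"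
    have fin: "finite {v\<in>primitive4. scale4 N v \<in> X}" if "X \<subseteq> box a b" for X
      by (rule finite_subset[OF _ finite_scale4_box[OF elim(4), of a b]]) (use that in blast)
    have "?c V1 \<le> ?c C" by (rule card_mono[OF fin[OF V(4)]]) (use V(3) in blast)
    hence 1: "real (?c V1) / N ^ 4 \<le> real (?c C) / N ^ 4" using elim(4) by (intro divide_right_mono) auto
    have "?c C + ?c V2 = card ({v\<in>primitive4. scale4 N v \<in> C} \<union> {v\<in>primitive4. scale4 N v \<in> V2})"
      by (rule card_Un_disjoint[symmetric]) (use V fin in blast)+
    also have "\<dots> \<le> ?c (box a b)" by (rule card_mono[OF fin]) (use V in blast)+
    finally have "(real (?c C) + real (?c V2)) / N ^ 4 \<le> real (?c (box a b)) / N ^ 4"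
      using elim(4) by (intro divide_right_mono) auto
    hence 2: "real (?c C) / N ^ 4 + real (?c V2) / N ^ 4 \<le> real (?c (box a b)) / N ^ 4"
      by (simp only: add_divide_distrib)
    have 3: "d * measure lborel (box a b) = d * measure lborel V1 + d * measure lborel V2"
      by (simp only: meas[symmetric] distrib_left)
    show ?case using 1 2 3 elim(1-3) unfolding dist_real_def by linarith
  qed
qed

end

section \<open>Covered pairs\<close>

text \<open>
  The matrix is factored into a map that changes only the second coordinate and one that changes only the
  first; each is an affine substitution in one variable, and Fubini's theorem joins them.
\<close>
lemma linear_map_nn_integral:
  fixes f :: "real \<times> real \<Rightarrow> ennreal"
  assumes f: "f \<in> borel_measurable borel" and a: "a \<noteq> 0" and det: "a * d - b * c \<noteq> 0"
  shows "(\<integral>\<^sup>+x. f x \<partial>lborel) =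
    ennreal \<bar>a * d - b * c\<bar> * (\<integral>\<^sup>+x. f (a * fst x + b * snd x, c * fst x + d * snd x) \<partial>lborel)"
proof -
  define D where "D = a * d - b * c"
  have [measurable]: "f \<in> borel_measurable (lborel \<Otimes>\<^sub>M lborel)" using f unfolding lborel_prod by simp
  have [measurable]: "f \<in> borel_measurable (borel \<Otimes>\<^sub>M borel)" using f unfolding borel_prod .
  have D: "D / a \<noteq> 0" using a det by (simp add: D_def)
  have "(\<integral>\<^sup>+x. f x \<partial>lborel) = (\<integral>\<^sup>+u. \<integral>\<^sup>+v. f (u, v) \<partial>lborel \<partial>lborel)"
    unfolding lborel_prod[symmetric] by (rule lborel.nn_integral_fst[symmetric]) measurable
  also have "\<dots> = (\<integral>\<^sup>+u. ennreal \<bar>D / a\<bar> * (\<integral>\<^sup>+y. f (u, c / a * u + D / a * y) \<partial>lborel) \<partial>lborel)"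
    by (intro nn_integral_cong nn_integral_real_affine[OF _ D]) measurable
  also have "\<dots> = ennreal \<bar>D / a\<bar> * (\<integral>\<^sup>+u. \<integral>\<^sup>+y. f (u, c / a * u + D / a * y) \<partial>lborel \<partial>lborel)"
    by (rule nn_integral_cmult) measurable
  also have "(\<integral>\<^sup>+u. \<integral>\<^sup>+y. f (u, c / a * u + D / a * y) \<partial>lborel \<partial>lborel) =
      (\<integral>\<^sup>+y. \<integral>\<^sup>+u. f (u, c / a * u + D / a * y) \<partial>lborel \<partial>lborel)"
    by (rule lborel_pair.Fubini'[symmetric]) measurable
  also have "\<dots> = (\<integral>\<^sup>+y. ennreal \<bar>a\<bar> * (\<integral>\<^sup>+x. f (b * y + a * x, c / a * (b * y + a * x) + D / a * y) \<partial>lborel) \<partial>lborel)"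
    by (intro nn_integral_cong nn_integral_real_affine[OF _ a]) measurable
  also have "\<dots> = ennreal \<bar>a\<bar> * (\<integral>\<^sup>+y. \<integral>\<^sup>+x. f (b * y + a * x, c / a * (b * y + a * x) + D / a * y) \<partial>lborel \<partial>lborel)"
    by (rule nn_integral_cmult) measurable
  also have "(\<integral>\<^sup>+y. \<integral>\<^sup>+x. f (b * y + a * x, c / a * (b * y + a * x) + D / a * y) \<partial>lborel \<partial>lborel)
    = (\<integral>\<^sup>+y. \<integral>\<^sup>+x. f (a * x + b * y, c * x + d * y) \<partial>lborel \<partial>lborel)"
  proof (intro nn_integral_cong)
    fix y x
    have "c / a * (b * y + a * x) + D / a * y = c * x + d * y"
      using a by (simp add: D_def field_simps)
    thus "f (b * y + a * x, c / a * (b * y + a * x) + D / a * y) = f (a * x + b * y, c * x + d * y)"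
      by (simp only: add.commute)
  qed
  also have "\<dots> = (\<integral>\<^sup>+z. f (a * fst z + b * snd z, c * fst z + d * snd z) \<partial>(lborel \<Otimes>\<^sub>M lborel))"
  proof -
    have m: "(\<lambda>z. f (a * fst z + b * snd z, c * fst z + d * snd z)) \<in> borel_measurable (lborel \<Otimes>\<^sub>M lborel)"
      by measurable
    show ?thesis using lborel_pair.nn_integral_snd[OF m] by simp
  qed
  also have "(lborel \<Otimes>\<^sub>M lborel) = (lborel :: (real \<times> real) measure)" by (rule lborel_prod)
  finally have eq: "integral\<^sup>N lborel f = ennreal \<bar>D / a\<bar> * (ennreal \<bar>a\<bar> * (\<integral>\<^sup>+z. f (a * fst z + b * snd z, c * fst z + d * snd z) \<partial>lborel))" .
  show ?thesis
  proof -
    have "ennreal \<bar>D / a\<bar> * (ennreal \<bar>a\<bar> * t) = ennreal \<bar>D\<bar> * t" for t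
    proof -
      have "ennreal \<bar>D / a\<bar> * (ennreal \<bar>a\<bar> * t) = ennreal (\<bar>D / a\<bar> * \<bar>a\<bar>) * t"
        by (subst ennreal_mult) (simp_all add: mult.assoc)
      also have "\<bar>D / a\<bar> * \<bar>a\<bar> = \<bar>D\<bar>" using a by simp
      finally show ?thesis .
    qed
    thus ?thesis using eq unfolding D_def by simp
  qed
qed

lemma null_if_finite_sections:
  fixes S :: "(real \<times> real) set"
  assumes S: "S \<in> sets borel" and fin: "(\<forall>y. finite {x. (x, y) \<in> S}) \<or> (\<forall>x. finite {y. (x, y) \<in> S})"
  shows "emeasure lborel S = 0"
proof -
  have S': "S \<in> sets (lborel \<Otimes>\<^sub>M lborel)" unfolding lborel_prod using S by simp
  have 0: "emeasure lborel A = 0" if "finite A" for A :: "real set" using countable_finite[OF that] by (rule emeasure_lborel_countable)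
  from fin show ?thesis
  proof
    assume f: "\<forall>y. finite {x. (x, y) \<in> S}"
    have "emeasure lborel ((\<lambda>x. (x, y)) -` S) = 0" for y using 0[OF f[rule_format]] by (simp add: vimage_def)
    thus ?thesis using lborel_pair.emeasure_pair_measure_alt2[OF S'] unfolding lborel_prod by simp
  next
    assume f: "\<forall>x. finite {y. (x, y) \<in> S}"
    have "emeasure lborel (Pair x -` S) = 0" for x using 0[OF f[rule_format]] by (simp add: vimage_def)
    thus ?thesis using lborel.emeasure_pair_measure_alt[OF S'] unfolding lborel_prod by simp
  qed
qed

context quadratic_lattice
begin

text \<open>
  Areas are measured in coordinates with respect to the basis \<open>(1, \<omega>)\<close>. The fundamental
  parallelogram becomes the unit square and lattice points become integer points; the constant factor
  relating this to Euclidean area cancels in all quotients.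
\<close>
definition psi :: "real \<times> real \<Rightarrow> complex"
  where "psi x = of_real (fst x) + of_real (snd x) * \<omega>"

definition psi_inv :: "complex \<Rightarrow> real \<times> real"
  where "psi_inv z = (Re z - Im z / Im \<omega> * Re \<omega>, Im z / Im \<omega>)"

lemma psi_psi_inv [simp]: "psi (psi_inv z) = z"
  using Im_pos by (simp add: psi_def psi_inv_def complex_eq_iff)

lemma psi_inv_psi [simp]: "psi_inv (psi x) = x"
  using Im_pos by (simp add: psi_def psi_inv_def prod_eq_iff)

lemma psi_add: "psi (x + y) = psi x + psi y" by (simp add: psi_def algebra_simps)
lemma psi_inv_diff: "psi_inv (x - y) = psi_inv x - psi_inv y"
  by (simp add: psi_inv_def algebra_simps diff_divide_distrib)

lemma psi_emb: "psi (of_int (fst v), of_int (snd v)) = emb v" by (simp add: psi_def emb_def)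

lemma continuous_psi [continuous_intros]: "continuous_on S f \<Longrightarrow> continuous_on S (\<lambda>x. psi (f x))"
  unfolding psi_def by (intro continuous_intros)

lemma continuous_psi_inv [continuous_intros]: "continuous_on S f \<Longrightarrow> continuous_on S (\<lambda>x. psi_inv (f x))"
  unfolding psi_inv_def using Im_pos by (intro continuous_intros) auto

lemma psi_eq_0: "psi x = 0 \<longleftrightarrow> x = 0"
proof
  assume "psi x = 0"
  hence "x = psi_inv 0" using psi_inv_psi[of x] by simp
  thus "x = 0" by (simp add: psi_inv_def zero_prod_def)
qed (simp add: psi_def)

lemma psi_measurable [measurable]: "psi \<in> borel_measurable borel"
  by (intro borel_measurable_continuous_onI continuous_psi continuous_on_id)

lemma psi_inv_measurable [measurable]: "psi_inv \<in> borel_measurable borel"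
  by (intro borel_measurable_continuous_onI continuous_psi_inv continuous_on_id)

lemma countable_O: "countable \<O>"
  unfolding \<O>_def by simp

lemma finite_O_ball: "finite {z\<in>\<O>. cmod z \<le> R}"
proof -
  define X where "X = R + R / Im \<omega> * cmod \<omega> + R / Im \<omega> + 1"
  have "{z\<in>\<O>. cmod z \<le> R} \<subseteq> emb ` {b::int \<times> int. \<bar>of_int (fst b)\<bar> < X \<and> \<bar>of_int (snd b)\<bar> < X}"
  proof
    fix z assume z: "z \<in> {z\<in>\<O>. cmod z \<le> R}"
    then obtain m n where mn: "z = of_int m + of_int n * \<omega>" using OE by blast
    have R: "R \<ge> 0" using z norm_ge_zero[of z] by (simp only: mem_Collect_eq) linarith
    have "Im z = of_int n * Im \<omega>" by (simp add: mn)
    hence "\<bar>of_int n\<bar> * Im \<omega> \<le> R" using abs_Im_le_cmod[of z] z Im_pos by (simp add: abs_mult)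
    hence n: "\<bar>of_int n\<bar> \<le> R / Im \<omega>" using Im_pos by (simp add: pos_le_divide_eq)
    have "of_int m = z - of_int n * \<omega>" by (simp add: mn)
    hence "cmod (of_int m) \<le> cmod z + cmod (of_int n * \<omega>)" by (simp only: norm_triangle_ineq4)
    also have "\<dots> \<le> R + R / Im \<omega> * cmod \<omega>"
    proof (rule add_mono)
      show "cmod z \<le> R" using z by simp
      show "cmod (of_int n * \<omega>) \<le> R / Im \<omega> * cmod \<omega>"
        unfolding norm_mult norm_of_int by (rule mult_right_mono[OF n]) simp
    qed
    finally have m: "\<bar>of_int m\<bar> \<le> R + R / Im \<omega> * cmod \<omega>" by simp
    have "R / Im \<omega> \<ge> 0" "R / Im \<omega> * cmod \<omega> \<ge> 0" using R Im_pos by simp_all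
    hence "\<bar>real_of_int m\<bar> < X" "\<bar>real_of_int n\<bar> < X" using m n R unfolding X_def by linarith+
    thus "z \<in> emb ` {b::int \<times> int. \<bar>of_int (fst b)\<bar> < X \<and> \<bar>of_int (snd b)\<bar> < X}"
      by (intro image_eqI[of _ _ "(m, n)"]) (simp_all add: mn emb_def)
  qed
  thus ?thesis by (rule finite_subset) (intro finite_imageI finite_box2)
qed

text \<open>
  For \<open>z = \<zeta> * w\<close> this says that \<open>\<zeta>\<close> lies in one of the closed annuli about \<open>Q / P\<close> with radii
  \<open>1 / (d * |w|\<^sup>2)\<close> and \<open>1 / (|P| * |w|)\<close>. With \<open>|w| = exp (- s / 2)\<close> these are the annuli that define
  \<open>f\<^sub>s(d)\<close>. The form without denominators is polynomial in \<open>(z, w)\<close> and hence suits both the lattice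
  point count and continuity arguments.
\<close>
definition covered :: "real \<Rightarrow> complex \<Rightarrow> complex \<Rightarrow> bool"
  where "covered d z w \<longleftrightarrow> (\<exists>P\<in>\<O>. \<exists>Q\<in>\<O>. unimodular P Q \<and> P \<noteq> 0 \<and>
     cmod (P * z - Q * w) \<le> 1 \<and> cmod P \<le> d * cmod w * cmod (P * z - Q * w))"

definition strictly_covered :: "real \<Rightarrow> complex \<Rightarrow> complex \<Rightarrow> bool"
  where "strictly_covered d z w \<longleftrightarrow> (\<exists>P\<in>\<O>. \<exists>Q\<in>\<O>. unimodular P Q \<and> P \<noteq> 0 \<and>
     cmod (P * z - Q * w) < 1 \<and> cmod P < d * cmod w * cmod (P * z - Q * w))"

lemma strictly_covered_imp_covered: "strictly_covered d z w \<Longrightarrow> covered d z w"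
  unfolding covered_def strictly_covered_def by (meson less_imp_le)

lemma covered_mono: "covered d z w \<Longrightarrow> d \<le> d' \<Longrightarrow> covered d' z w"
proof -
  assume "covered d z w" and le: "d \<le> d'"
  then obtain P Q where PQ: "P \<in> \<O>" "Q \<in> \<O>" "unimodular P Q" "P \<noteq> 0" "cmod (P * z - Q * w) \<le> 1"
    "cmod P \<le> d * cmod w * cmod (P * z - Q * w)" unfolding covered_def by blast
  have "d * cmod w * cmod (P * z - Q * w) \<le> d' * cmod w * cmod (P * z - Q * w)"
    using le by (intro mult_right_mono) auto
  thus ?thesis unfolding covered_def using PQ by (meson order_trans)
qed

lemma not_covered_0: "\<not> covered 0 z w" by (simp add: covered_def)

text \<open>
  Covering is a closed condition for each \<open>(P, Q)\<close>. It is closed as a whole where \<open>w \<noteq> 0\<close> because,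
  for bounded \<open>d\<close>, \<open>z\<close>, \<open>w\<close> and \<open>1 / w\<close>, only finitely many \<open>(P, Q)\<close> are relevant: the second inequality
  bounds \<open>P\<close> and then the first one bounds \<open>Q\<close>.
\<close>
lemma open_not_covered: "open {(d, z, w). w \<noteq> 0 \<and> \<not> covered d z w}"
proof -
  define U where "U = (\<lambda>n::nat. {x :: real \<times> complex \<times> complex. \<bar>fst x\<bar> < real n \<and> cmod (fst (snd x)) < real n \<and>
     1 < real n * cmod (snd (snd x)) \<and> cmod (snd (snd x)) < real n})"
  define S where "S = (\<lambda>n::nat. {P\<in>\<O>. cmod P \<le> real n * real n} \<times> {Q\<in>\<O>. cmod Q \<le> real n * (1 + real n * real n * real n)})"
  define T where "T = (\<lambda>p :: complex \<times> complex. if unimodular (fst p) (snd p) \<and> fst p \<noteq> 0 then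
     {x :: real \<times> complex \<times> complex. 1 < cmod (fst p * fst (snd x) - snd p * snd (snd x))} \<union>
     {x. fst x * cmod (snd (snd x)) * cmod (fst p * fst (snd x) - snd p * snd (snd x)) < cmod (fst p)} else UNIV)"
  have openT: "open (T p)" for p
    unfolding T_def by (auto intro!: open_Un open_Collect_less continuous_intros)
  have openU: "open (U n)" for n
    unfolding U_def by (intro open_Collect_conj open_Collect_less continuous_intros)
  have finS: "finite (S n)" for n unfolding S_def by (intro finite_cartesian_product finite_O_ball)
  have local: "x \<in> (\<Inter>p\<in>S n. T p) \<longleftrightarrow> \<not> covered (fst x) (fst (snd x)) (snd (snd x))" if x: "x \<in> U n" for x n
  proof
    assume T: "x \<in> (\<Inter>p\<in>S n. T p)"
    show "\<not> covered (fst x) (fst (snd x)) (snd (snd x))"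
    proof
      obtain d z w where dzw: "x = (d, z, w)" by (metis surj_pair)
      assume "covered (fst x) (fst (snd x)) (snd (snd x))"
      then obtain P Q where PQ: "P \<in> \<O>" "Q \<in> \<O>" "unimodular P Q" "P \<noteq> 0" "cmod (P * z - Q * w) \<le> 1"
        "cmod P \<le> d * cmod w * cmod (P * z - Q * w)" unfolding covered_def dzw fst_conv snd_conv by blast
      have u: "\<bar>d\<bar> < real n" "cmod z < real n" "1 < real n * cmod w" "cmod w < real n"
        using x unfolding U_def dzw by simp_all
      have "d * cmod w * cmod (P * z - Q * w) \<le> real n * real n * 1"
        using u PQ(5) by (intro mult_mono) auto
      hence P: "cmod P \<le> real n * real n" using PQ(6) by linarith
      have "cmod (Q * w) \<le> cmod (P * z) + cmod (P * z - Q * w)"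
        using norm_triangle_ineq4[of "P * z" "P * z - Q * w"] by simp
      also have "\<dots> \<le> real n * real n * real n + 1"
        unfolding norm_mult using u P PQ(5) by (intro add_mono mult_mono) auto
      finally have qw: "cmod Q * cmod w \<le> real n * real n * real n + 1" by (simp only: norm_mult)
      have "cmod Q * 1 \<le> cmod Q * (real n * cmod w)" using u(3) by (intro mult_left_mono) auto
      also have "\<dots> = real n * (cmod Q * cmod w)" by (simp only: mult_ac)
      also have "\<dots> \<le> real n * (real n * real n * real n + 1)" by (intro mult_left_mono qw) auto
      finally have "cmod Q \<le> real n * (1 + real n * real n * real n)" by (simp only: mult_1_right add.commute)
      hence "(P, Q) \<in> S n" using PQ(1,2) P unfolding S_def by simp
      hence "x \<in> T (P, Q)" using T by blast
      thus False using PQ(3-6) unfolding T_def dzw by auto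
    qed
  next
    assume nc: "\<not> covered (fst x) (fst (snd x)) (snd (snd x))"
    show "x \<in> (\<Inter>p\<in>S n. T p)"
    proof
      fix p assume p: "p \<in> S n"
      show "x \<in> T p"
      proof (rule ccontr)
        assume "x \<notin> T p"
        hence "unimodular (fst p) (snd p)" "fst p \<noteq> 0" "cmod (fst p * fst (snd x) - snd p * snd (snd x)) \<le> 1"
          "cmod (fst p) \<le> fst x * cmod (snd (snd x)) * cmod (fst p * fst (snd x) - snd p * snd (snd x))"
          unfolding T_def by (auto split: if_splits)
        moreover have "fst p \<in> \<O>" "snd p \<in> \<O>" using p unfolding S_def by auto
        ultimately show False using nc unfolding covered_def by blast
      qed
    qed
  qed
  have "{(d, z, w). w \<noteq> 0 \<and> \<not> covered d z w} = (\<Union>n. U n \<inter> (\<Inter>p\<in>S n. T p))"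
  proof (intro set_eqI iffI)
    fix x assume "x \<in> {(d, z, w). w \<noteq> 0 \<and> \<not> covered d z w}"
    then obtain d z w where dzw: "x = (d, z, w)" "w \<noteq> 0" "\<not> covered d z w" by blast
    obtain n where n: "\<bar>d\<bar> + cmod z + cmod w + 1 / cmod w < real n" using reals_Archimedean2 by blast
    have "1 / cmod w > 0" using dzw by simp
    hence n': "\<bar>d\<bar> < real n" "cmod z < real n" "cmod w < real n" "1 / cmod w < real n"
      using n abs_ge_zero[of d] norm_ge_zero[of z] norm_ge_zero[of w] by linarith+
    hence "1 < real n * cmod w" using dzw(2) by (simp add: pos_divide_less_eq)
    hence "x \<in> U n" using n' unfolding U_def dzw by simp
    thus "x \<in> (\<Union>n. U n \<inter> (\<Inter>p\<in>S n. T p))" using local[of x n] dzw by auto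
  next
    fix x assume "x \<in> (\<Union>n. U n \<inter> (\<Inter>p\<in>S n. T p))"
    then obtain n where n: "x \<in> U n" "x \<in> (\<Inter>p\<in>S n. T p)" by blast
    obtain d z w where dzw: "x = (d, z, w)" by (metis surj_pair)
    have "\<not> covered d z w" using local[OF n(1)] n(2) unfolding dzw fst_conv snd_conv by blast
    moreover have "w \<noteq> 0" using n(1) unfolding U_def dzw by auto
    ultimately show "x \<in> {(d, z, w). w \<noteq> 0 \<and> \<not> covered d z w}" by (simp add: dzw)
  qed
  also have "open \<dots>" by (intro open_UN ballI open_Int openU open_INT finS openT)
  finally show ?thesis .
qed

end

section \<open>The region of uncovered pairs\<close>

lemma lborel2_section:
  fixes X :: "((real \<times> real) \<times> (real \<times> real)) set"
  assumes "X \<in> sets borel"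
  shows "emeasure lborel X = (\<integral>\<^sup>+q. emeasure lborel {b. (b, q) \<in> X} \<partial>lborel)"
proof -
  have X: "X \<in> sets (lborel \<Otimes>\<^sub>M lborel)" unfolding lborel_prod using assms by simp
  show ?thesis using lborel_pair.emeasure_pair_measure_alt2[OF X] unfolding lborel_prod vimage_def .
qed

lemma AE_lborel2_nonzero: "AE q in lborel. fst (q :: real \<times> real) \<noteq> 0"
proof -
  let ?S = "{q :: real \<times> real. fst q = 0}"
  have S: "?S \<in> sets borel" by (intro borel_closed closed_Collect_eq continuous_intros)
  have "emeasure lborel ?S = 0" by (rule null_if_finite_sections[OF S]) simp
  hence "?S \<in> null_sets lborel" using S by (intro null_setsI) simp_all
  from AE_not_in[OF this] show ?thesis by simp
qed

abbreviation unit_square :: "(real \<times> real) set"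
  where "unit_square \<equiv> {x. 0 \<le> fst x \<and> fst x < 1 \<and> 0 \<le> snd x \<and> snd x < 1}"

abbreviation open_square :: "(real \<times> real) set"
  where "open_square \<equiv> {x. 0 < fst x \<and> fst x < 1 \<and> 0 < snd x \<and> snd x < 1}"

abbreviation closed_square :: "(real \<times> real) set"
  where "closed_square \<equiv> {x. 0 \<le> fst x \<and> fst x \<le> 1 \<and> 0 \<le> snd x \<and> snd x \<le> 1}"

lemma open_open_square: "open open_square"
  by (intro open_Collect_conj open_Collect_less continuous_intros)

lemma closed_closed_square: "closed closed_square"
  by (intro closed_Collect_conj closed_Collect_le continuous_intros)

lemma square_boundary_null: "closed_square - open_square \<in> null_sets lborel"
proof -
  have 1: "{x :: real \<times> real. fst x \<in> {0, 1}} \<in> null_sets lborel"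
  proof -
    have "closed ({x :: real \<times> real. fst x = 0} \<union> {x. fst x = 1})"
      by (intro closed_Un closed_Collect_eq continuous_intros)
    also have "{x :: real \<times> real. fst x = 0} \<union> {x. fst x = 1} = {x. fst x \<in> {0, 1}}" by blast
    finally have S: "{x :: real \<times> real. fst x \<in> {0, 1}} \<in> sets borel" by (rule borel_closed)
    have "emeasure lborel {x :: real \<times> real. fst x \<in> {0, 1}} = 0"
      by (rule null_if_finite_sections[OF S]) simp
    thus ?thesis using S by (intro null_setsI) simp_all
  qed
  have 2: "{x :: real \<times> real. snd x \<in> {0, 1}} \<in> null_sets lborel"
  proof -
    have "closed ({x :: real \<times> real. snd x = 0} \<union> {x. snd x = 1})"
      by (intro closed_Un closed_Collect_eq continuous_intros)
    also have "{x :: real \<times> real. snd x = 0} \<union> {x. snd x = 1} = {x. snd x \<in> {0, 1}}" by blast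
    finally have S: "{x :: real \<times> real. snd x \<in> {0, 1}} \<in> sets borel" by (rule borel_closed)
    have "emeasure lborel {x :: real \<times> real. snd x \<in> {0, 1}} = 0"
      by (rule null_if_finite_sections[OF S]) simp
    thus ?thesis using S by (intro null_setsI) simp_all
  qed
  have "closed_square - open_square \<subseteq> {x. fst x \<in> {0, 1}} \<union> {x. snd x \<in> {0, 1}}"
  proof
    fix x :: "real \<times> real" assume "x \<in> closed_square - open_square"
    thus "x \<in> {x. fst x \<in> {0, 1}} \<union> {x. snd x \<in> {0, 1}}"
      unfolding Diff_iff mem_Collect_eq Un_iff by simp linarith
  qed
  moreover have "closed_square - open_square \<in> sets lborel"
    using open_open_square closed_closed_square by (intro sets.Diff) auto
  ultimately show ?thesis using null_sets_subset[OF null_sets.Un[OF 1 2]] by blast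
qed

context quadratic_lattice
begin

lemma circle_null: "{x. cmod (psi x - c) = r} \<in> null_sets lborel"
proof -
  let ?S = "{x. cmod (psi x - c) = r}"
  have S: "?S \<in> sets borel" by (intro borel_closed closed_Collect_eq continuous_intros)
  have "finite {x. (x, y) \<in> ?S}" for y
  proof -
    define x0 where "x0 = Re c - y * Re \<omega>"
    define k where "k = r ^ 2 - (y * Im \<omega> - Im c) ^ 2"
    have "{x. (x, y) \<in> ?S} \<subseteq> {x0 + sqrt k, x0 - sqrt k}"
    proof
      fix x assume "x \<in> {x. (x, y) \<in> ?S}"
      hence "(cmod (psi (x, y) - c)) ^ 2 = r ^ 2" by simp
      hence "(x - x0) ^ 2 = k" unfolding cmod_power2 by (simp add: psi_def x0_def k_def algebra_simps)
      hence "\<bar>x - x0\<bar> = sqrt k" by (metis real_sqrt_abs)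
      thus "x \<in> {x0 + sqrt k, x0 - sqrt k}" by (simp add: abs_if split: if_splits) 
    qed
    thus ?thesis by (rule finite_subset) simp
  qed
  hence "emeasure lborel ?S = 0" by (intro null_if_finite_sections[OF S]) blast
  thus ?thesis using S by (intro null_setsI) simp_all
qed

lemma norm_psi_sq: "(cmod (psi q)) ^ 2 = fst q * (fst q + of_int \<tau> * snd q) + of_int \<nu> * snd q * snd q"
proof -
  have nu: "of_int \<nu> = (Re \<omega>) ^ 2 + (Im \<omega>) ^ 2"
    using arg_cong[OF omega_cnj, of Re] by (simp add: power2_eq_square)
  have "(cmod (psi q)) ^ 2 = (fst q + snd q * Re \<omega>) ^ 2 + (snd q * Im \<omega>) ^ 2"
    unfolding cmod_power2 by (simp add: psi_def)
  also have "\<dots> = fst q * (fst q + of_int \<tau> * snd q) + of_int \<nu> * snd q * snd q"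
    unfolding nu Re_omega[symmetric] by (simp add: power2_eq_square algebra_simps)
  finally show ?thesis .
qed

lemma psi_mult: "psi x * psi q = psi (fst q * fst x + (- of_int \<nu> * snd q) * snd x, snd q * fst x + (fst q + of_int \<tau> * snd q) * snd x)"
proof -
  have "psi x * psi q = of_real (fst x * fst q) + of_real (fst x * snd q + snd x * fst q) * \<omega> + of_real (snd x * snd q) * (\<omega> * \<omega>)"
    by (simp add: psi_def algebra_simps)
  also have "\<dots> = psi (fst q * fst x + (- of_int \<nu> * snd q) * snd x, snd q * fst x + (fst q + of_int \<tau> * snd q) * snd x)"
    unfolding omega_sq by (simp add: psi_def algebra_simps)
  finally show ?thesis .
qed

lemma nn_integral_psi_mult:
  fixes f :: "real \<times> real \<Rightarrow> ennreal"
  assumes "f \<in> borel_measurable borel" "fst q \<noteq> 0"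
  shows "(\<integral>\<^sup>+x. f x \<partial>lborel) = ennreal ((cmod (psi q)) ^ 2) * (\<integral>\<^sup>+x. f (psi_inv (psi x * psi q)) \<partial>lborel)"
proof -
  have det: "fst q * (fst q + of_int \<tau> * snd q) - (- of_int \<nu> * snd q) * snd q = (cmod (psi q)) ^ 2"
    unfolding norm_psi_sq by simp
  have "psi q \<noteq> 0" using assms(2) by (auto simp: psi_eq_0)
  hence "(cmod (psi q)) ^ 2 \<noteq> 0" by simp
  from linear_map_nn_integral[OF assms, of "fst q + of_int \<tau> * snd q" "- of_int \<nu> * snd q" "snd q", unfolded det, OF this]
  show ?thesis unfolding psi_mult psi_inv_psi by simp
qed

text \<open>
  Multiplication by \<open>psi q\<close> has determinant \<open>|psi q|\<^sup>2\<close>. The first coordinate of \<open>q\<close> is assumed nonzero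
  only for the factorization into one-variable substitutions; almost every \<open>q\<close> qualifies.
\<close>
lemma emeasure_psi_quotient:
  assumes S: "S \<in> sets borel" and q: "fst q \<noteq> 0"
  shows "emeasure lborel {b. psi_inv (psi b / psi q) \<in> S} = ennreal ((cmod (psi q)) ^ 2) * emeasure lborel S"
proof -
  have [measurable]: "S \<in> sets borel" by (rule S)
  have "psi q \<noteq> 0" using q by (auto simp: psi_eq_0)
  let ?X = "{b. psi_inv (psi b / psi q) \<in> S}"
  have X: "?X \<in> sets borel" by measurable
  have "emeasure lborel ?X = (\<integral>\<^sup>+x. indicator ?X x \<partial>lborel)" using X by simp
  also have "\<dots> = ennreal ((cmod (psi q)) ^ 2) * (\<integral>\<^sup>+x. indicator ?X (psi_inv (psi x * psi q)) \<partial>lborel)"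
    by (rule nn_integral_psi_mult[OF _ q]) (use X in measurable)
  also have "(\<integral>\<^sup>+x. indicator ?X (psi_inv (psi x * psi q)) \<partial>lborel) = (\<integral>\<^sup>+x. indicator S x \<partial>lborel)"
    using \<open>psi q \<noteq> 0\<close> by (intro nn_integral_cong) (simp add: indicator_def)
  finally show ?thesis using S by simp
qed

text \<open>
  The rescaled codes \<open>(b, q) / N\<close> of the Farey points with rescaled gap larger than \<open>d\<close> are those in
  the set \<open>region d\<close> below. It is sandwiched between this open set and the complement of the open set
  \<open>region_exterior B d\<close>; together these two fill the surrounding box \<open>B\<close> up to a null set.
\<close>
definition region_interior :: "real \<Rightarrow> real4 set"
  where "region_interior d = {v. psi (snd v) \<noteq> 0 \<and> cmod (psi (snd v)) < 1 \<and>
     psi_inv (psi (fst v) / psi (snd v)) \<in> open_square \<and> \<not> covered d (psi (fst v)) (psi (snd v))}"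

definition region :: "real \<Rightarrow> real4 set"
  where "region d = {v. psi (snd v) \<noteq> 0 \<and> cmod (psi (snd v)) \<le> 1 \<and>
     psi_inv (psi (fst v) / psi (snd v)) \<in> unit_square \<and> \<not> covered d (psi (fst v)) (psi (snd v))}"

definition region_exterior :: "real4 set \<Rightarrow> real \<Rightarrow> real4 set"
  where "region_exterior B d = {v\<in>B. psi (snd v) \<noteq> 0 \<and> (1 < cmod (psi (snd v)) \<or>
     psi_inv (psi (fst v) / psi (snd v)) \<notin> closed_square \<or> strictly_covered d (psi (fst v)) (psi (snd v)))}"

lemma open_nonzero: "open {v :: real4. psi (snd v) \<noteq> 0}"
  by (intro open_Collect_neq continuous_intros)

lemma open_quotient_preimage:
  assumes "open T"
  shows "open {v :: real4. psi (snd v) \<noteq> 0 \<and> psi_inv (psi (fst v) / psi (snd v)) \<in> T}"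
proof -
  have "continuous_on {v :: real4. psi (snd v) \<noteq> 0} (\<lambda>v. psi_inv (psi (fst v) / psi (snd v)))"
    by (intro continuous_intros) simp
  from continuous_open_preimage[OF this open_nonzero assms] show ?thesis
    by (simp add: vimage_def Int_def)
qed

lemma open_not_covered_family: "open {x :: real \<times> real4. psi (snd (snd x)) \<noteq> 0 \<and> \<not> covered (fst x) (psi (fst (snd x))) (psi (snd (snd x)))}"
proof -
  have "continuous_on UNIV (\<lambda>x :: real \<times> real4. (fst x, psi (fst (snd x)), psi (snd (snd x))))"
    by (intro continuous_intros)
  from open_vimage[OF open_not_covered this] show ?thesis by (simp add: vimage_def)
qed

lemma open_not_covered4: "open {v :: real4. psi (snd v) \<noteq> 0 \<and> \<not> covered d (psi (fst v)) (psi (snd v))}"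
proof -
  have "continuous_on UNIV (\<lambda>v :: real4. (d, v))" by (intro continuous_intros)
  from open_vimage[OF open_not_covered_family this] show ?thesis by (simp add: vimage_def)
qed

lemma open_strictly_covered4: "open {v :: real4. strictly_covered d (psi (fst v)) (psi (snd v))}"
proof -
  have "{v :: real4. strictly_covered d (psi (fst v)) (psi (snd v))} = (\<Union>P\<in>\<O>. \<Union>Q\<in>\<O>. if unimodular P Q \<and> P \<noteq> 0 then
     {v. cmod (P * psi (fst v) - Q * psi (snd v)) < 1 \<and>
         cmod P < d * cmod (psi (snd v)) * cmod (P * psi (fst v) - Q * psi (snd v))} else {})"
    unfolding strictly_covered_def by (auto split: if_splits)
  also have "open \<dots>"
    by (intro open_UN ballI) (auto intro!: open_Collect_conj open_Collect_less continuous_intros)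
  finally show ?thesis .
qed

lemma open_region_interior: "open (region_interior d)"
proof -
  have "region_interior d = {v. psi (snd v) \<noteq> 0 \<and> psi_inv (psi (fst v) / psi (snd v)) \<in> open_square} \<inter>
    {v. psi (snd v) \<noteq> 0 \<and> \<not> covered d (psi (fst v)) (psi (snd v))} \<inter> {v. cmod (psi (snd v)) < 1}"
    unfolding region_interior_def by blast
  also have "open \<dots>"
    by (intro open_Int open_quotient_preimage open_open_square open_not_covered4 open_Collect_less continuous_intros)
  finally show ?thesis .
qed

lemma open_region_exterior: assumes "open B" shows "open (region_exterior B d)"
proof -
  have "region_exterior B d = B \<inter> {v. psi (snd v) \<noteq> 0} \<inter> ({v. 1 < cmod (psi (snd v))} \<union>
    {v. psi (snd v) \<noteq> 0 \<and> psi_inv (psi (fst v) / psi (snd v)) \<in> - closed_square} \<union>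
    {v. strictly_covered d (psi (fst v)) (psi (snd v))})"
    unfolding region_exterior_def by blast
  also have "open \<dots>"
    by (intro open_Int open_Un open_quotient_preimage open_nonzero assms open_strictly_covered4
      open_Compl closed_closed_square open_Collect_less continuous_intros)
  finally show ?thesis .
qed

lemma region_interior_subset_region: "region_interior d \<subseteq> region d"
proof
  fix v assume "v \<in> region_interior d"
  thus "v \<in> region d" unfolding region_interior_def region_def mem_Collect_eq using less_imp_le by blast
qed

lemma region_exterior_disjoint_region: "region_exterior B d \<subseteq> B - region d"
proof
  fix v assume v: "v \<in> region_exterior B d"
  hence "v \<in> B" unfolding region_exterior_def by blast
  moreover have "v \<notin> region d"
  proof
    assume r: "v \<in> region d"
    have "psi_inv (psi (fst v) / psi (snd v)) \<in> closed_square" "\<not> strictly_covered d (psi (fst v)) (psi (snd v))"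
      "\<not> 1 < cmod (psi (snd v))"
      using r strictly_covered_imp_covered unfolding region_def mem_Collect_eq by (auto intro: less_imp_le)
    thus False using v unfolding region_exterior_def by blast
  qed
  ultimately show "v \<in> B - region d" by blast
qed

lemma region_bounded: "\<exists>A. \<forall>d. region d \<subseteq> box (- A) A"
proof -
  have contp: "continuous_on UNIV psi_inv" by (intro continuous_psi_inv continuous_on_id)
  have cpt: "compact (psi_inv ` cball 0 r)" for r
    by (intro compact_continuous_image compact_cball continuous_on_subset[OF contp]) simp
  have cpt2: "compact (psi ` closed_square)"
  proof (intro compact_continuous_image continuous_psi continuous_on_id)
    have "closed_square = cbox (0, 0) (1, 1)" by (auto simp: cbox_Pair_eq)
    thus "compact closed_square" by simp
  qed
  then obtain M where M: "cmod z \<le> M" if "z \<in> psi ` closed_square" for z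
    using compact_imp_bounded[OF cpt2] unfolding bounded_iff by blast
  have "region d \<subseteq> psi_inv ` cball 0 M \<times> psi_inv ` cball 0 1" for d
  proof
    fix v assume v: "v \<in> region d"
    have 1: "cmod (psi (snd v)) \<le> 1" "psi (snd v) \<noteq> 0" using v unfolding region_def by blast+
    have x: "psi_inv (psi (fst v) / psi (snd v)) \<in> closed_square"
      using v unfolding region_def mem_Collect_eq by (auto intro: less_imp_le)
    have "cmod (psi (psi_inv (psi (fst v) / psi (snd v)))) \<le> M" by (rule M[OF imageI[OF x]])
    hence "cmod (psi (fst v)) / cmod (psi (snd v)) \<le> M" by (simp add: norm_divide)
    hence "cmod (psi (fst v)) \<le> M * cmod (psi (snd v))" using 1(2) by (simp add: pos_divide_le_eq)
    also have "M \<ge> 0"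
      using M[OF imageI[OF x]] norm_ge_zero order_trans by blast
    hence "M * cmod (psi (snd v)) \<le> M * 1" by (intro mult_left_mono 1)
    finally have "psi (fst v) \<in> cball 0 M" by simp
    moreover have "psi (snd v) \<in> cball 0 1" using 1 by simp
    ultimately have "psi_inv (psi (fst v)) \<in> psi_inv ` cball 0 M \<and> psi_inv (psi (snd v)) \<in> psi_inv ` cball 0 1"
      by (intro conjI imageI)
    thus "v \<in> psi_inv ` cball 0 M \<times> psi_inv ` cball 0 1" by (simp only: psi_inv_psi mem_Times_iff)
  qed
  moreover have "bounded (psi_inv ` cball 0 M \<times> psi_inv ` cball 0 1)"
    by (intro bounded_Times compact_imp_bounded cpt)
  then obtain A where "psi_inv ` cball 0 M \<times> psi_inv ` cball 0 1 \<subseteq> box (- A) A"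
    using bounded_subset_box_symmetric by blast
  ultimately show ?thesis by (intro exI[of _ A]) blast
qed

text \<open>
  The covering condition is invariant under multiplying both arguments by a number of modulus \<open>1\<close>, so
  for a given quotient \<open>\<zeta>\<close> only \<open>|w|\<close> matters.
\<close>
lemma covered_scale: "covered d (\<zeta> * w) w \<longleftrightarrow> covered d (\<zeta> * of_real (cmod w)) (of_real (cmod w))"
proof -
  have "P * (\<zeta> * w) - Q * w = (P * \<zeta> - Q) * w" for P Q w by (simp add: algebra_simps)
  hence "cmod (P * (\<zeta> * w) - Q * w) = cmod (P * \<zeta> - Q) * cmod w" for P Q w by (simp only: norm_mult)
  thus ?thesis unfolding covered_def by simp
qed

text \<open>
  Weak and strict covering differ only on the boundary circles of countably many annuli.
\<close>
lemma covered_boundary_null: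
  assumes w: "w \<noteq> 0"
  shows "\<exists>N\<in>null_sets lborel. {x. covered d (psi x * w) w \<and> \<not> strictly_covered d (psi x * w) w} \<subseteq> N"
proof -
  define C where "C = (\<lambda>P Q. {x. cmod (psi x - Q / P) = 1 / (cmod P * cmod w)} \<union>
    {x. cmod (psi x - Q / P) = 1 / (d * cmod w * cmod w)})"
  define N where "N = (\<Union>P\<in>\<O>. \<Union>Q\<in>\<O>. C P Q)"
  have "N \<in> null_sets lborel" unfolding N_def C_def
    by (intro null_sets_UN' countable_O null_sets.Un circle_null)
  moreover have "{x. covered d (psi x * w) w \<and> \<not> strictly_covered d (psi x * w) w} \<subseteq> N"
  proof
    fix x assume "x \<in> {x. covered d (psi x * w) w \<and> \<not> strictly_covered d (psi x * w) w}"
    hence x: "covered d (psi x * w) w" "\<not> strictly_covered d (psi x * w) w" by blast+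
    then obtain P Q where PQ: "P \<in> \<O>" "Q \<in> \<O>" "unimodular P Q" "P \<noteq> 0" "cmod (P * (psi x * w) - Q * w) \<le> 1"
      "cmod P \<le> d * cmod w * cmod (P * (psi x * w) - Q * w)" unfolding covered_def by blast
    define t where "t = cmod (psi x - Q / P)"
    have "P * (psi x * w) - Q * w = P * w * (psi x - Q / P)" using PQ(4) by (simp add: field_simps)
    hence eq: "cmod (P * (psi x * w) - Q * w) = cmod P * cmod w * t" by (simp only: norm_mult t_def)
    have "\<not> (cmod (P * (psi x * w) - Q * w) < 1 \<and> cmod P < d * cmod w * cmod (P * (psi x * w) - Q * w))"
      using x(2) PQ(1-4) unfolding strictly_covered_def by blast
    hence "cmod P * cmod w * t = 1 \<or> cmod P = d * cmod w * (cmod P * cmod w * t)"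
      using PQ(5,6) unfolding eq by linarith
    hence "t = 1 / (cmod P * cmod w) \<or> t = 1 / (d * cmod w * cmod w)"
    proof
      assume "cmod P * cmod w * t = 1"
      thus ?thesis using PQ(4) w by (simp add: field_simps)
    next
      assume *: "cmod P = d * cmod w * (cmod P * cmod w * t)"
      have "cmod P * 1 = cmod P * (d * cmod w * cmod w * t)" using * by (simp add: mult_ac)
      hence 1: "d * cmod w * cmod w * t = 1" using PQ(4) by (metis mult_left_cancel norm_eq_zero)
      hence "d * cmod w * cmod w \<noteq> 0" by auto
      thus ?thesis using 1 by (simp add: field_simps)
    qed
    hence "x \<in> C P Q" unfolding C_def t_def by blast
    thus "x \<in> N" using PQ(1,2) unfolding N_def by blast
  qed
  ultimately show ?thesis by blast
qed

text \<open>
  For almost every \<open>q\<close> the section over \<open>q\<close> of what is left over consists of \<open>b\<close> for which \<open>b / q\<close>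
  lies on the boundary of the unit square or of an annulus.
\<close>
lemma measure_region_interior_region_exterior:
  assumes B: "B = box a b" and sub: "region_interior d \<subseteq> B"
  shows "measure lborel (region_interior d) + measure lborel (region_exterior B d) = measure lborel B"
proof -
  let ?X = "B - region_interior d - region_exterior B d"
  have oB: "open B" by (simp add: B open_box)
  have m1: "region_interior d \<in> sets borel" by (rule borel_open[OF open_region_interior])
  have m2: "region_exterior B d \<in> sets borel" by (rule borel_open[OF open_region_exterior[OF oB]])
  have mB: "B \<in> sets borel" by (rule borel_open[OF oB])
  have mX: "?X \<in> sets borel" by (intro sets.Diff mB m1 m2)
  have "emeasure lborel ?X = (\<integral>\<^sup>+q. emeasure lborel {b. (b, q) \<in> ?X} \<partial>lborel)"
    by (rule lborel2_section[OF mX])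
  also have "\<dots> = (\<integral>\<^sup>+(q :: real \<times> real). 0 \<partial>lborel)"
  proof (rule nn_integral_cong_AE)
    have "AE q in lborel. cmod (psi q - 0) \<noteq> 1"
      using AE_not_in[OF circle_null[of 0 1]] by simp
    thus "AE q in lborel. emeasure lborel {b. (b, q) \<in> ?X} = 0"
      using AE_lborel2_nonzero
    proof eventually_elim
      case (elim q)
      have q: "psi q \<noteq> 0" using elim by (auto simp: psi_eq_0)
      obtain N where N: "N \<in> null_sets lborel" "{x. covered d (psi x * psi q) (psi q) \<and> \<not> strictly_covered d (psi x * psi q) (psi q)} \<subseteq> N"
        using covered_boundary_null[OF q] by blast
      define M where "M = (closed_square - open_square) \<union> N"
      have M: "M \<in> null_sets lborel" unfolding M_def by (intro null_sets.Un square_boundary_null N)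
      have sub: "{b. (b, q) \<in> ?X} \<subseteq> {b. psi_inv (psi b / psi q) \<in> M}"
      proof
        fix b assume "b \<in> {b. (b, q) \<in> ?X}"
        hence b: "(b, q) \<in> B" "(b, q) \<notin> region_interior d" "(b, q) \<notin> region_exterior B d" by blast+
        define x where "x = psi_inv (psi b / psi q)"
        have pb: "psi b = psi x * psi q" using q by (simp add: x_def)
        have nV2: "cmod (psi q) \<le> 1" "x \<in> closed_square" "\<not> strictly_covered d (psi b) (psi q)"
          using b(1,3) q unfolding region_exterior_def x_def by auto
        have "cmod (psi q) < 1" using nV2(1) elim(1) by simp
        hence "x \<notin> open_square \<or> covered d (psi b) (psi q)"
          using b(2) q unfolding region_interior_def x_def by simp
        hence "x \<in> M" using nV2 N(2) unfolding M_def pb by blast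
        thus "b \<in> {b. psi_inv (psi b / psi q) \<in> M}" unfolding x_def by blast
      qed
      have mM: "M \<in> sets borel" using M by auto
      have "{b. psi_inv (psi b / psi q) \<in> M} \<in> sets borel" using mM by measurable
      hence "emeasure lborel {b. (b, q) \<in> ?X} \<le> emeasure lborel {b. psi_inv (psi b / psi q) \<in> M}"
        by (intro emeasure_mono sub) simp
      also have "\<dots> = 0" using emeasure_psi_quotient[OF mM elim(2)] M by auto
      finally show ?case by simp
    qed
  qed
  finally have X0: "emeasure lborel ?X = 0" by simp
  have finB: "emeasure lborel B \<noteq> \<top>" using emeasure_lborel_box_finite[of a b] B by auto
  have subV2: "region_exterior B d \<subseteq> B" "region_interior d \<inter> region_exterior B d = {}"
    using region_exterior_disjoint_region region_interior_subset_region by blast+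
  have fB: "B \<in> fmeasurable lborel" using mB finB by (intro fmeasurableI) (simp_all add: less_top)
  have f1: "region_interior d \<in> fmeasurable lborel" "region_exterior B d \<in> fmeasurable lborel" "?X \<in> fmeasurable lborel"
    by (rule fmeasurableI2[OF fB]; use m1 m2 mX sub subV2(1) in auto)+
  have fin: "emeasure lborel (region_interior d) \<noteq> \<infinity>" "emeasure lborel (region_exterior B d) \<noteq> \<infinity>" "emeasure lborel ?X \<noteq> \<infinity>"
    using f1 by (auto dest!: fmeasurableD2 simp: less_top)
  have un: "emeasure lborel (region_interior d \<union> region_exterior B d) \<noteq> \<infinity>"
    using fmeasurableD2[OF fmeasurable.Un[OF f1(1,2)]] by simp
  have "measure lborel B = measure lborel (region_interior d \<union> region_exterior B d) + measure lborel ?X"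
  proof -
    have "B = (region_interior d \<union> region_exterior B d) \<union> ?X" using sub subV2 by blast
    moreover have "(region_interior d \<union> region_exterior B d) \<inter> ?X = {}" by blast
    moreover have "region_interior d \<union> region_exterior B d \<in> sets lborel" "?X \<in> sets lborel" using m1 m2 mX by simp_all
    ultimately show ?thesis using measure_Union[OF un fin(3)] by metis
  qed
  also have "measure lborel ?X = 0" using X0 by (simp add: measure_def)
  also have "measure lborel (region_interior d \<union> region_exterior B d) = measure lborel (region_interior d) + measure lborel (region_exterior B d)"
    by (rule measure_Union[OF fin(1,2)]) (use m1 m2 subV2(2) in simp_all)
  finally show ?thesis by simp
qed

end

section \<open>The volume of the region\<close>

lemma emeasure_lborel_open_pos:
  fixes S :: "'a::euclidean_space set"
  assumes "open S" "S \<noteq> {}"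
  shows "emeasure lborel S > 0"
proof (rule ccontr)
  assume "\<not> emeasure lborel S > 0"
  hence "S \<in> null_sets lborel" using assms(1) by (intro null_setsI) (auto simp: not_gr_zero)
  hence "negligible S" unfolding negligible_iff_null_sets by (rule null_sets_completionI)
  thus False using open_not_negligible[OF assms] by blast
qed

lemma exponential_tail:
  "emeasure (density lborel (exponential_density 2)) {a<..} = ennreal (if a < 0 then 1 else exp (- 2 * a))"
proof -
  let ?M = "density lborel (exponential_density 2)"
  interpret prob_space ?M by (rule prob_space_exponential_density) simp
  have *: "emeasure ?M {a<..} = ennreal (exp (- 2 * a))" if a: "0 \<le> a" for a
  proof -
    have "emeasure ?M {..a} = erlang_CDF 0 2 a" by (rule emeasure_erlang_density) (use a in simp_all)
    also have "erlang_CDF 0 2 a = 1 - exp (- 2 * a)" using a by (simp add: erlang_CDF_def)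
    finally have "prob {..a} = 1 - exp (- 2 * a)" using a by (simp add: measure_def)
    moreover have "prob {a<..} = 1 - prob {..a}"
    proof -
      have "space ?M - {..a} = {a<..}" by auto
      thus ?thesis using prob_compl[of "{..a}"] by simp
    qed
    ultimately have "prob {a<..} = exp (- 2 * a)" by simp
    thus ?thesis by (simp add: emeasure_eq_measure)
  qed
  show ?thesis
  proof (cases "a < 0")
    case True
    have "1 = emeasure ?M {0<..}" using *[of 0] by simp
    also have "\<dots> \<le> emeasure ?M {a<..}" using True by (intro emeasure_mono) auto
    finally have "emeasure ?M {a<..} = 1" using emeasure_le_1[of "{a<..}"] by (intro antisym)
    thus ?thesis using True by simp
  qed (use * in simp)
qed

context quadratic_lattice
begin

definition uncovered :: "real \<Rightarrow> real \<Rightarrow> (real \<times> real) set"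
  where "uncovered d \<rho> = {x\<in>open_square. \<rho> \<noteq> 0 \<and> \<not> covered d (psi x * of_real \<rho>) (of_real \<rho>)}"

lemma open_uncovered_family: "open {y. snd y \<in> uncovered d (fst y)}"
proof -
  have "continuous_on UNIV (\<lambda>y :: real \<times> (real \<times> real). (d, psi (snd y) * of_real (fst y), complex_of_real (fst y)))"
    by (intro continuous_intros)
  from open_vimage[OF open_not_covered this]
  have "open {y :: real \<times> (real \<times> real). fst y \<noteq> 0 \<and> \<not> covered d (psi (snd y) * of_real (fst y)) (of_real (fst y))}"
    by (simp add: vimage_def)
  moreover have "open {y :: real \<times> (real \<times> real). snd y \<in> open_square}"
    using open_vimage[OF open_open_square, of snd] by (simp add: vimage_def continuous_on_snd)
  ultimately have "open ({y :: real \<times> (real \<times> real). snd y \<in> open_square} \<inter>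
     {y. fst y \<noteq> 0 \<and> \<not> covered d (psi (snd y) * of_real (fst y)) (of_real (fst y))})" by (rule open_Int[rotated])
  also have "\<dots> = {y. snd y \<in> uncovered d (fst y)}" unfolding uncovered_def by blast
  finally show ?thesis .
qed

lemma open_uncovered: "open (uncovered d \<rho>)"
proof -
  have "continuous_on UNIV (\<lambda>x :: real \<times> real. (\<rho>, x))" by (intro continuous_intros)
  from open_vimage[OF open_uncovered_family this] show ?thesis by (simp add: vimage_def)
qed

lemma uncovered_area_measurable [measurable]: "(\<lambda>\<rho>. emeasure lborel (uncovered d \<rho>)) \<in> borel_measurable borel"
proof -
  let ?Q = "{y. snd y \<in> uncovered d (fst y)}"
  have "?Q \<in> sets borel" by (rule borel_open[OF open_uncovered_family])
  hence "?Q \<in> sets (borel \<Otimes>\<^sub>M lborel)" by (simp add: borel_prod[symmetric] cong: sets_pair_measure_cong)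
  from lborel.measurable_emeasure_Pair[OF this] show ?thesis by (simp add: vimage_def)
qed

lemma emeasure_open_square: "emeasure lborel open_square = 1"
proof -
  let ?b = "box (0, 0) (1, 1) :: (real \<times> real) set"
  have sq: "open_square = ?b" unfolding box_prod by (auto simp: box_real)
  have "emeasure lborel ?b \<noteq> \<top>" using emeasure_lborel_box_finite[of "(0, 0)" "(1, 1) :: real \<times> real"] by auto
  hence "emeasure lborel ?b = ennreal (measure lborel ?b)" by (rule emeasure_eq_ennreal_measure)
  moreover have "measure lborel ?b = measure lborel (cbox (0, 0) (1, 1) :: (real \<times> real) set)"
    by (simp only: measure_lborel_box_eq measure_lborel_cbox_eq)
  moreover have "measure lborel (cbox (0, 0) (1, 1) :: (real \<times> real) set) = 1" by (simp add: content_Pair)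
  ultimately show ?thesis unfolding sq by simp
qed

lemma uncovered_0: "\<rho> \<noteq> 0 \<Longrightarrow> emeasure lborel (uncovered 0 \<rho>) = 1"
  unfolding uncovered_def using emeasure_open_square by (simp add: not_covered_0)

text \<open>
  The weight \<open>|q|\<^sup>2\<close> is the area of the set of all \<open>b\<close> with \<open>b / q\<close> in the unit square.
\<close>
definition disc_weight :: "real \<times> real \<Rightarrow> ennreal"
  where "disc_weight q = indicator {q. psi q \<noteq> 0 \<and> cmod (psi q) < 1} q * ennreal ((cmod (psi q)) ^ 2)"

lemma disc_set_measurable [measurable]: "{q. psi q \<noteq> 0 \<and> cmod (psi q) < c} \<in> sets borel"
  by measurable

lemma disc_weight_measurable [measurable]: "disc_weight \<in> borel_measurable borel"
  unfolding disc_weight_def by measurable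

lemma emeasure_region_interior: "emeasure lborel (region_interior d) = (\<integral>\<^sup>+q. disc_weight q * emeasure lborel (uncovered d (cmod (psi q))) \<partial>lborel)"
proof -
  have "emeasure lborel (region_interior d) = (\<integral>\<^sup>+q. emeasure lborel {b. (b, q) \<in> region_interior d} \<partial>lborel)"
    by (rule lborel2_section[OF borel_open[OF open_region_interior]])
  also have "\<dots> = (\<integral>\<^sup>+q. disc_weight q * emeasure lborel (uncovered d (cmod (psi q))) \<partial>lborel)"
  proof (rule nn_integral_cong_AE)
    show "AE q in lborel. emeasure lborel {b. (b, q) \<in> region_interior d} = disc_weight q * emeasure lborel (uncovered d (cmod (psi q)))"
      using AE_lborel2_nonzero
    proof eventually_elim
      case (elim q)
      have q: "psi q \<noteq> 0" using elim by (auto simp: psi_eq_0)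
      show ?case
      proof (cases "cmod (psi q) < 1")
        case False
        hence empty: "{b. (b, q) \<in> region_interior d} = {}" unfolding region_interior_def by auto
        show ?thesis unfolding empty using False by (simp add: disc_weight_def)
      next
        case True
        have "{b. (b, q) \<in> region_interior d} = {b. psi_inv (psi b / psi q) \<in> uncovered d (cmod (psi q))}"
        proof (intro Collect_cong)
          fix b
          define x where "x = psi_inv (psi b / psi q)"
          have pb: "psi b = psi x * psi q" using q by (simp add: x_def)
          show "(b, q) \<in> region_interior d \<longleftrightarrow> psi_inv (psi b / psi q) \<in> uncovered d (cmod (psi q))"
            unfolding region_interior_def uncovered_def mem_Collect_eq fst_conv snd_conv x_def[symmetric] pb
              covered_scale[of d "psi x" "psi q"] using q True by simp
        qed
        thus ?thesis using emeasure_psi_quotient[OF borel_open[OF open_uncovered] elim] True q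
          by (simp add: disc_weight_def)
      qed
    qed
  qed
  finally show ?thesis .
qed

text \<open>
  Shrinking the disc by \<open>c\<close> costs \<open>c\<^sup>2\<close> for the area and \<open>c\<^sup>2\<close> for the weight.
\<close>
lemma disc_weight_scaling:
  assumes c: "0 < c" "c \<le> 1"
  shows "(\<integral>\<^sup>+q. disc_weight q * indicator {q. cmod (psi q) < c} q \<partial>lborel) =
     ennreal (c ^ 4) * (\<integral>\<^sup>+q. disc_weight q \<partial>lborel)"
proof -
  have [measurable]: "{q. cmod (psi q) < c} \<in> sets borel" by measurable
  have psi_sc: "psi (c * fst q, c * snd q) = of_real c * psi q" for q
    by (simp add: psi_def algebra_simps)
  have "(\<integral>\<^sup>+q. disc_weight q * indicator {q. cmod (psi q) < c} q \<partial>lborel) =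
    ennreal \<bar>c * c - 0 * 0\<bar> * (\<integral>\<^sup>+q. disc_weight (c * fst q + 0 * snd q, 0 * fst q + c * snd q) *
      indicator {q. cmod (psi q) < c} (c * fst q + 0 * snd q, 0 * fst q + c * snd q) \<partial>lborel)"
    by (rule linear_map_nn_integral) (use c in \<open>measurable, simp_all\<close>)
  also have "\<dots> = ennreal (c * c) * (\<integral>\<^sup>+q. ennreal (c ^ 2) * disc_weight q \<partial>lborel)"
  proof -
    have "disc_weight (c * fst q + 0 * snd q, 0 * fst q + c * snd q) *
      indicator {q. cmod (psi q) < c} (c * fst q + 0 * snd q, 0 * fst q + c * snd q) = ennreal (c ^ 2) * disc_weight q" for q
    proof -
      have n: "cmod (psi (c * fst q, c * snd q)) = c * cmod (psi q)"
        unfolding psi_sc norm_mult using c by simp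
      have z: "psi (c * fst q, c * snd q) \<noteq> 0 \<longleftrightarrow> psi q \<noteq> 0" unfolding psi_sc using c by simp
      have lt: "c * cmod (psi q) < c \<longleftrightarrow> cmod (psi q) < 1" using c by simp
      have lt1: "cmod (psi q) < 1 \<Longrightarrow> c * cmod (psi q) < 1"
        using lt c by (metis less_le_trans)
      show ?thesis
      proof (cases "psi q \<noteq> 0 \<and> cmod (psi q) < 1")
        case True
        thus ?thesis using z lt lt1 c
          by (simp add: disc_weight_def n power_mult_distrib ennreal_mult)
      next
        case False
        thus ?thesis using z lt by (auto simp: disc_weight_def n indicator_def)
      qed
    qed
    thus ?thesis using c by simp
  qed
  also have "\<dots> = ennreal (c * c) * (ennreal (c ^ 2) * (\<integral>\<^sup>+q. disc_weight q \<partial>lborel))"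
    by (subst nn_integral_cmult) simp_all
  also have "\<dots> = ennreal (c ^ 4) * (\<integral>\<^sup>+q. disc_weight q \<partial>lborel)"
    unfolding mult.assoc[symmetric] using c by (subst ennreal_mult[symmetric]) (simp_all add: power4_eq_xxxx power2_eq_square mult.assoc)
  finally show ?thesis .
qed

definition total_mass :: ennreal where "total_mass = (\<integral>\<^sup>+q. disc_weight q \<partial>lborel)"

lemma region_interior_0: "emeasure lborel (region_interior 0) = total_mass"
  unfolding emeasure_region_interior total_mass_def
  by (intro nn_integral_cong) (auto simp: disc_weight_def indicator_def uncovered_0)

lemma region_interior_finite: "emeasure lborel (region_interior d) \<noteq> \<top>"
proof -
  obtain A where A: "region d \<subseteq> box (- A) A" using region_bounded by blast
  have "emeasure lborel (region_interior d) \<le> emeasure lborel (box (- A) A)"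
    using A region_interior_subset_region by (intro emeasure_mono) (blast, simp)
  thus ?thesis using emeasure_lborel_box_finite[of "- A" A] by (auto simp: top_unique)
qed

lemma total_mass: "total_mass \<noteq> \<top>" "total_mass > 0"
proof -
  show "total_mass \<noteq> \<top>" using region_interior_finite[of 0] region_interior_0 by simp
  have "(psi_inv (psi (1/2, 1/2) * (1/2)), psi_inv (1/2)) \<in> region_interior 0"
    unfolding region_interior_def by (simp add: not_covered_0)
  hence "region_interior 0 \<noteq> {}" by blast
  from emeasure_lborel_open_pos[OF open_region_interior this] show "total_mass > 0" by (simp only: region_interior_0)
qed

text \<open>
  Since \<open>s > a\<close> means \<open>|q| < exp (- a / 2)\<close>, a disc whose share of the mass is \<open>exp (- 2 * a)\<close>,
  the scaling law makes \<open>s = - 2 * ln |q|\<close> exponential with rate \<open>2\<close>.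
\<close>
lemma radial_law:
  "distr (density lborel disc_weight) borel (\<lambda>q. - 2 * ln (cmod (psi q))) =
   density lborel (\<lambda>s. total_mass * ennreal (exponential_density 2 s))" (is "?M = ?N")
proof (rule measure_eqI_lessThan)
  have meas: "(\<lambda>q. - 2 * ln (cmod (psi q))) \<in> borel_measurable borel" by measurable
  have eq: "emeasure ?M {a<..} = total_mass * ennreal (if a < 0 then 1 else exp (- 2 * a))" for a
  proof -
    define c where "c = (if a < 0 then 1 else exp (- a / 2))"
    have c: "0 < c" "c \<le> 1" by (auto simp: c_def)
    have vm: "(\<lambda>q. - 2 * ln (cmod (psi q))) -` {a<..} \<in> sets borel"
      using measurable_sets[OF meas, of "{a<..}"] by simp
    have "emeasure ?M {a<..} = emeasure (density lborel disc_weight) ((\<lambda>q. - 2 * ln (cmod (psi q))) -` {a<..})"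
      using meas by (subst emeasure_distr) simp_all
    also have "\<dots> = (\<integral>\<^sup>+q. disc_weight q * indicator ((\<lambda>q. - 2 * ln (cmod (psi q))) -` {a<..}) q \<partial>lborel)"
      using vm by (intro emeasure_density) simp_all
    also have "\<dots> = (\<integral>\<^sup>+q. disc_weight q * indicator {q. cmod (psi q) < c} q \<partial>lborel)"
    proof (intro nn_integral_cong)
      fix q
      show "disc_weight q * indicator ((\<lambda>q. - 2 * ln (cmod (psi q))) -` {a<..}) q = disc_weight q * indicator {q. cmod (psi q) < c} q"
      proof (cases "psi q \<noteq> 0 \<and> cmod (psi q) < 1")
        case True
        hence ln: "ln (cmod (psi q)) < 0" by simp
        have "a < - 2 * ln (cmod (psi q)) \<longleftrightarrow> cmod (psi q) < c"
        proof (cases "a < 0")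
          case True
          have "a < - 2 * ln (cmod (psi q))" using True ln by linarith
          thus ?thesis using True \<open>psi q \<noteq> 0 \<and> cmod (psi q) < 1\<close> by (simp add: c_def)
        next
          case False
          have "a < - 2 * ln (cmod (psi q)) \<longleftrightarrow> ln (cmod (psi q)) < - a / 2" by linarith
          also have "\<dots> \<longleftrightarrow> cmod (psi q) < exp (- a / 2)"
            using True by (metis exp_less_cancel_iff exp_ln zero_less_norm_iff)
          finally show ?thesis using False by (simp add: c_def)
        qed
        thus ?thesis by (simp add: indicator_def)
      qed (auto simp: disc_weight_def)
    qed
    also have "\<dots> = ennreal (c ^ 4) * total_mass" unfolding total_mass_def by (rule disc_weight_scaling[OF c])
    also have "c ^ 4 = (if a < 0 then 1 else exp (- 2 * a))"
      by (simp add: c_def exp_of_nat_mult[symmetric])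
    finally show ?thesis by (simp add: mult.commute)
  qed
  show "emeasure ?M {a<..} < \<infinity>" for a
    unfolding eq using total_mass by (auto simp: ennreal_mult_less_top less_top)
  show "emeasure ?M {a<..} = emeasure ?N {a<..}" for a
  proof -
    have "emeasure ?N {a<..} = (\<integral>\<^sup>+s. total_mass * ennreal (exponential_density 2 s) * indicator {a<..} s \<partial>lborel)"
      by (intro emeasure_density) simp_all
    also have "\<dots> = total_mass * (\<integral>\<^sup>+s. ennreal (exponential_density 2 s) * indicator {a<..} s \<partial>lborel)"
      unfolding mult.assoc by (rule nn_integral_cmult) measurable
    also have "(\<integral>\<^sup>+s. ennreal (exponential_density 2 s) * indicator {a<..} s \<partial>lborel) = emeasure (density lborel (exponential_density 2)) {a<..}"
      by (intro emeasure_density[symmetric]) simp_all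
    finally show ?thesis unfolding eq exponential_tail by simp
  qed
qed simp_all

definition gap_tail :: "real \<Rightarrow> ennreal"
  where "gap_tail d = (\<integral>\<^sup>+s. ennreal (exponential_density 2 s) * emeasure lborel (uncovered d (exp (- s / 2))) \<partial>lborel)"

lemma emeasure_region_interior_gap_tail: "emeasure lborel (region_interior d) = emeasure lborel (region_interior 0) * gap_tail d"
proof -
  define g where "g = (\<lambda>s. emeasure lborel (uncovered d (exp (- s / 2))))"
  have [measurable]: "g \<in> borel_measurable borel" unfolding g_def by measurable
  have "emeasure lborel (region_interior d) = (\<integral>\<^sup>+q. disc_weight q * g (- 2 * ln (cmod (psi q))) \<partial>lborel)"
    unfolding emeasure_region_interior
  proof (intro nn_integral_cong)
    fix q
    show "disc_weight q * emeasure lborel (uncovered d (cmod (psi q))) = disc_weight q * g (- 2 * ln (cmod (psi q)))"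
      by (cases "psi q = 0") (simp_all add: disc_weight_def g_def)
  qed
  also have "\<dots> = (\<integral>\<^sup>+q. g (- 2 * ln (cmod (psi q))) \<partial>density lborel disc_weight)"
    by (rule nn_integral_density[symmetric]) measurable
  also have "\<dots> = (\<integral>\<^sup>+s. g s \<partial>distr (density lborel disc_weight) borel (\<lambda>q. - 2 * ln (cmod (psi q))))"
    by (rule nn_integral_distr[symmetric]) measurable
  also have "\<dots> = (\<integral>\<^sup>+s. total_mass * ennreal (exponential_density 2 s) * g s \<partial>lborel)"
    unfolding radial_law by (rule nn_integral_density) measurable
  also have "\<dots> = total_mass * (\<integral>\<^sup>+s. ennreal (exponential_density 2 s) * g s \<partial>lborel)"
    unfolding mult.assoc by (rule nn_integral_cmult) measurable
  also have "(\<integral>\<^sup>+s. ennreal (exponential_density 2 s) * g s \<partial>lborel) = gap_tail d"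
    unfolding gap_tail_def g_def by (rule refl)
  finally show ?thesis by (simp only: region_interior_0)
qed

lemma measure_region_interior_0_pos: "measure lborel (region_interior 0) > 0"
  using total_mass region_interior_0 by (simp add: measure_def enn2real_positive_iff less_top)

lemma gap_tail_real: "measure lborel (region_interior d) / measure lborel (region_interior 0) = enn2real (gap_tail d)"
proof -
  have "measure lborel (region_interior d) = measure lborel (region_interior 0) * enn2real (gap_tail d)"
    unfolding measure_def emeasure_region_interior_gap_tail[of d] enn2real_mult by simp
  thus ?thesis using measure_region_interior_0_pos by simp
qed

lemma region_interior_antimono: "d \<le> d' \<Longrightarrow> region_interior d' \<subseteq> region_interior d"
  unfolding region_interior_def using covered_mono by blast

text \<open>
  A point that is uncovered at level \<open>d\<close> remains uncovered at slightly larger levels, by openness.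
\<close>
lemma measure_region_interior_right: "(\<lambda>n. measure lborel (region_interior (d + 1 / real (Suc n)))) \<longlonglongrightarrow> measure lborel (region_interior d)"
proof -
  let ?A = "\<lambda>n. region_interior (d + 1 / real (Suc n))"
  have inc: "incseq ?A"
    by (intro incseq_SucI region_interior_antimono) (simp add: frac_le)
  have un: "(\<Union>n. ?A n) = region_interior d"
  proof
    show "(\<Union>n. ?A n) \<subseteq> region_interior d" by (intro UN_least region_interior_antimono) simp
    show "region_interior d \<subseteq> (\<Union>n. ?A n)"
    proof
      fix v assume v: "v \<in> region_interior d"
      have "continuous_on UNIV (\<lambda>t :: real. (t, v))" by (intro continuous_intros)
      from open_vimage[OF open_not_covered_family this]
      have op: "open {t. psi (snd v) \<noteq> 0 \<and> \<not> covered t (psi (fst v)) (psi (snd v))}" by (simp add: vimage_def)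
      have "(\<lambda>n. d + 1 / real (Suc n)) \<longlonglongrightarrow> d" by real_asymp
      from topological_tendstoD[OF this op] v
      have "\<forall>\<^sub>F n in sequentially. \<not> covered (d + 1 / real (Suc n)) (psi (fst v)) (psi (snd v))"
        unfolding region_interior_def by simp
      then obtain n where "\<not> covered (d + 1 / real (Suc n)) (psi (fst v)) (psi (snd v))"
        using eventually_happens'[OF sequentially_bot] by blast
      hence "v \<in> ?A n" using v unfolding region_interior_def by blast
      thus "v \<in> (\<Union>n. ?A n)" by blast
    qed
  qed
  have "(\<lambda>n. measure lborel (?A n)) \<longlonglongrightarrow> measure lborel (\<Union>n. ?A n)"
    by (rule Lim_measure_incseq[OF _ inc]) (use open_region_interior un region_interior_finite in auto)
  thus ?thesis unfolding un .
qed

text \<open>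
  Openness of the exterior gives continuity from the left for its measure, and the two measures add up
  to that of the box. Both one-sided limits are needed because narrow convergence determines the tail of
  the limit measure only at continuity points.
\<close>
lemma measure_region_interior_left: "(\<lambda>n. measure lborel (region_interior (d - 1 / real (Suc n)))) \<longlonglongrightarrow> measure lborel (region_interior d)"
proof -
  obtain A where A: "\<And>d. region d \<subseteq> box (- A) A" using region_bounded by blast
  let ?B = "box (- A) A"
  let ?V = "\<lambda>n. region_exterior ?B (d - 1 / real (Suc n))"
  have strictly_covered_mono: "strictly_covered t' z w" if "strictly_covered t z w" "t \<le> t'" for t t' z w
  proof -
    obtain P Q where PQ: "P \<in> \<O>" "Q \<in> \<O>" "unimodular P Q" "P \<noteq> 0" "cmod (P * z - Q * w) < 1"
      "cmod P < t * cmod w * cmod (P * z - Q * w)" using \<open>strictly_covered t z w\<close> unfolding strictly_covered_def by blast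
    have "t * cmod w * cmod (P * z - Q * w) \<le> t' * cmod w * cmod (P * z - Q * w)"
      using that(2) by (intro mult_right_mono) auto
    thus ?thesis unfolding strictly_covered_def using PQ by (meson less_le_trans)
  qed
  have inc: "incseq ?V"
  proof (intro incseq_SucI subsetI)
    fix n v assume v: "v \<in> ?V n"
    have "d - 1 / real (Suc n) \<le> d - 1 / real (Suc (Suc n))" by (simp add: frac_le)
    thus "v \<in> ?V (Suc n)" using v strictly_covered_mono unfolding region_exterior_def by blast
  qed
  have un: "(\<Union>n. ?V n) = region_exterior ?B d"
  proof
    show "(\<Union>n. ?V n) \<subseteq> region_exterior ?B d"
    proof (intro UN_least subsetI)
      fix n v assume v: "v \<in> ?V n"
      have "d - 1 / real (Suc n) \<le> d" by simp
      thus "v \<in> region_exterior ?B d" using v strictly_covered_mono unfolding region_exterior_def by blast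
    qed
    show "region_exterior ?B d \<subseteq> (\<Union>n. ?V n)"
    proof
      fix v assume v: "v \<in> region_exterior ?B d"
      show "v \<in> (\<Union>n. ?V n)"
      proof (cases "strictly_covered d (psi (fst v)) (psi (snd v))")
        case False
        hence "v \<in> ?V 0" using v unfolding region_exterior_def by blast
        thus ?thesis by blast
      next
        case True
        then obtain P Q where PQ: "P \<in> \<O>" "Q \<in> \<O>" "unimodular P Q" "P \<noteq> 0" "cmod (P * psi (fst v) - Q * psi (snd v)) < 1"
          "cmod P < d * cmod (psi (snd v)) * cmod (P * psi (fst v) - Q * psi (snd v))" unfolding strictly_covered_def by blast
        have "(\<lambda>n. (d - 1 / real (Suc n)) * cmod (psi (snd v)) * cmod (P * psi (fst v) - Q * psi (snd v))) \<longlonglongrightarrow>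
           d * cmod (psi (snd v)) * cmod (P * psi (fst v) - Q * psi (snd v))"
          by (intro tendsto_mult tendsto_const) real_asymp
        from order_tendstoD(1)[OF this PQ(6)]
        obtain n where "cmod P < (d - 1 / real (Suc n)) * cmod (psi (snd v)) * cmod (P * psi (fst v) - Q * psi (snd v))"
          using eventually_happens'[OF sequentially_bot] by blast
        hence "strictly_covered (d - 1 / real (Suc n)) (psi (fst v)) (psi (snd v))"
          unfolding strictly_covered_def using PQ(1-5) by blast
        hence "v \<in> ?V n" using v unfolding region_exterior_def by blast
        thus ?thesis by blast
      qed
    qed
  qed
  have eq: "measure lborel (region_interior t) = measure lborel ?B - measure lborel (region_exterior ?B t)" for t
    using measure_region_interior_region_exterior[of ?B "- A" A t] A region_interior_subset_region by force
  have V2sets: "region_exterior ?B t \<in> sets lborel" for t using borel_open[OF open_region_exterior[OF open_box]] by simp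
  have "(\<lambda>n. measure lborel (?V n)) \<longlonglongrightarrow> measure lborel (\<Union>n. ?V n)"
  proof (rule Lim_measure_incseq[OF _ inc])
    show "range ?V \<subseteq> sets lborel" using V2sets by blast
    have "emeasure lborel (region_exterior ?B d) \<le> emeasure lborel ?B"
      by (intro emeasure_mono) (auto simp: region_exterior_def)
    thus "emeasure lborel (\<Union>n. ?V n) \<noteq> \<infinity>"
      unfolding un using emeasure_lborel_box_finite[of "- A" A] by (auto simp: top_unique)
  qed
  hence "(\<lambda>n. measure lborel ?B - measure lborel (?V n)) \<longlonglongrightarrow> measure lborel ?B - measure lborel (region_exterior ?B d)"
    unfolding un by (intro tendsto_diff tendsto_const)
  thus ?thesis unfolding eq .
qed

end

section \<open>Farey points and their gaps\<close>

locale quadratic_integers = quadratic_lattice +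
  fixes K :: "complex set"
  assumes ring_of_integers_eq: "ring_of_integers K = \<O>"
begin

lemma primitive_pairs_iff: "(p, q) \<in> primitive_pairs K \<longleftrightarrow> p \<in> \<O> \<and> q \<in> \<O> \<and> unimodular p q"
proof -
  have "{p * a + q * b | a b. a \<in> \<O> \<and> b \<in> \<O>} = \<O> \<longleftrightarrow> unimodular p q" if pq: "p \<in> \<O>" "q \<in> \<O>"
  proof
    assume "{p * a + q * b | a b. a \<in> \<O> \<and> b \<in> \<O>} = \<O>"
    hence "1 \<in> {p * a + q * b | a b. a \<in> \<O> \<and> b \<in> \<O>}" using O_1 by blast
    then obtain a b where ab: "1 = p * a + q * b" "a \<in> \<O>" "b \<in> \<O>" by (elim CollectE exE conjE)
    show "unimodular p q" unfolding unimodular_def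
      by (rule bexI[OF _ ab(2)], rule bexI[OF _ ab(3)], rule ab(1)[symmetric])
  next
    assume "unimodular p q"
    then obtain x y where xy: "x \<in> \<O>" "y \<in> \<O>" "p * x + q * y = 1" unfolding unimodular_def by (elim bexE)
    show "{p * a + q * b | a b. a \<in> \<O> \<and> b \<in> \<O>} = \<O>"
    proof (intro equalityI subsetI)
      fix z assume "z \<in> {p * a + q * b | a b. a \<in> \<O> \<and> b \<in> \<O>}"
      then obtain a b where ab: "z = p * a + q * b" "a \<in> \<O>" "b \<in> \<O>" by (elim CollectE exE conjE)
      show "z \<in> \<O>" unfolding ab(1) by (intro O_add O_mult pq ab)
    next
      fix z assume z: "z \<in> \<O>"
      have "z = (p * x + q * y) * z" by (simp only: xy mult_1_left)
      hence "z = p * (x * z) + q * (y * z)" by (simp add: algebra_simps)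
      moreover have "x * z \<in> \<O>" "y * z \<in> \<O>" by (intro O_mult xy z)+
      ultimately show "z \<in> {p * a + q * b | a b. a \<in> \<O> \<and> b \<in> \<O>}" by (intro CollectI exI conjI)
    qed
  qed
  thus ?thesis unfolding primitive_pairs_def ring_of_integers_eq by auto
qed

lemma pr_eq_iff: "pr K z = pr K z' \<longleftrightarrow> z - z' \<in> \<O>"
proof
  assume "pr K z = pr K z'"
  moreover have "z \<in> pr K z" unfolding pr_def ring_of_integers_eq by (intro CollectI exI[of _ 0]) simp
  ultimately obtain a where a: "z = z' + a" "a \<in> \<O>" unfolding pr_def ring_of_integers_eq by blast
  thus "z - z' \<in> \<O>" by simp
next
  assume d: "z - z' \<in> \<O>"
  have sub: "pr K z \<subseteq> pr K z'" if "z - z' \<in> \<O>" for z z'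
  proof
    fix x assume "x \<in> pr K z"
    then obtain a where a: "x = z + a" "a \<in> \<O>" unfolding pr_def ring_of_integers_eq by blast
    hence "x = z' + ((z - z') + a)" "(z - z') + a \<in> \<O>" using O_add[OF that a(2)] by simp_all
    thus "x \<in> pr K z'" unfolding pr_def ring_of_integers_eq by blast
  qed
  have "z' - z \<in> \<O>" using O_minus[OF d] by simp
  thus "pr K z = pr K z'" using sub[OF d] sub by blast
qed

text \<open>
  Only finitely many lattice translates can compete, so the infimum over the cosets is a minimum.
\<close>
lemma torus_dist_attained: "\<exists>a\<in>\<O>. torus_dist (pr K z) (pr K z') = cmod (z - z' - a)"
proof -
  define S where "S = {a\<in>\<O>. cmod (z - z' - a) \<le> cmod (z - z')}"
  have "S \<subseteq> {a\<in>\<O>. cmod a \<le> 2 * cmod (z - z')}"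
  proof
    fix a assume a: "a \<in> S"
    have "cmod a \<le> cmod (z - z') + cmod (z - z' - a)"
      using norm_triangle_ineq4[of "z - z'" "z - z' - a"] by simp
    thus "a \<in> {a\<in>\<O>. cmod a \<le> 2 * cmod (z - z')}" using a unfolding S_def by simp
  qed
  hence finS: "finite S" by (rule finite_subset) (rule finite_O_ball)
  have "0 \<in> S" by (simp add: S_def)
  then obtain a where a: "a \<in> S" "\<forall>b\<in>S. cmod (z - z' - a) \<le> cmod (z - z' - b)"
    using finS ex_min_if_finite[of "(\<lambda>b. cmod (z - z' - b)) ` S"] by (metis (mono_tags, lifting) arg_min_if_finite(1) arg_min_least empty_iff)
  have min: "cmod (z - z' - a) \<le> cmod (z - z' - b)" if "b \<in> \<O>" for b
  proof (cases "b \<in> S")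
    case False
    hence "cmod (z - z' - b) > cmod (z - z')" using that unfolding S_def by simp
    moreover have "cmod (z - z' - a) \<le> cmod (z - z')" using a(1) unfolding S_def by blast
    ultimately show ?thesis by linarith
  qed (use a(2) in blast)
  have aO: "a \<in> \<O>" using a(1) unfolding S_def by blast
  have mem: "z \<in> pr K z" "z' + a \<in> pr K z'"
    unfolding pr_def ring_of_integers_eq using aO by (intro CollectI exI[of _ 0], simp, blast)
  have "setdist (pr K z) (pr K z') \<le> dist z (z' + a)" by (rule setdist_le_dist[OF mem])
  moreover have "cmod (z - z' - a) \<le> setdist (pr K z) (pr K z')"
  proof (rule le_setdistI)
    fix x y assume "x \<in> pr K z" "y \<in> pr K z'"
    then obtain c c' where c: "x = z + c" "c \<in> \<O>" "y = z' + c'" "c' \<in> \<O>"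
      unfolding pr_def ring_of_integers_eq by blast
    have "cmod (z - z' - a) \<le> cmod (z - z' - (c' - c))" by (intro min O_diff c)
    thus "cmod (z - z' - a) \<le> dist x y" by (simp add: dist_norm c algebra_simps)
  qed (use mem in blast)+
  ultimately show ?thesis unfolding torus_dist_def
    by (intro bexI[OF _ aO]) (simp add: dist_norm diff_diff_eq)
qed

lemma torus_dist_le: "a \<in> \<O> \<Longrightarrow> torus_dist (pr K z) (pr K z') \<le> cmod (z - z' - a)"
proof -
  assume aO: "a \<in> \<O>"
  have mem: "z \<in> pr K z" "z' + a \<in> pr K z'"
    unfolding pr_def ring_of_integers_eq using aO by (intro CollectI exI[of _ 0], simp, blast)
  have "setdist (pr K z) (pr K z') \<le> dist z (z' + a)" by (rule setdist_le_dist[OF mem])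
  thus ?thesis by (simp add: torus_dist_def dist_norm diff_diff_eq)
qed

lemma reduce_mod_O: "\<exists>e\<in>\<O>. psi_inv (z - e) \<in> unit_square"
proof -
  define x where "x = psi_inv z"
  define e where "e = emb (\<lfloor>fst x\<rfloor>, \<lfloor>snd x\<rfloor>)"
  have e: "psi_inv e = (of_int \<lfloor>fst x\<rfloor>, of_int \<lfloor>snd x\<rfloor>)"
    unfolding e_def psi_emb[symmetric] fst_conv snd_conv psi_inv_psi by (rule refl)
  have "psi_inv (z - e) \<in> unit_square"
    unfolding psi_inv_diff e x_def[symmetric] by simp linarith
  moreover have "e \<in> \<O>" unfolding e_def by (rule emb_in)
  ultimately show ?thesis by blast
qed

lemma unit_square_unique:
  assumes "psi_inv z \<in> unit_square" "psi_inv z' \<in> unit_square" "z - z' \<in> \<O>"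
  shows "z = z'"
proof -
  obtain v where v: "z - z' = emb v" using assms(3) unfolding \<O>_def by blast
  have "psi_inv z - psi_inv z' = (of_int (fst v), of_int (snd v))"
    unfolding psi_inv_diff[symmetric] v psi_emb[symmetric] psi_inv_psi by (rule refl)
  hence 1: "fst (psi_inv z) - fst (psi_inv z') = of_int (fst v)" "snd (psi_inv z) - snd (psi_inv z') = of_int (snd v)"
    by (simp_all add: prod_eq_iff)
  have "\<bar>real_of_int (fst v)\<bar> < 1" "\<bar>real_of_int (snd v)\<bar> < 1"
    using assms(1,2) unfolding 1[symmetric] mem_Collect_eq by linarith+
  hence "fst v = 0" "snd v = 0" by linarith+
  thus ?thesis using v by (simp add: emb_def)
qed

definition units :: "complex set" where "units = {u\<in>\<O>. \<exists>u'\<in>\<O>. u * u' = 1}"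

lemma norm_unit: assumes "u \<in> units" shows "cmod u = 1"
proof -
  obtain u' where u: "u \<in> \<O>" "u' \<in> \<O>" "u * u' = 1" using assms unfolding units_def by blast
  hence nz: "u \<noteq> 0" "u' \<noteq> 0" by auto
  have 1: "cmod u \<ge> 1" "cmod u' \<ge> 1" using O_norm_ge_1 u nz by blast+
  have "cmod u * cmod u' = 1" using u(3) by (metis norm_mult norm_one)
  moreover have "cmod u * 1 \<le> cmod u * cmod u'" using 1 by (intro mult_left_mono) auto
  ultimately show ?thesis using 1 by linarith
qed

text \<open>
  At level \<open>0\<close> nothing is covered, so membership in \<open>region 0\<close> only says that \<open>0 < |q| \<le> N\<close> and
  that \<open>b / q\<close> lies in the fundamental parallelogram.
\<close>
definition lattice_points :: "real \<Rightarrow> int4 set"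
  where "lattice_points N = {v\<in>primitive4. scale4 N v \<in> region 0}"

definition inverse_rel :: "int4 \<Rightarrow> complex \<Rightarrow> bool"
  where "inverse_rel v p \<longleftrightarrow> p \<in> \<O> \<and> (\<exists>a\<in>\<O>. p * emb (fst v) - emb (snd v) * a = 1)"

text \<open>
  The code \<open>(b, q)\<close> stands for \<open>p / q\<close> with \<open>p\<close> an inverse of \<open>b\<close> modulo \<open>q\<close>. The choice of \<open>p\<close> does
  not matter modulo the lattice, by \<open>inverse_rel_unique\<close>.
\<close>
definition farey_point :: "int4 \<Rightarrow> complex set"
  where "farey_point v = pr K ((SOME p. inverse_rel v p) / emb (snd v))"

lemma psi_scale4: "psi (fst (scale4 N v)) = emb (fst v) / of_real N" "psi (snd (scale4 N v)) = emb (snd v) / of_real N"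
  by (simp_all add: scale4_def psi_def emb_def add_divide_distrib)

lemma scale4_region:
  assumes "N > 0"
  shows "scale4 N v \<in> region d \<longleftrightarrow> emb (snd v) \<noteq> 0 \<and> cmod (emb (snd v)) \<le> N \<and>
    psi_inv (emb (fst v) / emb (snd v)) \<in> unit_square \<and> \<not> covered d (emb (fst v) / of_real N) (emb (snd v) / of_real N)"
  unfolding region_def mem_Collect_eq psi_scale4 using assms by (simp add: norm_divide)

lemma lattice_pointsD:
  assumes "v \<in> lattice_points N" "N > 0"
  shows "emb (snd v) \<noteq> 0" "cmod (emb (snd v)) \<le> N" "psi_inv (emb (fst v) / emb (snd v)) \<in> unit_square"
    "unimodular (emb (fst v)) (emb (snd v))"
  using assms unfolding lattice_points_def mem_Collect_eq scale4_region[OF assms(2)] primitive4_def by blast+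

lemma lattice_pointsI:
  assumes "N > 0" "emb (snd v) \<noteq> 0" "cmod (emb (snd v)) \<le> N" "psi_inv (emb (fst v) / emb (snd v)) \<in> unit_square"
    "unimodular (emb (fst v)) (emb (snd v))"
  shows "v \<in> lattice_points N"
  unfolding lattice_points_def mem_Collect_eq scale4_region[OF assms(1)] primitive4_def
  using assms not_covered_0 by blast

lemma finite_lattice_points: "N > 0 \<Longrightarrow> finite (lattice_points N)"
proof -
  assume N: "N > 0"
  obtain A where A: "region 0 \<subseteq> box (- A) A" using region_bounded by blast
  show ?thesis by (rule finite_subset[OF _ finite_scale4_box[OF N, of "- A" A]]) (use A in \<open>auto simp: lattice_points_def\<close>)
qed

lemma inverse_rel_exists:
  assumes "unimodular (emb (fst v)) (emb (snd v))"
  shows "\<exists>p. inverse_rel v p"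
proof -
  obtain x y where xy: "x \<in> \<O>" "y \<in> \<O>" "emb (fst v) * x + emb (snd v) * y = 1"
    using assms unfolding unimodular_def by (elim bexE)
  have "x * emb (fst v) - emb (snd v) * (- y) = 1" using xy(3) by (simp add: mult.commute)
  thus ?thesis unfolding inverse_rel_def using xy(1) O_minus[OF xy(2)] by blast
qed

lemma inverse_rel_unique:
  assumes "inverse_rel v p" "inverse_rel v p'" "emb (snd v) \<noteq> 0"
  shows "p / emb (snd v) - p' / emb (snd v) \<in> \<O>"
proof -
  define b q where "b = emb (fst v)" and "q = emb (snd v)"
  obtain a a' where a: "a \<in> \<O>" "p * b - q * a = 1" "a' \<in> \<O>" "p' * b - q * a' = 1" "p \<in> \<O>" "p' \<in> \<O>"
    using assms(1,2) unfolding inverse_rel_def b_def q_def by blast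
  have "p - p' = p * (p' * b - q * a') - p' * (p * b - q * a)" unfolding a(2,4) by simp
  also have "\<dots> = q * (p' * a - p * a')" by (simp add: algebra_simps)
  finally have "p / q - p' / q = p' * a - p * a'"
    using assms(3) unfolding diff_divide_distrib[symmetric] q_def[symmetric] by simp
  also have "\<dots> \<in> \<O>" by (intro O_diff O_mult a)
  finally show ?thesis unfolding q_def .
qed

lemma farey_point_eq:
  assumes "inverse_rel v p" "emb (snd v) \<noteq> 0"
  shows "farey_point v = pr K (p / emb (snd v))"
proof -
  have "inverse_rel v (SOME p. inverse_rel v p)" using assms(1) by (rule someI)
  from inverse_rel_unique[OF this assms] show ?thesis unfolding farey_point_def pr_eq_iff .
qed

lemma farey_eq: "farey K t = {pr K (p / q) | p q. p \<in> \<O> \<and> q \<in> \<O> \<and> unimodular p q \<and> q \<noteq> 0 \<and> cmod q \<le> exp (t / 2)}"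
  unfolding farey_def primitive_pairs_iff zero_less_norm_iff conj_assoc by (rule refl)

lemma farey_point_in:
  assumes "v \<in> lattice_points (exp (t / 2))"
  shows "farey_point v \<in> farey K t"
proof -
  have N: "exp (t / 2) > 0" by simp
  note v = lattice_pointsD[OF assms N]
  obtain p where p: "inverse_rel v p" using inverse_rel_exists[OF v(4)] by blast
  then obtain a where a: "a \<in> \<O>" "p * emb (fst v) - emb (snd v) * a = 1" "p \<in> \<O>" unfolding inverse_rel_def by blast
  have "p * emb (fst v) + emb (snd v) * (- a) = 1" using a(2) by simp
  hence "unimodular p (emb (snd v))" unfolding unimodular_def using O_minus[OF a(1)] emb_in by blast
  thus ?thesis unfolding farey_point_eq[OF p v(1)] farey_eq using a(3) v(1,2) emb_in by blast
qed

text \<open>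
  Since \<open>p0\<close> and \<open>q0\<close> generate the unit ideal, the denominators of the point \<open>p0 / q0\<close> in lowest terms
  are the \<open>u * q0\<close> with \<open>u\<close> a unit. Once the denominator \<open>q\<close> is fixed, \<open>b\<close> is determined modulo \<open>q\<close>, and
  hence completely because \<open>b / q\<close> lies in the fundamental parallelogram.
\<close>
lemma card_fibre:
  assumes r: "r \<in> farey K t"
  shows "card {v\<in>lattice_points (exp (t / 2)). farey_point v = r} = card units"
proof -
  define N where "N = exp (t / 2)"
  have N: "N > 0" by (simp add: N_def)
  obtain p0 q0 where r0: "r = pr K (p0 / q0)" "p0 \<in> \<O>" "q0 \<in> \<O>" "unimodular p0 q0" "q0 \<noteq> 0" "cmod q0 \<le> N"
    using r unfolding farey_eq N_def by blast
  obtain x y where xy: "x \<in> \<O>" "y \<in> \<O>" "p0 * x + q0 * y = 1" using r0(4) unfolding unimodular_def by (elim bexE)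
  let ?F = "{v\<in>lattice_points N. farey_point v = r}"
  have "bij_betw (\<lambda>v. emb (snd v) / q0) ?F units"
    unfolding bij_betw_def
  proof (intro conjI inj_onI equalityI subsetI)
    fix v v' assume vv: "v \<in> ?F" "v' \<in> ?F" "emb (snd v) / q0 = emb (snd v') / q0"
    have v: "v \<in> lattice_points N" "v' \<in> lattice_points N" "farey_point v = farey_point v'" using vv by auto
    note l = lattice_pointsD[OF v(1) N] lattice_pointsD[OF v(2) N]
    have qq: "emb (snd v) = emb (snd v')" using vv(3) r0(5) by simp
    obtain p p' where p: "inverse_rel v p" "inverse_rel v' p'" using inverse_rel_exists l(4,8) by blast
    have "p / emb (snd v) - p' / emb (snd v) \<in> \<O>"
      using v(3) unfolding farey_point_eq[OF p(1) l(1)] farey_point_eq[OF p(2) l(5)] pr_eq_iff qq .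
    define q b b' where "q = emb (snd v)" and "b = emb (fst v)" and "b' = emb (fst v')"
    define e where "e = p / q - p' / q"
    have eO: "e \<in> \<O>" unfolding e_def q_def by fact
    have qe: "p - p' = q * e" using l(1) unfolding e_def q_def by (simp add: right_diff_distrib)
    obtain a a' where a: "a \<in> \<O>" "p * b - q * a = 1" "a' \<in> \<O>" "p' * b' - q * a' = 1"
      using p unfolding inverse_rel_def b_def b'_def q_def qq by blast
    have "b - b' = b * (p' * b' - q * a') - b' * (p * b - q * a)" unfolding a(2,4) by simp
    also have "\<dots> = q * (b' * a - b * a') - (p - p') * b * b'" by (simp add: algebra_simps)
    also have "\<dots> = q * (b' * a - b * a' - e * b * b')" unfolding qe by (simp add: algebra_simps)
    finally have "b / q - b' / q = b' * a - b * a' - e * b * b'"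
      using l(1) unfolding diff_divide_distrib[symmetric] q_def[symmetric] by simp
    also have "\<dots> \<in> \<O>" unfolding b_def b'_def by (intro O_diff O_mult a(1,3) eO emb_in)
    finally have "b / q - b' / q \<in> \<O>" .
    hence "b / q = b' / q"
      using unit_square_unique[of "b / q" "b' / q"] l(3,7) unfolding b_def b'_def q_def qq by blast
    hence "b = b'" using l(1) unfolding q_def by simp
    thus "v = v'" using qq inj_emb unfolding b_def b'_def by (intro prod_eqI) (auto dest: injD)
  next
    fix u assume "u \<in> (\<lambda>v. emb (snd v) / q0) ` ?F"
    then obtain v where v: "v \<in> lattice_points N" "farey_point v = r" "u = emb (snd v) / q0" by blast
    note l = lattice_pointsD[OF v(1) N]
    obtain p where p: "inverse_rel v p" using inverse_rel_exists l(4) by blast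
    define q b where "q = emb (snd v)" and "b = emb (fst v)"
    have q0: "q \<noteq> 0" using l(1) unfolding q_def .
    obtain a where a: "a \<in> \<O>" "p * b - q * a = 1" "p \<in> \<O>" using p unfolding inverse_rel_def b_def q_def by blast
    define c where "c = p / q - p0 / q0"
    have cO: "c \<in> \<O>" using v(2) unfolding r0(1) farey_point_eq[OF p l(1)] pr_eq_iff c_def q_def .
    define p1 where "p1 = p0 + c * q0"
    have p1: "p * q0 = p1 * q" using q0 r0(5) unfolding p1_def c_def by (simp add: field_simps)
    have p1x: "p1 * x + q0 * (y - c * x) = 1" using xy(3) unfolding p1_def by (simp add: algebra_simps)
    have "q = q * (p1 * x + q0 * (y - c * x))" unfolding p1x by simp
    also have "\<dots> = (p1 * q) * x + q * q0 * (y - c * x)" by (simp add: algebra_simps)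
    also have "\<dots> = q0 * (p * x + q * (y - c * x))" unfolding p1[symmetric] by (simp add: algebra_simps)
    finally have "q / q0 = p * x + q * (y - c * x)" using r0(5) by (simp add: field_simps)
    also have "\<dots> \<in> \<O>" unfolding q_def by (intro O_add O_mult O_diff a xy cO emb_in)
    finally have 1: "q / q0 \<in> \<O>" .
    have "q0 = q0 * (p * b - q * a)" unfolding a(2) by simp
    also have "\<dots> = (p * q0) * b - q0 * q * a" by (simp add: algebra_simps)
    also have "\<dots> = q * (p1 * b - q0 * a)" unfolding p1 by (simp add: algebra_simps)
    finally have "q0 / q = p1 * b - q0 * a" using q0 by (simp add: field_simps)
    also have "\<dots> \<in> \<O>" unfolding p1_def b_def by (intro O_add O_mult O_diff a r0 cO emb_in)
    finally have 2: "q0 / q \<in> \<O>" .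
    have "q / q0 * (q0 / q) = 1" using q0 r0(5) by simp
    thus "u \<in> units" using 1 2 unfolding units_def v(3) q_def[symmetric] by blast
  next
    fix u assume u: "u \<in> units"
    then obtain u' where u': "u \<in> \<O>" "u' \<in> \<O>" "u * u' = 1" unfolding units_def by blast
    have un: "u \<noteq> 0" using u' by auto
    define q p where "q = u * q0" and "p = u * p0"
    have q0: "q \<noteq> 0" using un r0(5) by (simp add: q_def)
    have qp: "q \<in> \<O>" "p \<in> \<O>" unfolding q_def p_def by (intro O_mult u' r0)+
    obtain e where e: "e \<in> \<O>" "psi_inv (u' * x / q - e) \<in> unit_square" using reduce_mod_O by blast
    define b where "b = u' * x - q * e"
    define a where "a = - (u' * y) - p * e"
    have bO: "b \<in> \<O>" unfolding b_def by (intro O_diff O_mult u' xy qp e)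
    have aO: "a \<in> \<O>" unfolding a_def by (intro O_diff O_minus O_mult u' xy qp e)
    have "p * b - q * a = (u * u') * (p0 * x + q0 * y)"
      unfolding a_def b_def p_def q_def by (simp add: algebra_simps)
    hence pb: "p * b - q * a = 1" by (simp only: xy u' mult_1_left)
    obtain vb vq where vbq: "b = emb vb" "q = emb vq" using bO qp unfolding \<O>_def by blast
    define v where "v = (vb, vq)"
    have inv: "inverse_rel v p" unfolding inverse_rel_def v_def fst_conv snd_conv vbq[symmetric]
      using qp aO pb by blast
    have "b / q = u' * x / q - e" using q0 by (simp add: b_def diff_divide_distrib)
    hence sq: "psi_inv (b / q) \<in> unit_square" using e(2) by (simp only:)
    have "b * p + q * (- a) = 1" using pb by (simp add: mult.commute)
    hence "unimodular b q" unfolding unimodular_def using qp O_minus[OF aO] by blast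
    moreover have "cmod q \<le> N" using norm_unit[OF u] r0(6) by (simp add: q_def norm_mult)
    ultimately have "v \<in> lattice_points N"
      using sq q0 N unfolding vbq by (intro lattice_pointsI) (simp_all add: v_def)
    moreover have "farey_point v = r"
    proof -
      have "emb (snd v) = q" by (simp add: v_def vbq)
      moreover have "p / q = p0 / q0" using un by (simp add: p_def q_def)
      ultimately show ?thesis using farey_point_eq[OF inv] q0 r0(1) by simp
    qed
    moreover have "u = emb (snd v) / q0" using r0(5) by (simp add: v_def vbq(2)[symmetric] q_def)
    ultimately show "u \<in> (\<lambda>v. emb (snd v) / q0) ` ?F" by blast
  qed
  thus ?thesis unfolding N_def by (rule bij_betw_same_card)
qed

lemma card_units_pos: "card units > 0"
proof -
  have one: "1 \<in> units" unfolding units_def using O_1 by (intro CollectI conjI bexI[of _ 1]) simp_all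
  have sub: "units \<subseteq> {z\<in>\<O>. cmod z \<le> 1}"
  proof
    fix u assume u: "u \<in> units"
    thus "u \<in> {z\<in>\<O>. cmod z \<le> 1}" using norm_unit[OF u] unfolding units_def by simp
  qed
  have "finite units" by (rule finite_subset[OF sub finite_O_ball])
  thus ?thesis using one by (auto simp: card_gt_0_iff)
qed

lemma farey_image: "farey K t = farey_point ` lattice_points (exp (t / 2))"
proof
  show "farey_point ` lattice_points (exp (t / 2)) \<subseteq> farey K t" using farey_point_in by blast
  show "farey K t \<subseteq> farey_point ` lattice_points (exp (t / 2))"
  proof
    fix r assume r: "r \<in> farey K t"
    have "card {v\<in>lattice_points (exp (t / 2)). farey_point v = r} > 0"
      using card_fibre[OF r] card_units_pos by simp
    hence "{v\<in>lattice_points (exp (t / 2)). farey_point v = r} \<noteq> {}" by (auto simp: card_gt_0_iff)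
    thus "r \<in> farey_point ` lattice_points (exp (t / 2))" by blast
  qed
qed

lemma finite_farey: "finite (farey K t)"
  unfolding farey_image by (intro finite_imageI finite_lattice_points) simp

lemma card_lattice_points_farey:
  "card {v\<in>lattice_points (exp (t / 2)). P (farey_point v)} = card units * card {r\<in>farey K t. P r}"
proof -
  let ?F = "\<lambda>r. {v\<in>lattice_points (exp (t / 2)). farey_point v = r}"
  have "{v\<in>lattice_points (exp (t / 2)). P (farey_point v)} = (\<Union>r\<in>{r\<in>farey K t. P r}. ?F r)"
    using farey_point_in by blast
  also have "card \<dots> = (\<Sum>r\<in>{r\<in>farey K t. P r}. card (?F r))"
  proof (rule card_UN_disjoint)
    show "finite {r\<in>farey K t. P r}" using finite_farey by simp
    show "\<forall>r\<in>{r\<in>farey K t. P r}. finite (?F r)"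
      by (intro ballI finite_subset[OF _ finite_lattice_points[of "exp (t / 2)"]]) auto
    show "\<forall>r\<in>{r\<in>farey K t. P r}. \<forall>r'\<in>{r\<in>farey K t. P r}. r \<noteq> r' \<longrightarrow> ?F r \<inter> ?F r' = {}" by blast
  qed
  also have "\<dots> = (\<Sum>r\<in>{r\<in>farey K t. P r}. card units)"
    by (intro sum.cong refl card_fibre) blast
  finally show ?thesis by simp
qed

text \<open>
  The matrix with rows \<open>(p, a)\<close> and \<open>(q, b)\<close> has determinant \<open>1\<close>, so \<open>P = p * q' - q * p'\<close> and
  \<open>Q = q' * a - p' * b\<close> define a bijection between unimodular pairs \<open>(p', q')\<close> and unimodular pairs
  \<open>(P, Q)\<close>, with inverse \<open>q' = P * b - Q * q\<close>, \<open>p' = P * a - Q * p\<close>. The two inequalities of \<open>covered\<close> become \<open>|q'| \<le> N\<close>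
  and \<open>N\<^sup>2 * |p / q - p' / q'| \<le> d\<close>. The hypothesis \<open>d < exp t\<close> rules out that \<open>p' / q'\<close> is a lattice translate of
  \<open>p / q\<close>, since those are at distance at least \<open>1\<close>.
\<close>
lemma exists_near_iff_covered:
  assumes v: "v \<in> lattice_points (exp (t / 2))" and d: "d < exp t"
  shows "(\<exists>r'\<in>farey K t - {farey_point v}. exp t * torus_dist (farey_point v) r' \<le> d) \<longleftrightarrow>
    covered d (emb (fst v) / of_real (exp (t / 2))) (emb (snd v) / of_real (exp (t / 2)))"
proof -
  define N where "N = exp (t / 2)"
  have N: "N > 0" by (simp add: N_def)
  have N2: "exp t = N * N" unfolding N_def exp_add[symmetric] by simp
  note l = lattice_pointsD[OF v[folded N_def] N]
  obtain p where p: "inverse_rel v p" using inverse_rel_exists l(4) by blast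
  define q b where "q = emb (snd v)" and "b = emb (fst v)"
  have q: "q \<noteq> 0" "q \<in> \<O>" "b \<in> \<O>" "cmod q \<le> N" using l(1,2) unfolding q_def b_def by simp_all
  obtain a where a: "a \<in> \<O>" "p * b - q * a = 1" "p \<in> \<O>" using p unfolding inverse_rel_def b_def q_def by blast
  have r: "farey_point v = pr K (p / q)" using farey_point_eq[OF p l(1)] unfolding q_def .
  have scaled: "covered d (b / of_real N) (q / of_real N) \<longleftrightarrow> (\<exists>P\<in>\<O>. \<exists>Q\<in>\<O>. unimodular P Q \<and> P \<noteq> 0 \<and>
     cmod (P * b - Q * q) \<le> N \<and> cmod P * (N * N) \<le> d * cmod q * cmod (P * b - Q * q))"
  proof -
    have eq: "P * (b / of_real N) - Q * (q / of_real N) = (P * b - Q * q) / of_real N" for P Q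
      by (simp add: diff_divide_distrib)
    have n: "cmod ((P * b - Q * q) / of_real N) = cmod (P * b - Q * q) / N" for P Q
      using N by (simp add: norm_divide)
    have n2: "cmod (q / of_real N) = cmod q / N" using N by (simp add: norm_divide)
    have i1: "x / N \<le> 1 \<longleftrightarrow> x \<le> N" for x using N by simp
    have i2: "x \<le> d * (y / N) * (z / N) \<longleftrightarrow> x * (N * N) \<le> d * y * z" for x y z
      using N by (simp add: field_simps)
    show ?thesis unfolding covered_def eq n n2 i1 i2 by (rule refl)
  qed
  have dist_eq: "p / q - p' / q' = (p * q' - q * p') / (q * q')" if "q' \<noteq> 0" for p' q'
    using q(1) that by (simp add: field_simps)
  have "(\<exists>r'\<in>farey K t - {pr K (p / q)}. exp t * torus_dist (pr K (p / q)) r' \<le> d) \<longleftrightarrow> covered d (b / of_real N) (q / of_real N)"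
    unfolding scaled
  proof
    assume "\<exists>r'\<in>farey K t - {pr K (p / q)}. exp t * torus_dist (pr K (p / q)) r' \<le> d"
    then obtain r' where r': "r' \<in> farey K t" "r' \<noteq> pr K (p / q)" "exp t * torus_dist (pr K (p / q)) r' \<le> d" by blast
    obtain p1 q' where pq': "r' = pr K (p1 / q')" "p1 \<in> \<O>" "q' \<in> \<O>" "unimodular p1 q'" "q' \<noteq> 0" "cmod q' \<le> N"
      using r'(1) unfolding farey_eq N_def by blast
    obtain c where c: "c \<in> \<O>" "torus_dist (pr K (p / q)) (pr K (p1 / q')) = cmod (p / q - p1 / q' - c)"
      using torus_dist_attained by blast
    define p' where "p' = p1 + c * q'"
    have p'q: "p1 / q' + c = p' / q'" using pq'(5) by (simp add: p'_def field_simps)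
    hence dist: "exp t * cmod (p / q - p' / q') \<le> d"
      using r'(3) unfolding pq'(1) c(2) by (simp add: algebra_simps p'q[symmetric])
    define P Q where "P = p * q' - q * p'" and "Q = q' * a - p' * b"
    have p'O: "p' \<in> \<O>" unfolding p'_def by (intro O_add O_mult c pq')
    have PO: "P \<in> \<O>" unfolding P_def by (intro O_diff O_mult a q pq' p'O)
    have QO: "Q \<in> \<O>" unfolding Q_def by (intro O_diff O_mult a q pq' p'O)
    have "P * b - Q * q = q' * (p * b - q * a)" unfolding P_def Q_def by (simp add: algebra_simps)
    hence e1: "P * b - Q * q = q'" by (simp only: a mult_1_right)
    have "P * a - Q * p = p' * (p * b - q * a)" unfolding P_def Q_def by (simp add: algebra_simps)
    hence e2: "P * a - Q * p = p'" by (simp only: a mult_1_right)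
    obtain \<alpha> \<beta> where ab: "\<alpha> \<in> \<O>" "\<beta> \<in> \<O>" "p1 * \<alpha> + q' * \<beta> = 1" using pq'(4) unfolding unimodular_def by (elim bexE)
    have "P * (a * \<alpha> + b * (\<beta> - c * \<alpha>)) + Q * (- (p * \<alpha>) - q * (\<beta> - c * \<alpha>)) = (P * a - Q * p) * \<alpha> + (P * b - Q * q) * (\<beta> - c * \<alpha>)"
      by (simp add: algebra_simps)
    also have "\<dots> = p1 * \<alpha> + q' * \<beta>" unfolding e1 e2 p'_def by (simp add: algebra_simps)
    finally have one: "P * (a * \<alpha> + b * (\<beta> - c * \<alpha>)) + Q * (- (p * \<alpha>) - q * (\<beta> - c * \<alpha>)) = 1" unfolding ab(3) .
    have "a * \<alpha> + b * (\<beta> - c * \<alpha>) \<in> \<O>" "- (p * \<alpha>) - q * (\<beta> - c * \<alpha>) \<in> \<O>"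
      by (intro O_add O_mult O_diff O_minus a ab c q)+
    hence uni: "unimodular P Q" unfolding unimodular_def using one by blast
    have P0: "P \<noteq> 0"
    proof
      assume "P = 0"
      hence "p / q - p' / q' = 0" using dist_eq[OF pq'(5)] unfolding P_def by simp
      hence "p1 / q' - p / q = - c" using p'q by (simp add: algebra_simps)
      hence "r' = pr K (p / q)" unfolding pq'(1) pr_eq_iff using O_minus[OF c(1)] by simp
      thus False using r'(2) by blast
    qed
    have "cmod (p / q - p' / q') = cmod P / (cmod q * cmod q')"
      unfolding dist_eq[OF pq'(5)] P_def by (simp add: norm_divide norm_mult)
    hence "cmod P = cmod (p / q - p' / q') * (cmod q * cmod q')" using q(1) pq'(5) by simp
    hence "cmod P * (N * N) = (exp t * cmod (p / q - p' / q')) * (cmod q * cmod q')"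
      unfolding N2 by (simp only: mult_ac)
    also have "\<dots> \<le> d * (cmod q * cmod q')" by (intro mult_right_mono dist) simp
    finally have "cmod P * (N * N) \<le> d * cmod q * cmod q'" by (simp only: mult.assoc)
    thus "\<exists>P\<in>\<O>. \<exists>Q\<in>\<O>. unimodular P Q \<and> P \<noteq> 0 \<and>
     cmod (P * b - Q * q) \<le> N \<and> cmod P * (N * N) \<le> d * cmod q * cmod (P * b - Q * q)"
      using uni P0 pq'(6) by (intro bexI[OF _ PO] bexI[OF _ QO]) (simp only: e1 not_False_eq_True simp_thms)
  next
    assume "\<exists>P\<in>\<O>. \<exists>Q\<in>\<O>. unimodular P Q \<and> P \<noteq> 0 \<and>
     cmod (P * b - Q * q) \<le> N \<and> cmod P * (N * N) \<le> d * cmod q * cmod (P * b - Q * q)"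
    then obtain P Q where PQ: "P \<in> \<O>" "Q \<in> \<O>" "unimodular P Q" "P \<noteq> 0" "cmod (P * b - Q * q) \<le> N"
      "cmod P * (N * N) \<le> d * cmod q * cmod (P * b - Q * q)" by blast
    define q' p' where "q' = P * b - Q * q" and "p' = P * a - Q * p"
    have qO: "q' \<in> \<O>" "p' \<in> \<O>" unfolding q'_def p'_def by (intro O_diff O_mult PQ q a)+
    have q'0: "q' \<noteq> 0"
    proof
      assume "q' = 0"
      hence "cmod P * (N * N) \<le> 0" using PQ(6) unfolding q'_def[symmetric] by simp
      moreover have "cmod P * (N * N) > 0" using PQ(4) N by simp
      ultimately show False by linarith
    qed
    have "p * q' - q * p' = P * (p * b - q * a)" unfolding q'_def p'_def by (simp add: algebra_simps)
    hence e1: "p * q' - q * p' = P" by (simp only: a mult_1_right)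
    have "q' * a - p' * b = Q * (p * b - q * a)" unfolding q'_def p'_def by (simp add: algebra_simps)
    hence e2: "q' * a - p' * b = Q" by (simp only: a mult_1_right)
    obtain \<alpha> \<beta> where ab: "\<alpha> \<in> \<O>" "\<beta> \<in> \<O>" "P * \<alpha> + Q * \<beta> = 1" using PQ(3) unfolding unimodular_def by (elim bexE)
    have "p' * (- (q * \<alpha>) - b * \<beta>) + q' * (p * \<alpha> + a * \<beta>) = (p * q' - q * p') * \<alpha> + (q' * a - p' * b) * \<beta>"
      by (simp add: algebra_simps)
    hence one: "p' * (- (q * \<alpha>) - b * \<beta>) + q' * (p * \<alpha> + a * \<beta>) = 1" unfolding e1 e2 ab(3) .
    have "- (q * \<alpha>) - b * \<beta> \<in> \<O>" "p * \<alpha> + a * \<beta> \<in> \<O>"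
      by (intro O_add O_mult O_diff O_minus a ab q)+
    hence "unimodular p' q'" unfolding unimodular_def using one by blast
    hence rF: "pr K (p' / q') \<in> farey K t"
      unfolding farey_eq using qO q'0 PQ(5) unfolding q'_def[symmetric] N_def by blast
    have diff: "p / q - p' / q' = P / (q * q')" unfolding dist_eq[OF q'0] e1 by (rule refl)
    hence "cmod (p / q - p' / q') = cmod P / (cmod q * cmod q')" by (simp only: norm_divide norm_mult)
    hence "exp t * cmod (p / q - p' / q') = cmod P * (N * N) / (cmod q * cmod q')"
      unfolding N2 by (simp only: times_divide_eq_right mult.commute)
    also have "\<dots> \<le> d"
      using PQ(6) q(1) q'0 unfolding q'_def[symmetric] by (subst pos_divide_le_eq) (simp_all add: mult.assoc)
    finally have dist: "exp t * cmod (p / q - p' / q') \<le> d" .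
    have "pr K (p' / q') \<noteq> pr K (p / q)"
    proof
      assume "pr K (p' / q') = pr K (p / q)"
      hence "p / q - p' / q' \<in> \<O>" using pr_eq_iff by metis
      moreover have "p / q - p' / q' \<noteq> 0" unfolding diff using PQ(4) q(1) q'0 by simp
      ultimately have "cmod (p / q - p' / q') \<ge> 1" by (rule O_norm_ge_1)
      hence "exp t * 1 \<le> exp t * cmod (p / q - p' / q')" by (intro mult_left_mono) auto
      thus False using dist d by linarith
    qed
    moreover have "exp t * torus_dist (pr K (p / q)) (pr K (p' / q')) \<le> d"
    proof -
      have "torus_dist (pr K (p / q)) (pr K (p' / q')) \<le> cmod (p / q - p' / q')"
        using torus_dist_le[OF O_0, of "p / q" "p' / q'"] by simp
      hence "exp t * torus_dist (pr K (p / q)) (pr K (p' / q')) \<le> exp t * cmod (p / q - p' / q')"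
        by (intro mult_left_mono) auto
      thus ?thesis using dist by linarith
    qed
    ultimately show "\<exists>r'\<in>farey K t - {pr K (p / q)}. exp t * torus_dist (pr K (p / q)) r' \<le> d" using rF by blast
  qed
  thus ?thesis unfolding r b_def q_def N_def .
qed

definition gap :: "real \<Rightarrow> complex set \<Rightarrow> real"
  where "gap t r = exp t * (INF r'\<in>farey K t - {r}. torus_dist r r')"

lemma gap_gt_iff:
  assumes card: "card (farey K t) \<ge> 2"
  shows "gap t r > d \<longleftrightarrow> \<not> (\<exists>r'\<in>farey K t - {r}. exp t * torus_dist r r' \<le> d)"
proof -
  let ?F = "farey K t - {r}"
  let ?D = "(\<lambda>r'. torus_dist r r') ` ?F"
  have "?F \<noteq> {}"
  proof
    assume "?F = {}"
    hence "farey K t \<subseteq> {r}" by blast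
    hence "card (farey K t) \<le> card {r}" by (intro card_mono) auto
    thus False using card by simp
  qed
  hence ne: "?D \<noteq> {}" "finite ?D" using finite_farey by auto
  have Inf: "Inf ?D = Min ?D" by (rule cInf_eq_Min[OF ne(2,1)])
  have "gap t r > d \<longleftrightarrow> Min ?D > d / exp t"
    unfolding gap_def Inf by (subst pos_divide_less_eq) (simp_all add: mult.commute)
  also have "\<dots> \<longleftrightarrow> (\<forall>x\<in>?D. d / exp t < x)" by (rule Min_gr_iff[OF ne(2,1)])
  also have "\<dots> \<longleftrightarrow> (\<forall>r'\<in>?F. d < exp t * torus_dist r r')"
    by (simp add: pos_divide_less_eq mult.commute)
  finally show ?thesis by (simp add: not_le)
qed

lemma gap_nonneg:
  assumes card: "card (farey K t) \<ge> 2"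
  shows "gap t r \<ge> 0"
proof -
  have "farey K t - {r} \<noteq> {}"
  proof
    assume "farey K t - {r} = {}"
    hence "farey K t \<subseteq> {r}" by blast
    hence "card (farey K t) \<le> card {r}" by (intro card_mono) auto
    thus False using card by simp
  qed
  hence "0 \<le> (INF r'\<in>farey K t - {r}. torus_dist r r')"
    by (intro cINF_greatest) (simp_all add: torus_dist_def setdist_pos_le)
  thus ?thesis unfolding gap_def by simp
qed

lemma lattice_points_region:
  assumes card: "card (farey K t) \<ge> 2" and d: "d < exp t"
  shows "card {v\<in>primitive4. scale4 (exp (t / 2)) v \<in> region d} = card units * card {r\<in>farey K t. gap t r > d}"
proof -
  have N: "exp (t / 2) > 0" by simp
  have "{v\<in>primitive4. scale4 (exp (t / 2)) v \<in> region d} = {v\<in>lattice_points (exp (t / 2)). gap t (farey_point v) > d}"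
  proof (intro set_eqI iffI)
    fix v assume "v \<in> {v\<in>primitive4. scale4 (exp (t / 2)) v \<in> region d}"
    hence v: "v \<in> primitive4" "scale4 (exp (t / 2)) v \<in> region d" by blast+
    hence l: "v \<in> lattice_points (exp (t / 2))"
      unfolding lattice_points_def mem_Collect_eq scale4_region[OF N] using not_covered_0 by blast
    have "\<not> covered d (emb (fst v) / of_real (exp (t / 2))) (emb (snd v) / of_real (exp (t / 2)))"
      using v(2) unfolding scale4_region[OF N] by blast
    thus "v \<in> {v\<in>lattice_points (exp (t / 2)). gap t (farey_point v) > d}"
      using l unfolding mem_Collect_eq gap_gt_iff[OF card] exists_near_iff_covered[OF l d] by blast
  next
    fix v assume "v \<in> {v\<in>lattice_points (exp (t / 2)). gap t (farey_point v) > d}"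
    hence l: "v \<in> lattice_points (exp (t / 2))" and g: "gap t (farey_point v) > d" by blast+
    have "\<not> covered d (emb (fst v) / of_real (exp (t / 2))) (emb (snd v) / of_real (exp (t / 2)))"
      using g unfolding gap_gt_iff[OF card] exists_near_iff_covered[OF l d] .
    thus "v \<in> {v\<in>primitive4. scale4 (exp (t / 2)) v \<in> region d}"
      using l unfolding lattice_points_def mem_Collect_eq scale4_region[OF N] by blast
  qed
  thus ?thesis using card_lattice_points_farey[of t "\<lambda>r. gap t r > d"] by simp
qed

lemma region_count_asymp:
  obtains c where "c > 0" "\<And>d. ((\<lambda>N. real (card {v\<in>primitive4. scale4 N v \<in> region d}) / N ^ 4) \<longlongrightarrow> c * measure lborel (region_interior d)) at_top"
proof -
  obtain c where c: "c > 0" "sift_density \<longlonglongrightarrow> c" by (rule sift_density_limit)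
  obtain A where A: "\<And>d. region d \<subseteq> box (- A) A" using region_bounded by blast
  have "region_interior 0 \<noteq> {}" using measure_region_interior_0_pos by auto
  hence "box (- A) A \<noteq> {}" using A[of 0] region_interior_subset_region[of 0] by blast
  hence b4: "box4 (- A) A" unfolding box4_def box_prod box_real by (auto simp: Times_eq_cancel2)
  have "((\<lambda>N. real (card {v\<in>primitive4. scale4 N v \<in> region d}) / N ^ 4) \<longlongrightarrow> c * measure lborel (region_interior d)) at_top" for d
  proof (rule primitive4_jordan[OF c(2,1) b4 open_region_interior open_region_exterior[OF open_box] region_interior_subset_region A region_exterior_disjoint_region])
    show "measure lborel (region_interior d) + measure lborel (region_exterior (box (- A) A) d) = measure lborel (box (- A) A)"
      by (rule measure_region_interior_region_exterior[OF refl]) (use A region_interior_subset_region in blast)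
  qed
  thus ?thesis using c(1) that by blast
qed

lemma filterlim_exp_half: "filterlim (\<lambda>t::real. exp (t / 2)) at_top at_top"
  by real_asymp

lemma card_farey_ge_2: "\<forall>\<^sub>F t in at_top. card (farey K t) \<ge> 2"
proof -
  obtain c where c: "c > 0" "\<And>d. ((\<lambda>N. real (card {v\<in>primitive4. scale4 N v \<in> region d}) / N ^ 4) \<longlongrightarrow> c * measure lborel (region_interior d)) at_top"
    using region_count_asymp by blast
  define m where "m = c * measure lborel (region_interior 0)"
  have m: "m > 0" using c(1) measure_region_interior_0_pos by (simp add: m_def)
  have lim: "((\<lambda>t. real (card (lattice_points (exp (t / 2)))) / exp (t / 2) ^ 4) \<longlongrightarrow> m) at_top"
    using filterlim_compose[OF c(2)[of 0] filterlim_exp_half] unfolding lattice_points_def m_def .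
  have "\<forall>\<^sub>F t in at_top. real (card (lattice_points (exp (t / 2)))) / exp (t / 2) ^ 4 > m / 2"
    by (rule order_tendstoD(1)[OF lim]) (use m in simp)
  moreover have "\<forall>\<^sub>F t in at_top. exp (t / 2) ^ 4 * (m / 2) > 2 * real (card units)"
  proof -
    have "filterlim (\<lambda>t::real. exp (t / 2) ^ 4 * (m / 2)) at_top at_top" using m by real_asymp
    thus ?thesis by (rule filterlim_at_top_dense[THEN iffD1, rule_format])
  qed
  ultimately show ?thesis
  proof eventually_elim
    case (elim t)
    have "exp (t / 2) ^ 4 * (m / 2) < real (card (lattice_points (exp (t / 2))))"
      using elim(1) by (simp add: pos_less_divide_eq mult.commute)
    also have "card (lattice_points (exp (t / 2))) = card units * card (farey K t)"
      using card_lattice_points_farey[of t "\<lambda>_. True"] by simp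
    finally have "2 * real (card units) < real (card units) * real (card (farey K t))" using elim(2) by simp
    hence "real (card units) * 2 < real (card units) * real (card (farey K t))" by simp
    hence "2 < real (card (farey K t))" by (rule mult_left_less_imp_less) simp
    thus ?case by simp
  qed
qed

text \<open>
  Both numbers of Farey points are, up to the number of units, counts of unimodular pairs in dilated
  regions, so their quotient tends to a quotient of volumes.
\<close>
lemma gap_fraction_limit:
  "((\<lambda>t. real (card {r\<in>farey K t. gap t r > d}) / real (card (farey K t))) \<longlongrightarrow> enn2real (gap_tail d)) at_top"
proof -
  obtain c where c: "c > 0" "\<And>d. ((\<lambda>N. real (card {v\<in>primitive4. scale4 N v \<in> region d}) / N ^ 4) \<longlongrightarrow> c * measure lborel (region_interior d)) at_top"
    using region_count_asymp by blast
  have "((\<lambda>N. (real (card {v\<in>primitive4. scale4 N v \<in> region d}) / N ^ 4) / (real (card {v\<in>primitive4. scale4 N v \<in> region 0}) / N ^ 4))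
     \<longlongrightarrow> (c * measure lborel (region_interior d)) / (c * measure lborel (region_interior 0))) at_top"
    by (intro tendsto_divide c(2)) (use c(1) measure_region_interior_0_pos in simp)
  also have "(c * measure lborel (region_interior d)) / (c * measure lborel (region_interior 0)) = enn2real (gap_tail d)"
    using c(1) gap_tail_real[of d] by simp
  finally have "((\<lambda>t. (real (card {v\<in>primitive4. scale4 (exp (t / 2)) v \<in> region d}) / exp (t / 2) ^ 4) /
      (real (card {v\<in>primitive4. scale4 (exp (t / 2)) v \<in> region 0}) / exp (t / 2) ^ 4)) \<longlongrightarrow> enn2real (gap_tail d)) at_top"
    by (rule filterlim_compose[OF _ filterlim_exp_half])
  moreover have "\<forall>\<^sub>F t in at_top. exp t > d"
    using filterlim_at_top_dense[of "exp :: real \<Rightarrow> real" at_top] exp_at_top by blast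
  hence "\<forall>\<^sub>F t in at_top. (real (card {v\<in>primitive4. scale4 (exp (t / 2)) v \<in> region d}) / exp (t / 2) ^ 4) /
      (real (card {v\<in>primitive4. scale4 (exp (t / 2)) v \<in> region 0}) / exp (t / 2) ^ 4) =
      real (card {r\<in>farey K t. gap t r > d}) / real (card (farey K t))"
    using card_farey_ge_2
  proof eventually_elim
    case (elim t)
    have F: "card {v\<in>primitive4. scale4 (exp (t / 2)) v \<in> region 0} = card units * card (farey K t)"
      using card_lattice_points_farey[of t "\<lambda>_. True"] unfolding lattice_points_def by simp
    show ?case unfolding lattice_points_region[OF elim(2,1)] F using card_units_pos by simp
  qed
  ultimately show ?thesis by (rule Lim_transform_eventually)
qed

lemma gap_measure_integral:
  fixes g :: "real \<Rightarrow> real"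
  assumes card: "card (farey K t) \<ge> 2" and g: "continuous_on {0..} g"
  shows "integral\<^sup>L (gap_measure K t) g = (\<Sum>r\<in>farey K t. g (gap t r)) / real (card (farey K t))"
proof -
  have m: "gap t \<in> measurable (uniform_count_measure (farey K t)) (restrict_space borel {0..})"
    by (rule measurableI) (simp_all add: space_restrict_space gap_nonneg[OF card])
  have gm: "g \<in> borel_measurable (restrict_space borel {0..})"
    by (rule borel_measurable_continuous_on_restrict[OF g])
  have "gap_measure K t = distr (uniform_count_measure (farey K t)) (restrict_space borel {0..}) (gap t)"
    unfolding gap_measure_def gap_def by (rule refl)
  hence "integral\<^sup>L (gap_measure K t) g = integral\<^sup>L (uniform_count_measure (farey K t)) (\<lambda>r. g (gap t r))"
    by (simp only: integral_distr[OF m gm])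
  also have "\<dots> = (\<Sum>r\<in>farey K t. g (gap t r)) / real (card (farey K t))"
    by (rule integral_uniform_count_measure[OF finite_farey])
  finally show ?thesis .
qed

text \<open>
  Indicators of half-lines are squeezed between the piecewise linear functions \<open>h\<close>. This compares
  \<open>\<mu>(]d, \<infinity>[)\<close> with the limiting fractions at levels just above and just below \<open>d\<close>, and the limiting
  fraction is continuous in the level.
\<close>
lemma limit_gap_measure_tail:
  assumes mu: "is_limit_gap_measure K \<mu>" and d: "d > 0"
  shows "measure \<mu> {d<..} = enn2real (gap_tail d)"
proof -
  interpret prob_space \<mu> using mu unfolding is_limit_gap_measure_def by blast
  have sets: "sets \<mu> = sets (restrict_space borel {0..})" using mu unfolding is_limit_gap_measure_def by blast
  have space: "space \<mu> = {0..}" using sets_eq_imp_space_eq[OF sets] by (simp add: space_restrict_space)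
  have tail_sets: "{x<..} \<in> sets \<mu>" if "x \<ge> 0" for x
    unfolding sets using that by (subst sets_restrict_space_iff) auto
  \<comment> \<open>\<open>h a b\<close> rises linearly from \<open>0\<close> at \<open>a\<close> to \<open>1\<close> at \<open>b\<close>.\<close>
  define h where "h = (\<lambda>a b x::real. min 1 (max 0 ((x - a) / (b - a))))"
  have h_cont: "continuous_on S (h a b)" for a b S
    unfolding h_def by (cases "a = b") (auto intro!: continuous_intros)
  have h01: "0 \<le> h a b x" "h a b x \<le> 1" for a b x by (auto simp: h_def)
  have h0: "h a b x = 0" if "a < b" "x \<le> a" for a b x
    using that by (simp add: h_def divide_nonpos_pos)
  have h1: "h a b x = 1" if "a < b" "b \<le> x" for a b x
    using that by (simp add: h_def min_def max_def pos_le_divide_eq)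
  have h_abs: "\<bar>h a b x\<bar> \<le> 1" for a b x using h01[of a b x] by linarith
  have h_bdd: "bounded (h a b ` {0..})" for a b
    unfolding bounded_iff by (rule exI[of _ 1]) (simp add: h_abs)
  have conv: "((\<lambda>t. integral\<^sup>L (gap_measure K t) (h a b)) \<longlongrightarrow> integral\<^sup>L \<mu> (h a b)) at_top" for a b
    using mu h_cont h_bdd unfolding is_limit_gap_measure_def by blast
  have h_meas: "h a b \<in> borel_measurable \<mu>" for a b
    using borel_measurable_continuous_on_restrict[OF h_cont[of "{0..}" a b]]
    unfolding measurable_cong_sets[OF sets refl] .
  have h_int: "integrable \<mu> (h a b)" for a b
    by (rule integrable_const_bound[of _ 1]) (use h01 h_meas in auto)
  have lower_avg: "\<forall>\<^sub>F t in at_top. real (card {r\<in>farey K t. gap t r > b}) / real (card (farey K t)) \<le> integral\<^sup>L (gap_measure K t) (h a b)"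
    if "a < b" for a b
    using card_farey_ge_2
  proof eventually_elim
    case (elim t)
    have "real (card {r\<in>farey K t. gap t r > b}) = (\<Sum>r\<in>{r\<in>farey K t. gap t r > b}. 1)" by simp
    also have "\<dots> = (\<Sum>r\<in>{r\<in>farey K t. gap t r > b}. h a b (gap t r))"
      by (rule sum.cong) (use h1[OF that] in auto)
    also have "\<dots> \<le> (\<Sum>r\<in>farey K t. h a b (gap t r))"
      by (rule sum_mono2) (use finite_farey h01 in auto)
    finally show ?case
      unfolding gap_measure_integral[OF elim h_cont] by (intro divide_right_mono) auto
  qed
  have upper_avg: "\<forall>\<^sub>F t in at_top. integral\<^sup>L (gap_measure K t) (h a b) \<le> real (card {r\<in>farey K t. gap t r > a}) / real (card (farey K t))"
    if "a < b" for a b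
    using card_farey_ge_2
  proof eventually_elim
    case (elim t)
    have "(\<Sum>r\<in>farey K t. h a b (gap t r)) = (\<Sum>r\<in>{r\<in>farey K t. gap t r > a}. h a b (gap t r))"
    proof (rule sum.mono_neutral_right)
      show "\<forall>r\<in>farey K t - {r\<in>farey K t. gap t r > a}. h a b (gap t r) = 0"
        using h0[OF that] by (simp add: not_less)
    qed (use finite_farey in auto)
    also have "\<dots> \<le> (\<Sum>r\<in>{r\<in>farey K t. gap t r > a}. 1)" by (intro sum_mono h01)
    finally have "(\<Sum>r\<in>farey K t. h a b (gap t r)) \<le> real (card {r\<in>farey K t. gap t r > a})" by simp
    thus ?case
      unfolding gap_measure_integral[OF elim h_cont] by (intro divide_right_mono) auto
  qed
  have lower: "enn2real (gap_tail b) \<le> measure \<mu> {d<..}" if "d < b" for b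
  proof -
    have "enn2real (gap_tail b) \<le> integral\<^sup>L \<mu> (h d b)"
      by (rule tendsto_le[OF _ conv gap_fraction_limit lower_avg[OF that]]) simp
    also have "\<dots> \<le> integral\<^sup>L \<mu> (indicat_real {d<..})"
    proof (rule integral_mono[OF h_int])
      show "integrable \<mu> (indicat_real {d<..})"
        by (rule integrable_const_bound[of _ 1]) (use tail_sets d in auto)
      show "h d b x \<le> indicat_real {d<..} x" for x
        using h0[OF that, of x] h01[of d b x] by (cases "x \<le> d") (auto simp: indicator_def)
    qed
    also have "\<dots> = measure \<mu> {d<..}" using tail_sets[of d] d by simp
    finally show ?thesis .
  qed
  have upper: "measure \<mu> {d<..} \<le> enn2real (gap_tail a)" if "a < d" for a
  proof -
    have "measure \<mu> {d<..} = integral\<^sup>L \<mu> (indicat_real {d<..})" using tail_sets[of d] d by simp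
    also have "\<dots> \<le> integral\<^sup>L \<mu> (h a d)"
    proof (rule integral_mono[OF _ h_int])
      show "integrable \<mu> (indicat_real {d<..})"
        by (rule integrable_const_bound[of _ 1]) (use tail_sets d in auto)
      show "indicat_real {d<..} x \<le> h a d x" for x
        using h1[OF that, of x] h01[of a d x] by (auto simp: indicator_def)
    qed
    also have "\<dots> \<le> enn2real (gap_tail a)"
      by (rule tendsto_le[OF _ gap_fraction_limit conv upper_avg[OF that]]) simp
    finally show ?thesis .
  qed
  have lim1: "(\<lambda>n. enn2real (gap_tail (d + 1 / real (Suc n)))) \<longlonglongrightarrow> enn2real (gap_tail d)"
    unfolding gap_tail_real[symmetric]
    by (intro tendsto_divide measure_region_interior_right tendsto_const) (use measure_region_interior_0_pos in simp)
  have lim2: "(\<lambda>n. enn2real (gap_tail (d - 1 / real (Suc n)))) \<longlonglongrightarrow> enn2real (gap_tail d)"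
    unfolding gap_tail_real[symmetric]
    by (intro tendsto_divide measure_region_interior_left tendsto_const) (use measure_region_interior_0_pos in simp)
  have "enn2real (gap_tail d) \<le> measure \<mu> {d<..}"
    by (rule LIMSEQ_le_const2[OF lim1]) (use lower in auto)
  moreover have "measure \<mu> {d<..} \<le> enn2real (gap_tail d)"
    by (rule LIMSEQ_le_const[OF lim2]) (use upper in auto)
  ultimately show ?thesis by simp
qed

end

section \<open>Haar measure on the torus\<close>

lemma emeasure_lborel_translate:
  fixes S :: "'a::euclidean_space set"
  assumes "S \<in> sets borel"
  shows "emeasure lborel {x. x + c \<in> S} = emeasure lborel S"
proof -
  have "emeasure lborel S = emeasure (distr lborel borel ((+) c)) S"
    by (simp only: lborel_distr_plus)
  also have "\<dots> = emeasure lborel ((+) c -` S \<inter> space lborel)"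
    by (rule emeasure_distr) (use assms in simp_all)
  also have "(+) c -` S \<inter> space lborel = {x. x + c \<in> S}" by (auto simp: add.commute)
  finally show ?thesis by simp
qed

definition int_vec :: "int \<times> int \<Rightarrow> real \<times> real"
  where "int_vec k = (of_int (fst k), of_int (snd k))"

lemma unit_square_translate: "\<exists>k. x + int_vec k \<in> unit_square"
  by (rule exI[of _ "(- \<lfloor>fst x\<rfloor>, - \<lfloor>snd x\<rfloor>)"]) (simp add: int_vec_def, linarith)

lemma unit_square_translate_unique:
  assumes "x + int_vec k \<in> unit_square" "x + int_vec l \<in> unit_square"
  shows "k = l"
proof -
  have "\<bar>real_of_int (fst k) - real_of_int (fst l)\<bar> < 1" "\<bar>real_of_int (snd k) - real_of_int (snd l)\<bar> < 1"
    using assms unfolding int_vec_def by simp_all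
  hence "fst k = fst l" "snd k = snd l" by linarith+
  thus ?thesis by (intro prod_eqI)
qed

lemma unit_square_measurable [measurable]: "unit_square \<in> sets borel"
proof -
  have "unit_square = {0..<1} \<times> {0..<1}" by auto
  also have "\<dots> \<in> sets (borel \<Otimes>\<^sub>M borel)" by (intro pair_measureI) simp_all
  finally show ?thesis by (simp only: borel_prod)
qed

text \<open>
  Both sets are cut into the pieces that a single integer translation carries into each other; the
  translated unit squares tile the plane.
\<close>
lemma emeasure_unit_square_periodic:
  assumes P: "P \<in> sets borel" and per: "\<And>x k. x + int_vec k \<in> P \<longleftrightarrow> x \<in> P"
  shows "emeasure lborel {x\<in>unit_square. x + c \<in> P} = emeasure lborel {x\<in>unit_square. x \<in> P}"
proof -
  have tr: "{x. x + a \<in> S} \<in> sets borel" if "S \<in> sets borel" for S and a :: "real \<times> real"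
    using that by measurable
  define B where "B = P \<inter> {y. y + (- c) \<in> unit_square}"
  have Bm: "B \<in> sets borel" unfolding B_def by (intro sets.Int P tr unit_square_measurable)
  define X where "X = (\<lambda>k. B \<inter> {y. y + (- int_vec k) \<in> unit_square})"
  define Y where "Y = (\<lambda>k. {x\<in>unit_square. x \<in> P} \<inter> {x. x + (int_vec k - c) \<in> unit_square})"
  have Xm: "X k \<in> sets borel" for k unfolding X_def by (intro sets.Int Bm tr unit_square_measurable)
  have Pm: "{x\<in>unit_square. x \<in> P} \<in> sets borel"
  proof -
    have "{x\<in>unit_square. x \<in> P} = unit_square \<inter> P" by blast
    thus ?thesis using sets.Int[OF unit_square_measurable P] by simp
  qed
  have Ym: "Y k \<in> sets borel" for k unfolding Y_def by (intro sets.Int Pm tr unit_square_measurable)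
  have XY: "emeasure lborel (X k) = emeasure lborel (Y k)" for k
  proof -
    have "emeasure lborel (X k) = emeasure lborel {x. x + int_vec k \<in> X k}"
      by (rule emeasure_lborel_translate[OF Xm, symmetric])
    also have "{x. x + int_vec k \<in> X k} = Y k"
      unfolding X_def Y_def B_def using per by (auto simp: algebra_simps)
    finally show ?thesis .
  qed
  have "{x\<in>unit_square. x + c \<in> P} = {x. x + c \<in> B}" unfolding B_def by auto
  hence "emeasure lborel {x\<in>unit_square. x + c \<in> P} = emeasure lborel B"
    using emeasure_lborel_translate[OF Bm] by simp
  also have "B = (\<Union>k\<in>UNIV. X k)"
  proof (intro set_eqI iffI)
    fix y assume y: "y \<in> B"
    obtain k where "y + int_vec k \<in> unit_square" using unit_square_translate by blast
    moreover have "int_vec k = - int_vec (- fst k, - snd k)" by (simp add: int_vec_def)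
    ultimately have "y + (- int_vec (- fst k, - snd k)) \<in> unit_square" by simp
    hence "y \<in> X (- fst k, - snd k)" using y unfolding X_def by blast
    thus "y \<in> (\<Union>k\<in>UNIV. X k)" by blast
  qed (auto simp: X_def)
  also have "emeasure lborel \<dots> = (\<integral>\<^sup>+k. emeasure lborel (X k) \<partial>count_space UNIV)"
  proof (rule emeasure_UN_countable)
    show "disjoint_family_on X UNIV"
    proof (unfold disjoint_family_on_def, intro ballI impI)
      fix k l :: "int \<times> int" assume kl: "k \<noteq> l"
      have neg: "- int_vec k = int_vec (- fst k, - snd k)" for k by (simp add: int_vec_def)
      show "X k \<inter> X l = {}"
      proof (rule ccontr)
        assume "X k \<inter> X l \<noteq> {}"
        then obtain y where "y + (- int_vec k) \<in> unit_square" "y + (- int_vec l) \<in> unit_square" unfolding X_def by blast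
        hence "(- fst k, - snd k) = (- fst l, - snd l)" unfolding neg by (rule unit_square_translate_unique)
        thus False using kl by (simp add: prod_eq_iff)
      qed
    qed
  qed (use Xm in simp_all)
  also have "\<dots> = (\<integral>\<^sup>+k. emeasure lborel (Y k) \<partial>count_space UNIV)" unfolding XY by (rule refl)
  also have "\<dots> = emeasure lborel (\<Union>k\<in>UNIV. Y k)"
  proof (rule emeasure_UN_countable[symmetric])
    show "disjoint_family_on Y UNIV"
    proof (unfold disjoint_family_on_def, intro ballI impI)
      fix k l :: "int \<times> int" assume kl: "k \<noteq> l"
      show "Y k \<inter> Y l = {}"
      proof (rule ccontr)
        assume "Y k \<inter> Y l \<noteq> {}"
        then obtain y where "(y - c) + int_vec k \<in> unit_square" "(y - c) + int_vec l \<in> unit_square"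
          unfolding Y_def by (auto simp: algebra_simps)
        hence "k = l" by (rule unit_square_translate_unique)
        thus False using kl by blast
      qed
    qed
  qed (use Ym in simp_all)
  also have "(\<Union>k\<in>UNIV. Y k) = {x\<in>unit_square. x \<in> P}"
  proof (intro set_eqI iffI)
    fix y assume y: "y \<in> {x\<in>unit_square. x \<in> P}"
    obtain k where "(y - c) + int_vec k \<in> unit_square" using unit_square_translate by blast
    moreover have "(y - c) + int_vec k = y + (int_vec k - c)" by (simp only: diff_conv_add_uminus add_ac)
    ultimately have "y \<in> Y k" using y unfolding Y_def by simp
    thus "y \<in> (\<Union>k\<in>UNIV. Y k)" by blast
  qed (auto simp: Y_def)
  finally show ?thesis .
qed

context quadratic_integers
begin

lemma emb_int_vec: "psi (int_vec k) = emb k"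
  unfolding int_vec_def by (rule psi_emb)

lemma pr_in_torus: "pr K z \<in> torus K" unfolding torus_def by blast

lemma space_torus_borel: "space (torus_borel K) = torus K"
  unfolding torus_borel_def by (rule space_measure_of) blast

lemma open_in_torus_borel:
  assumes "U \<subseteq> torus K" "open (pr K -` U)"
  shows "U \<in> sets (torus_borel K)"
  unfolding torus_borel_def by (rule in_measure_of) (use assms in blast)+

lemma closed_in_torus_borel:
  assumes "G \<subseteq> torus K" "closed (pr K -` G)"
  shows "G \<in> sets (torus_borel K)"
proof -
  have "pr K -` (torus K - G) = - (pr K -` G)" using pr_in_torus by blast
  hence "torus K - G \<in> sets (torus_borel K)"
    using assms(2) by (intro open_in_torus_borel) (auto simp: open_Compl)
  hence "space (torus_borel K) - (torus K - G) \<in> sets (torus_borel K)" by (rule sets.compl_sets)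
  moreover have "space (torus_borel K) - (torus K - G) = G" using assms(1) unfolding space_torus_borel by blast
  ultimately show ?thesis by simp
qed

lemma pr_measurable [measurable]: "pr K \<in> measurable borel (torus_borel K)"
  unfolding torus_borel_def
proof (rule measurable_measure_of)
  show "pr K \<in> space borel \<rightarrow> torus K" using pr_in_torus by blast
  fix U assume "U \<in> {U. U \<subseteq> torus K \<and> open (pr K -` U)}"
  thus "pr K -` U \<inter> space borel \<in> sets borel" by (simp add: borel_open)
qed blast

lemma closed_O: "closed \<O>"
proof (rule discrete_imp_closed[of 1])
  show "\<forall>x\<in>\<O>. \<forall>y\<in>\<O>. dist y x < 1 \<longrightarrow> y = x"
  proof (intro ballI impI)
    fix x y assume xy: "x \<in> \<O>" "y \<in> \<O>" "dist y x < 1"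
    show "y = x"
    proof (rule ccontr)
      assume "y \<noteq> x"
      hence "cmod (y - x) \<ge> 1" using O_norm_ge_1[OF O_diff[OF xy(2,1)]] by simp
      thus False using xy(3) by (simp add: dist_norm)
    qed
  qed
qed simp

lemma compact_pr_image: assumes "compact C" shows "pr K ` C \<in> sets (torus_borel K)"
proof (rule closed_in_torus_borel)
  show "pr K ` C \<subseteq> torus K" using pr_in_torus by blast
  have "pr K -` (pr K ` C) = (\<Union>x\<in>\<O>. \<Union>y\<in>C. {x + y})"
  proof (intro set_eqI iffI)
    fix z assume "z \<in> pr K -` (pr K ` C)"
    then obtain w where w: "w \<in> C" "pr K z = pr K w" by blast
    hence "z - w \<in> \<O>" by (simp only: pr_eq_iff)
    moreover have "z = (z - w) + w" by simp
    ultimately show "z \<in> (\<Union>x\<in>\<O>. \<Union>y\<in>C. {x + y})" using w(1) by blast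
  next
    fix z assume "z \<in> (\<Union>x\<in>\<O>. \<Union>y\<in>C. {x + y})"
    then obtain x y where "x \<in> \<O>" "y \<in> C" "z = x + y" by blast
    moreover from this have "pr K z = pr K y" unfolding pr_eq_iff by simp
    ultimately show "z \<in> pr K -` (pr K ` C)" by blast
  qed
  thus "closed (pr K -` (pr K ` C))" using closed_compact_sums[OF closed_O assms] by simp
qed

text \<open>
  A measurable section of the projection. It allows the group action on the torus to be expressed by
  measurable functions on the plane.
\<close>
definition rep :: "complex set \<Rightarrow> real \<times> real"
  where "rep y = (THE x. x \<in> unit_square \<and> pr K (psi x) = y)"

lemma rep:
  assumes "y \<in> torus K" shows "rep y \<in> unit_square" "pr K (psi (rep y)) = y"
proof -
  obtain z where z: "y = pr K z" using assms unfolding torus_def by blast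
  obtain e where e: "e \<in> \<O>" "psi_inv (z - e) \<in> unit_square" using reduce_mod_O by blast
  have "\<exists>!x. x \<in> unit_square \<and> pr K (psi x) = y"
  proof (rule ex1I[of _ "psi_inv (z - e)"])
    show "psi_inv (z - e) \<in> unit_square \<and> pr K (psi (psi_inv (z - e))) = y"
      using e O_minus[OF e(1)] unfolding z psi_psi_inv pr_eq_iff by simp
    fix x assume x: "x \<in> unit_square \<and> pr K (psi x) = y"
    hence "psi x - z \<in> \<O>" unfolding z pr_eq_iff by blast
    hence "(psi x - z) + e \<in> \<O>" by (intro O_add e(1))
    hence "psi x - (z - e) \<in> \<O>" by (simp only: diff_diff_eq2 diff_add_eq)
    hence "psi x = z - e" using x e(2) by (intro unit_square_unique) simp_all
    thus "x = psi_inv (z - e)" using psi_inv_psi[of x] by simp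
  qed
  from theI'[OF this] show "rep y \<in> unit_square" "pr K (psi (rep y)) = y" unfolding rep_def by blast+
qed

lemma rep_pr: "x \<in> unit_square \<Longrightarrow> rep (pr K (psi x)) = x"
proof -
  assume x: "x \<in> unit_square"
  have "psi (rep (pr K (psi x))) - psi x \<in> \<O>" using rep(2)[OF pr_in_torus] unfolding pr_eq_iff[symmetric] .
  hence "psi (rep (pr K (psi x))) = psi x" using x rep(1)[OF pr_in_torus] by (intro unit_square_unique) simp_all
  thus ?thesis using psi_inv_psi by metis
qed

text \<open>
  The half-open square is a countable union of compact squares, so the cosets with representative in
  a closed set form a countable union of projections of compact sets, and these are closed.
\<close>
lemma rep_measurable [measurable]: "rep \<in> measurable (torus_borel K) borel"
proof (rule borel_measurableI)
  fix S :: "(real \<times> real) set" assume S: "open S"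
  define E where "E = (\<lambda>n::nat. cbox (0 :: real \<times> real) (1 - 1 / real (Suc n), 1 - 1 / real (Suc n)))"
  have closed_part: "{y\<in>torus K. rep y \<in> C} \<in> sets (torus_borel K)" if C: "closed C" for C
  proof -
    have "{y\<in>torus K. rep y \<in> C} = (\<Union>n. pr K ` psi ` (C \<inter> E n))"
    proof (intro set_eqI iffI)
      fix y assume y: "y \<in> {y\<in>torus K. rep y \<in> C}"
      define x where "x = rep y"
      have x: "x \<in> unit_square" "pr K (psi x) = y" "x \<in> C" using rep y unfolding x_def by blast+
      have "min (1 - fst x) (1 - snd x) > 0" using x(1) by simp
      then obtain n where n: "1 / real (Suc n) < min (1 - fst x) (1 - snd x)" using nat_approx_posE by blast
      have "x \<in> E n" using x(1) n unfolding E_def cbox_prod by (auto simp: mem_Times_iff zero_prod_def)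
      hence "y \<in> pr K ` psi ` (C \<inter> E n)" using x by blast
      thus "y \<in> (\<Union>n. pr K ` psi ` (C \<inter> E n))" by blast
    next
      fix y assume "y \<in> (\<Union>n. pr K ` psi ` (C \<inter> E n))"
      then obtain n x where x: "x \<in> C" "x \<in> E n" "y = pr K (psi x)" by blast
      have b: "0 \<le> fst x" "fst x \<le> 1 - 1 / real (Suc n)" "0 \<le> snd x" "snd x \<le> 1 - 1 / real (Suc n)"
        using x(2) unfolding E_def cbox_prod mem_Times_iff zero_prod_def fst_conv snd_conv cbox_interval atLeastAtMost_iff by blast+
      have "1 / real (Suc n) > 0" by simp
      hence "x \<in> unit_square" using b unfolding mem_Collect_eq by linarith
      hence "rep y = x" unfolding x(3) by (rule rep_pr)
      thus "y \<in> {y\<in>torus K. rep y \<in> C}" using x(1) pr_in_torus[of "psi x"] unfolding mem_Collect_eq by (simp add: x(3))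
    qed
    also have "\<dots> \<in> sets (torus_borel K)"
    proof (intro sets.countable_UN'')
      fix n
      have "compact (C \<inter> E n)" unfolding E_def by (intro closed_Int_compact C compact_cbox)
      hence "compact (psi ` (C \<inter> E n))" by (intro compact_continuous_image continuous_psi continuous_on_id)
      thus "pr K ` psi ` (C \<inter> E n) \<in> sets (torus_borel K)" by (rule compact_pr_image)
    qed simp
    finally show ?thesis .
  qed
  have "rep -` S \<inter> space (torus_borel K) = space (torus_borel K) - {y\<in>torus K. rep y \<in> - S}"
    unfolding space_torus_borel by blast
  also have "\<dots> \<in> sets (torus_borel K)"
    by (intro sets.compl_sets closed_part) (use S in \<open>simp add: closed_Compl\<close>)
  finally show "rep -` S \<inter> space (torus_borel K) \<in> sets (torus_borel K)" .
qed

definition shift :: "complex \<Rightarrow> complex set \<Rightarrow> complex set"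
  where "shift z x = (+) z ` x"

lemma shift_pr: "shift z (pr K w) = pr K (z + w)"
  unfolding shift_def pr_def ring_of_integers_eq by (auto simp: add.assoc)

lemma shift_image:
  assumes "A \<subseteq> torus K"
  shows "shift z ` A = {y\<in>torus K. shift (- z) y \<in> A}"
proof (intro set_eqI iffI)
  fix y assume "y \<in> shift z ` A"
  then obtain x where x: "x \<in> A" "y = shift z x" by blast
  then obtain w where w: "x = pr K w" using assms unfolding torus_def by blast
  show "y \<in> {y\<in>torus K. shift (- z) y \<in> A}"
    using x(1) unfolding x(2) w shift_pr mem_Collect_eq by (simp add: pr_in_torus)
next
  fix y assume y: "y \<in> {y\<in>torus K. shift (- z) y \<in> A}"
  then obtain w where w: "y = pr K w" unfolding torus_def by blast
  have "y = shift z (shift (- z) y)" unfolding w shift_pr by simp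
  thus "y \<in> shift z ` A" using y by blast
qed

definition square_measure :: "complex set set \<Rightarrow> ennreal"
  where "square_measure A = emeasure lborel {x\<in>unit_square. pr K (psi x) \<in> A}"

lemma pr_psi_measurable: "A \<in> sets (torus_borel K) \<Longrightarrow> {x. pr K (psi x) \<in> A} \<in> sets borel"
proof -
  assume A: "A \<in> sets (torus_borel K)"
  have "(\<lambda>x. pr K (psi x)) \<in> measurable borel (torus_borel K)" by measurable
  from measurable_sets[OF this A] show ?thesis by (simp add: vimage_def)
qed

lemma square_measure_shift:
  assumes A: "A \<in> sets (torus_borel K)"
  shows "emeasure lborel {x\<in>unit_square. pr K (psi (x + c)) \<in> A} = square_measure A"
proof -
  let ?P = "{x. pr K (psi x) \<in> A}"
  have per: "x + int_vec k \<in> ?P \<longleftrightarrow> x \<in> ?P" for x k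
  proof -
    have "pr K (psi (x + int_vec k)) = pr K (psi x)" unfolding pr_eq_iff psi_add emb_int_vec by simp
    thus ?thesis by simp
  qed
  from emeasure_unit_square_periodic[OF pr_psi_measurable[OF A] per, of c]
  show ?thesis unfolding square_measure_def by simp
qed

lemma emeasure_unit_square: "emeasure lborel unit_square = 1"
proof -
  have sub: "unit_square - open_square \<subseteq> closed_square - open_square" by auto
  have m: "open_square \<in> sets borel" by (rule borel_open[OF open_open_square])
  have "unit_square - open_square \<in> sets lborel" using m unit_square_measurable by simp
  hence null: "unit_square - open_square \<in> null_sets lborel"
    by (rule null_sets_subset[OF square_boundary_null _ sub])
  have "emeasure lborel unit_square = emeasure lborel (open_square \<union> (unit_square - open_square))"
    by (rule arg_cong[where f = "emeasure lborel"]) auto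
  also have "\<dots> = emeasure lborel open_square" by (rule emeasure_Un_null_set[OF _ null]) (use m in simp)
  finally show ?thesis by (simp only: emeasure_open_square)
qed

text \<open>
  The measure of \<open>A\<close> is averaged over all translations \<open>x\<close> in the unit square, which by invariance does not change
  it. Exchanging the two integrations, the integral over \<open>x\<close> for a fixed coset is the area of a
  translate of \<open>A\<close> in the square, which does not depend on the coset.
\<close>
lemma haar_unique:
  assumes sets: "sets M = sets (torus_borel K)"
    and inv: "\<And>A z. A \<in> sets M \<Longrightarrow> emeasure M (shift z ` A) = emeasure M A"
    and total: "emeasure M (torus K) = ennreal k"
    and A: "A \<in> sets (torus_borel K)"
  shows "emeasure M A = ennreal k * square_measure A"
proof -
  have space: "space M = torus K" using sets_eq_imp_space_eq[OF sets] space_torus_borel by simp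
  interpret finite_measure M by (rule finite_measureI) (simp add: space total)
  define f where "f = (\<lambda>(x, y). indicator A (pr K (psi (x + rep y))) * indicator unit_square x :: ennreal)"
  have rm: "rep \<in> measurable M borel" using rep_measurable unfolding measurable_cong_sets[OF sets refl] .
  have fm: "f \<in> borel_measurable (lborel \<Otimes>\<^sub>M M)"
  proof -
    have [measurable]: "rep \<in> measurable M borel" by (rule rm)
    have [measurable]: "A \<in> sets (torus_borel K)" by (rule A)
    show ?thesis unfolding f_def by measurable
  qed
  have inner: "(\<integral>\<^sup>+y. f (x, y) \<partial>M) = emeasure M A * indicator unit_square x" for x
  proof -
    have set_eq: "{y\<in>torus K. shift (psi x) y \<in> A} = shift (- psi x) ` A"
      using shift_image[of A "- psi x"] sets.sets_into_space[OF A] unfolding space_torus_borel by simp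
    have Sm: "shift (- psi x) ` A \<in> sets M"
    proof -
      have "(\<lambda>y. pr K (psi (x + rep y))) \<in> measurable (torus_borel K) (torus_borel K)" by measurable
      from measurable_sets[OF this A]
      have "{y\<in>torus K. pr K (psi (x + rep y)) \<in> A} \<in> sets M" unfolding sets space_torus_borel by (simp add: vimage_def Int_def conj_commute)
      moreover have "pr K (psi (x + rep y)) = shift (psi x) y" if "y \<in> torus K" for y
        using rep(2)[OF that] shift_pr[of "psi x" "psi (rep y)"] by (simp add: psi_add)
      hence "{y\<in>torus K. pr K (psi (x + rep y)) \<in> A} = {y\<in>torus K. shift (psi x) y \<in> A}" by auto
      ultimately show ?thesis unfolding set_eq by simp
    qed
    have "(\<integral>\<^sup>+y. f (x, y) \<partial>M) = (\<integral>\<^sup>+y. indicator (shift (- psi x) ` A) y * indicator unit_square x \<partial>M)"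
    proof (rule nn_integral_cong)
      fix y assume "y \<in> space M"
      hence y: "y \<in> torus K" by (simp only: space)
      have "pr K (psi (x + rep y)) = shift (psi x) y"
        using rep(2)[OF y] shift_pr[of "psi x" "psi (rep y)"] by (simp add: psi_add)
      hence "pr K (psi (x + rep y)) \<in> A \<longleftrightarrow> y \<in> shift (- psi x) ` A" unfolding set_eq[symmetric] using y by simp
      thus "f (x, y) = indicator (shift (- psi x) ` A) y * indicator unit_square x"
        unfolding f_def by (simp add: indicator_def)
    qed
    also have "\<dots> = emeasure M (shift (- psi x) ` A) * indicator unit_square x"
      using Sm by (simp add: nn_integral_multc)
    also have "emeasure M (shift (- psi x) ` A) = emeasure M A" by (rule inv) (simp add: sets A)
    finally show ?thesis .
  qed
  interpret pair_sigma_finite "lborel :: (real \<times> real) measure" M ..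
  have "emeasure M A = (\<integral>\<^sup>+x. emeasure M A * indicator unit_square x \<partial>lborel)"
    by (simp add: nn_integral_cmult emeasure_unit_square)
  also have "\<dots> = (\<integral>\<^sup>+x. \<integral>\<^sup>+y. f (x, y) \<partial>M \<partial>lborel)" unfolding inner by (rule refl)
  also have "\<dots> = (\<integral>\<^sup>+y. \<integral>\<^sup>+x. f (x, y) \<partial>lborel \<partial>M)" by (rule Fubini[OF fm, symmetric])
  also have "\<dots> = (\<integral>\<^sup>+y. square_measure A \<partial>M)"
  proof (rule nn_integral_cong)
    fix y
    have "(\<integral>\<^sup>+x. f (x, y) \<partial>lborel) = (\<integral>\<^sup>+x. indicator {x\<in>unit_square. pr K (psi (x + rep y)) \<in> A} x \<partial>lborel)"
      by (intro nn_integral_cong) (auto simp: f_def indicator_def)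
    also have "\<dots> = emeasure lborel {x\<in>unit_square. pr K (psi (x + rep y)) \<in> A}"
    proof (rule nn_integral_indicator)
      have "(\<lambda>x. pr K (psi (x + rep y))) \<in> measurable borel (torus_borel K)" by measurable
      from measurable_sets[OF this A] have "{x. pr K (psi (x + rep y)) \<in> A} \<in> sets borel" by (simp add: vimage_def)
      hence "unit_square \<inter> {x. pr K (psi (x + rep y)) \<in> A} \<in> sets lborel" using unit_square_measurable by simp
      thus "{x\<in>unit_square. pr K (psi (x + rep y)) \<in> A} \<in> sets lborel" by (simp add: Int_def)
    qed
    finally show "(\<integral>\<^sup>+x. f (x, y) \<partial>lborel) = square_measure A" by (simp only: square_measure_shift[OF A])
  qed
  also have "\<dots> = ennreal k * square_measure A" by (simp add: space total mult.commute)
  finally show ?thesis .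
qed

lemma haar_exists:
  assumes k: "k \<ge> 0"
  shows "\<exists>M. sets M = sets (torus_borel K) \<and> (\<forall>A\<in>sets M. \<forall>z. emeasure M ((\<lambda>x. (+) z ` x) ` A) = emeasure M A) \<and>
    emeasure M (torus K) = ennreal k"
proof -
  define M where "M = scale_measure (ennreal k) (distr (restrict_space lborel unit_square) (torus_borel K) (\<lambda>x. pr K (psi x)))"
  have m: "(\<lambda>x. pr K (psi x)) \<in> measurable (restrict_space lborel unit_square) (torus_borel K)"
    by (rule measurable_restrict_space1) measurable
  have sets: "sets M = sets (torus_borel K)" by (simp add: M_def)
  have em: "emeasure M A = ennreal k * square_measure A" if A: "A \<in> sets (torus_borel K)" for A
  proof -
    have "emeasure M A = ennreal k * emeasure (restrict_space lborel unit_square) ((\<lambda>x. pr K (psi x)) -` A \<inter> space (restrict_space lborel unit_square))"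
      unfolding M_def emeasure_scale_measure using emeasure_distr[OF m A] by simp
    also have "(\<lambda>x. pr K (psi x)) -` A \<inter> space (restrict_space lborel unit_square) = {x\<in>unit_square. pr K (psi x) \<in> A}"
      by (auto simp: space_restrict_space)
    also have "emeasure (restrict_space lborel unit_square) {x\<in>unit_square. pr K (psi x) \<in> A} = square_measure A"
      unfolding square_measure_def by (rule emeasure_restrict_space) (use unit_square_measurable in auto)
    finally show ?thesis .
  qed
  have "emeasure M (shift z ` A) = emeasure M A" if A: "A \<in> sets M" for A z
  proof -
    have A': "A \<in> sets (torus_borel K)" using A by (simp only: sets)
    have sub: "A \<subseteq> torus K" using sets.sets_into_space[OF A'] by (simp only: space_torus_borel)
    have eq: "pr K (psi x) \<in> shift z ` A \<longleftrightarrow> pr K (psi (x + psi_inv (- z))) \<in> A" for x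
      unfolding shift_image[OF sub] psi_add psi_psi_inv mem_Collect_eq shift_pr
      by (simp add: pr_in_torus add.commute)
    have "(\<lambda>y. pr K (psi (rep y) + (- z))) \<in> measurable (torus_borel K) (torus_borel K)" by measurable
    from measurable_sets[OF this A']
    have "{y\<in>torus K. pr K (psi (rep y) + (- z)) \<in> A} \<in> sets (torus_borel K)"
      by (simp add: space_torus_borel vimage_def Int_def conj_commute)
    also have "{y\<in>torus K. pr K (psi (rep y) + (- z)) \<in> A} = shift z ` A"
    proof -
      have "pr K (psi (rep y) + (- z)) = shift (- z) y" if "y \<in> torus K" for y
        using rep(2)[OF that] shift_pr[of "- z" "psi (rep y)"] by (simp only: add.commute)
      thus ?thesis unfolding shift_image[OF sub] by auto
    qed
    finally have S: "shift z ` A \<in> sets (torus_borel K)" .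
    have "square_measure (shift z ` A) = square_measure A"
      unfolding square_measure_def[of "shift z ` A"] eq by (rule square_measure_shift[OF A'])
    thus ?thesis unfolding em[OF S] em[OF A'] by simp
  qed
  moreover have "emeasure M (torus K) = ennreal k"
  proof -
    have "torus K \<in> sets (torus_borel K)" using sets.top[of "torus_borel K"] by (simp only: space_torus_borel)
    from em[OF this] show ?thesis by (simp add: square_measure_def pr_in_torus emeasure_unit_square)
  qed
  ultimately show ?thesis using sets unfolding shift_def by blast
qed

lemma torus_haar_eq:
  assumes A: "A \<in> sets (torus_borel K)"
  shows "emeasure (torus_haar K) A = ennreal (sqrt \<bar>real_of_int (discriminant K)\<bar> / 2) * square_measure A"
proof -
  let ?k = "sqrt \<bar>real_of_int (discriminant K)\<bar> / 2"
  let ?H = "\<lambda>M. sets M = sets (torus_borel K) \<and> (\<forall>A\<in>sets M. \<forall>z. emeasure M ((\<lambda>x. (+) z ` x) ` A) = emeasure M A) \<and>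
    emeasure M (torus K) = ennreal ?k"
  have formula: "emeasure M B = ennreal ?k * square_measure B" if "?H M" "B \<in> sets (torus_borel K)" for M B
    by (rule haar_unique[OF _ _ _ that(2)]) (use that(1) in \<open>auto simp: shift_def[abs_def]\<close>)
  obtain M where M: "?H M" using haar_exists[of ?k] by auto
  have "torus_haar K = M"
    unfolding torus_haar_def
  proof (rule the_equality)
    show "?H M" by (rule M)
    fix M' assume M': "?H M'"
    show "M' = M"
    proof (rule measure_eqI)
      show "sets M' = sets M" using M M' by simp
      fix B assume "B \<in> sets M'"
      hence "B \<in> sets (torus_borel K)" using M' by simp
      thus "emeasure M' B = emeasure M B" using formula[OF M] formula[OF M'] by simp
    qed
  qed
  thus ?thesis using formula[OF M A] by simp
qed

text \<open>
  Translating an annulus about \<open>q / p\<close> by a lattice point \<open>a\<close> gives the annulus about \<open>(q + p * a) / p\<close>,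
  which belongs to the same family. So the union of the projected annuli is the projection of their union, and
  normalized Haar measure is area in the unit square.
\<close>
lemma covered_fraction_eq:
  assumes d: "d > 0" and D: "discriminant K \<noteq> 0"
  shows "1 - covered_fraction K s d = measure lborel (uncovered d (exp (- s / 2)))"
proof -
  define \<rho> where "\<rho> = exp (- s / 2)"
  have rho: "\<rho> > 0" "exp (s / 2) = 1 / \<rho>" "exp s = 1 / (\<rho> * \<rho>)"
  proof -
    have "exp s = exp (s / 2) * exp (s / 2)" by (simp flip: exp_add)
    thus "\<rho> > 0" "exp (s / 2) = 1 / \<rho>" "exp s = 1 / (\<rho> * \<rho>)"
      unfolding \<rho>_def by (simp_all add: exp_minus inverse_eq_divide)
  qed
  define I where "I = {(p, q) \<in> primitive_pairs K. p \<noteq> 0}"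
  define W where "W = (\<Union>(p, q)\<in>I. pr K ` annulus (q / p) (exp s / d) (exp (s / 2) / cmod p))"
  have cntI: "countable I"
    by (rule countable_subset[of _ "\<O> \<times> \<O>"]) (auto simp: I_def primitive_pairs_iff countable_O)
  have cpt: "compact (annulus c r R)" for c r R
  proof -
    have "annulus c r R = {w. r \<le> cmod (w - c)} \<inter> cball c R"
      unfolding annulus_def by (auto simp: dist_norm norm_minus_commute)
    also have "compact \<dots>"
      by (intro closed_Int_compact compact_cball closed_Collect_le continuous_intros)
    finally show ?thesis .
  qed
  have Wm: "W \<in> sets (torus_borel K)"
    unfolding W_def case_prod_unfold by (intro sets.countable_UN'' cntI compact_pr_image cpt)
  have mem: "pr K (psi x) \<in> W \<longleftrightarrow> covered d (psi x * of_real \<rho>) (of_real \<rho>)" for x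
  proof -
    have ann: "psi x \<in> annulus (q / p) (exp s / d) (exp (s / 2) / cmod p) \<longleftrightarrow>
       cmod (p * (psi x * of_real \<rho>) - q * of_real \<rho>) \<le> 1 \<and>
       cmod p \<le> d * cmod (of_real \<rho>) * cmod (p * (psi x * of_real \<rho>) - q * of_real \<rho>)" if "p \<noteq> 0" for p q
    proof -
      define t where "t = cmod (psi x - q / p)"
      have "p * (psi x * of_real \<rho>) - q * of_real \<rho> = p * of_real \<rho> * (psi x - q / p)"
        using that by (simp add: field_simps)
      hence e: "cmod (p * (psi x * of_real \<rho>) - q * of_real \<rho>) = cmod p * \<rho> * t"
        using rho(1) by (simp add: norm_mult t_def)
      have p: "cmod p > 0" using that by simp
      have 1: "t \<le> exp (s / 2) / cmod p \<longleftrightarrow> cmod p * \<rho> * t \<le> 1"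
        unfolding rho(2) using p rho(1) by (simp add: field_simps)
      have 2: "exp s / d \<le> t \<longleftrightarrow> 1 \<le> d * \<rho> * \<rho> * t"
        unfolding rho(3) using d rho(1) by (simp add: field_simps)
      have 3: "cmod p \<le> d * \<rho> * (cmod p * \<rho> * t) \<longleftrightarrow> 1 \<le> d * \<rho> * \<rho> * t"
      proof -
        have "d * \<rho> * (cmod p * \<rho> * t) = cmod p * (d * \<rho> * \<rho> * t)" by (simp only: mult_ac)
        thus ?thesis using mult_le_cancel_left_pos[OF p, of 1 "d * \<rho> * \<rho> * t"] by (simp only: mult_1_right)
      qed
      show ?thesis unfolding annulus_def mem_Collect_eq t_def[symmetric] e 1 2
        using 3 rho(1) by auto
    qed
    show ?thesis
    proof
      assume "pr K (psi x) \<in> W"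
      then obtain p q w where pq: "(p, q) \<in> I" "w \<in> annulus (q / p) (exp s / d) (exp (s / 2) / cmod p)" "pr K (psi x) = pr K w"
        unfolding W_def by blast
      define a where "a = psi x - w"
      have aO: "a \<in> \<O>" using pq(3) unfolding a_def pr_eq_iff .
      have p: "p \<noteq> 0" "p \<in> \<O>" "q \<in> \<O>" "unimodular p q" using pq(1) unfolding I_def by (auto simp: primitive_pairs_iff)
      obtain \<alpha> \<beta> where ab: "\<alpha> \<in> \<O>" "\<beta> \<in> \<O>" "p * \<alpha> + q * \<beta> = 1" using p(4) unfolding unimodular_def by (elim bexE)
      have "p * (\<alpha> - a * \<beta>) + (q + p * a) * \<beta> = 1" using ab(3) by (simp add: algebra_simps)
      moreover have "\<alpha> - a * \<beta> \<in> \<O>" by (intro O_diff O_mult aO ab)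
      ultimately have "unimodular p (q + p * a)" unfolding unimodular_def using ab(2) by blast
      moreover have "q + p * a \<in> \<O>" by (intro O_add O_mult p aO)
      moreover have "psi x \<in> annulus ((q + p * a) / p) (exp s / d) (exp (s / 2) / cmod p)"
      proof -
        have "psi x - (q + p * a) / p = w - q / p" using p(1) by (simp add: a_def field_simps)
        thus ?thesis using pq(2) unfolding annulus_def by simp
      qed
      hence "cmod (p * (psi x * of_real \<rho>) - (q + p * a) * of_real \<rho>) \<le> 1 \<and>
       cmod p \<le> d * cmod (of_real \<rho>) * cmod (p * (psi x * of_real \<rho>) - (q + p * a) * of_real \<rho>)"
        unfolding ann[OF p(1)] .
      ultimately show "covered d (psi x * of_real \<rho>) (of_real \<rho>)" unfolding covered_def using p(1,2) by blast
    next
      assume "covered d (psi x * of_real \<rho>) (of_real \<rho>)"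
      then obtain p q where pq: "p \<in> \<O>" "q \<in> \<O>" "unimodular p q" "p \<noteq> 0"
        "cmod (p * (psi x * of_real \<rho>) - q * of_real \<rho>) \<le> 1 \<and>
         cmod p \<le> d * cmod (of_real \<rho>) * cmod (p * (psi x * of_real \<rho>) - q * of_real \<rho>)"
        unfolding covered_def by blast
      have "psi x \<in> annulus (q / p) (exp s / d) (exp (s / 2) / cmod p)" unfolding ann[OF pq(4)] by (rule pq(5))
      moreover have "(p, q) \<in> I" using pq unfolding I_def by (simp add: primitive_pairs_iff)
      ultimately show "pr K (psi x) \<in> W" unfolding W_def by blast
    qed
  qed
  let ?k = "sqrt \<bar>real_of_int (discriminant K)\<bar> / 2"
  have k: "?k > 0" using D by simp
  define X where "X = {x\<in>unit_square. pr K (psi x) \<in> W}"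
  have Xm: "X \<in> sets lborel"
  proof -
    have "X = unit_square \<inter> {x. pr K (psi x) \<in> W}" unfolding X_def by blast
    thus ?thesis using sets.Int[OF unit_square_measurable pr_psi_measurable[OF Wm]] by simp
  qed
  have "measure (torus_haar K) W = ?k * measure lborel X"
    unfolding measure_def torus_haar_eq[OF Wm] square_measure_def X_def[symmetric] enn2real_mult using k by simp
  moreover have "2 / sqrt \<bar>real_of_int (discriminant K)\<bar> * (?k * measure lborel X) = measure lborel X" using D by simp
  ultimately have cf: "covered_fraction K s d = measure lborel X"
    unfolding covered_fraction_def W_def[unfolded I_def, symmetric] by (simp only:)
  let ?U = "uncovered d \<rho>"
  have Um: "?U \<in> sets lborel" using borel_open[OF open_uncovered] by simp
  have "unit_square - open_square \<subseteq> closed_square - open_square" by auto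
  moreover have "unit_square - open_square \<in> sets lborel"
    using borel_open[OF open_open_square] unit_square_measurable by simp
  ultimately have null: "unit_square - open_square \<in> null_sets lborel"
    using null_sets_subset[OF square_boundary_null] by blast
  have "(unit_square - X) - ?U \<subseteq> unit_square - open_square"
    unfolding X_def uncovered_def mem using rho(1) by auto
  moreover have "(unit_square - X) - ?U \<in> sets lborel" using Xm Um unit_square_measurable by auto
  ultimately have null2: "(unit_square - X) - ?U \<in> null_sets lborel"
    using null_sets_subset[OF null] by blast
  have Usub: "?U \<subseteq> unit_square - X" unfolding X_def uncovered_def mem by auto
  have "emeasure lborel (unit_square - X) = emeasure lborel (?U \<union> ((unit_square - X) - ?U))"
    using Usub by (intro arg_cong[where f = "emeasure lborel"]) blast
  also have "\<dots> = emeasure lborel ?U" by (rule emeasure_Un_null_set[OF Um null2])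
  finally have "measure lborel (unit_square - X) = measure lborel ?U" by (simp only: measure_def)
  moreover have "measure lborel (unit_square - X) = measure lborel unit_square - measure lborel X"
    by (rule measure_Diff) (use emeasure_unit_square Xm unit_square_measurable X_def in auto)
  moreover have "measure lborel unit_square = 1" by (simp add: measure_def emeasure_unit_square)
  ultimately show ?thesis unfolding cf \<rho>_def by simp
qed

end

section \<open>The ring of integers of an imaginary quadratic field\<close>

abbreviation int_eval :: "int poly \<Rightarrow> complex \<Rightarrow> complex"
  where "int_eval p z \<equiv> poly (map_poly of_int p) z"

lemma int_eval_pCons: "int_eval (pCons a p) z = of_int a + z * int_eval p z"
  by (simp add: map_poly_pCons)

lemma int_eval_add: "int_eval (p + q) z = int_eval p z + int_eval q z"
proof -
  have "map_poly of_int (p + q) = (map_poly of_int p + map_poly of_int q :: complex poly)"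
    by (rule poly_eqI) (simp add: coeff_map_poly)
  thus ?thesis by simp
qed

lemma int_eval_smult: "int_eval (smult c p) z = of_int c * int_eval p z"
  by (induction p) (simp_all add: int_eval_pCons algebra_simps)

lemma int_eval_mult: "int_eval (p * q) z = int_eval p z * int_eval q z"
  by (induction p) (simp_all add: int_eval_pCons int_eval_add int_eval_smult algebra_simps)

text \<open>
  Gauss's lemma. The primitive quadratic polynomial \<open>F\<close> with root \<open>z\<close> divides an integer multiple \<open>a * p\<close> of a monic
  integer polynomial \<open>p\<close> with root \<open>z\<close>: a remainder would be linear with a nonreal root. Comparing contents, \<open>a\<close>
  divides the cofactor, so the leading coefficient of \<open>F\<close> divides that of \<open>p\<close>, which is \<open>1\<close>.
\<close>
lemma algebraic_int_quadratic:
  fixes z :: complex and c0 c1 c2 :: int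
  assumes alg: "algebraic_int z" and Im: "Im z \<noteq> 0" and c2: "c2 \<noteq> 0"
    and root: "of_int c0 + of_int c1 * z + of_int c2 * z ^ 2 = 0"
  shows "\<exists>T N :: int. z ^ 2 = of_int T * z - of_int N"
proof -
  define F0 where "F0 = [:c0, c1, c2:]"
  define F where "F = primitive_part F0"
  have F0: "F0 \<noteq> 0" "degree F0 = 2" using c2 by (simp_all add: F0_def)
  have cF0: "content F0 \<noteq> 0" using F0 by simp
  have F0F: "F0 = smult (content F0) F" unfolding F_def by simp
  have cF: "content F = 1" unfolding F_def using F0 by simp
  have dF: "degree F = 2" using F0(2) F0F cF0 by (metis degree_smult_eq)
  have "int_eval F0 z = 0" using root by (simp add: F0_def int_eval_pCons power2_eq_square algebra_simps)
  hence evF: "int_eval F z = 0" using cF0 by (subst (asm) F0F) (simp add: int_eval_smult)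
  have F: "F \<noteq> 0" using dF by auto
  obtain p where p: "int_eval p z = 0" "lead_coeff p = 1" using alg unfolding algebraic_int_altdef_ipoly by blast
  define r where "r = pseudo_mod p F"
  obtain a q where aq: "a \<noteq> 0" "smult a p = F * q + r" using pseudo_mod(1)[OF F, of p] unfolding r_def by blast
  have "r = 0 \<or> degree r < degree F" unfolding r_def by (rule pseudo_mod(2)[OF F])
  hence dr: "degree r \<le> 1" using dF by auto
  have "int_eval (smult a p) z = int_eval F z * int_eval q z + int_eval r z"
    unfolding aq(2) int_eval_add int_eval_mult by (rule refl)
  hence evr: "int_eval r z = 0" by (simp add: int_eval_smult p(1) evF)
  have "r = [:coeff r 0, coeff r 1:]"
    using dr by (intro poly_eqI) (auto simp: coeff_pCons coeff_eq_0 split: nat.splits)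
  then obtain r0 r1 where r: "r = [:r0, r1:]" by blast
  have "of_int r0 + z * of_int r1 = 0" using evr unfolding r by (simp add: int_eval_pCons)
  hence "Im (of_int r0 + z * of_int r1) = 0" "Re (of_int r0 + z * of_int r1) = 0" by simp_all
  hence "r1 = 0" "r0 = 0" using Im by auto
  hence apq: "smult a p = F * q" using aq(2) r by simp
  have "content p dvd lead_coeff p" by (rule content_dvd_coeff)
  hence "is_unit (content p)" unfolding p(2) .
  hence "content p = 1" by (metis is_unit_normalize normalize_content)
  hence "content q = \<bar>a\<bar>" using arg_cong[OF apq, of content] cF by (simp add: content_mult)
  hence "a dvd lead_coeff q" using content_dvd_coeff[of q "degree q"] by simp
  then obtain k where k: "lead_coeff q = a * k" by blast
  have "a * lead_coeff p = lead_coeff F * lead_coeff q"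
    using arg_cong[OF apq, of lead_coeff] unfolding lead_coeff_smult lead_coeff_mult .
  hence "a * 1 = a * (lead_coeff F * k)" unfolding p(2) k by (simp only: mult_ac)
  hence "lead_coeff F * k = 1" using aq(1) by (metis mult_left_cancel)
  hence "lead_coeff F = 1 \<or> lead_coeff F = - 1" by (metis zmult_eq_1_iff)
  hence f2: "coeff F 2 * coeff F 2 = 1" using dF by auto
  have Fc: "F = [:coeff F 0, coeff F 1, coeff F 2:]"
    using dF by (intro poly_eqI) (auto simp: coeff_pCons numeral_2_eq_2 coeff_eq_0 split: nat.splits)
  have "of_int (coeff F 0) + of_int (coeff F 1) * z + of_int (coeff F 2) * z ^ 2 = 0"
    using evF by (subst (asm) Fc) (simp add: int_eval_pCons power2_eq_square algebra_simps)
  hence "of_int (coeff F 2) * (of_int (coeff F 0) + of_int (coeff F 1) * z + of_int (coeff F 2) * z ^ 2) = 0" by simp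
  hence "of_int (coeff F 2 * coeff F 0) + of_int (coeff F 2 * coeff F 1) * z + of_int (coeff F 2 * coeff F 2) * z ^ 2 = 0"
    by (simp add: algebra_simps)
  hence "z ^ 2 = of_int (- (coeff F 2 * coeff F 1)) * z - of_int (coeff F 2 * coeff F 0)"
    unfolding f2 by (simp add: algebra_simps eq_neg_iff_add_eq_0)
  thus ?thesis by blast
qed

lemma rat_as_fraction: "\<exists>a b :: int. b > 0 \<and> r = of_int a / (of_int b :: rat)"
  using quotient_of_div[of r] quotient_of_denom_pos[of r] by (metis surj_pair)

interpretation rat_complex: vector_space "\<lambda>(c::rat) (z::complex). of_rat c * z"
  by unfold_locales (simp_all add: algebra_simps of_rat_add of_rat_mult)

text \<open>
  Any nonreal \<open>\<alpha> \<in> K\<close> gives a basis \<open>(\<alpha>, 1)\<close>. Completing the square in the quadratic equation of \<open>\<alpha>\<close> and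
  removing the square part of the radicand leaves a generator \<open>\<i> * sqrt d\<close>.
\<close>
lemma imaginary_quadratic_field_generator:
  assumes K: "imaginary_quadratic_field K"
  obtains d :: int where "d > 0" "squarefree d"
    "K = {of_rat a + of_rat b * (\<i> * of_real (sqrt (of_int d))) | a b. True}"
proof -
  have one: "1 \<in> K" and cl: "x \<in> K \<Longrightarrow> y \<in> K \<Longrightarrow> x - y \<in> K" "x \<in> K \<Longrightarrow> y \<in> K \<Longrightarrow> x * y \<in> K"
    and inv: "x \<in> K \<Longrightarrow> inverse x \<in> K" and dim: "rat_complex.dim K = 2" and nonreal: "\<not> K \<subseteq> \<real>" for x y
    using K unfolding imaginary_quadratic_field_def by blast+
  have zero: "0 \<in> K" using cl(1)[OF one one] by simp
  have neg: "- x \<in> K" if "x \<in> K" for x using cl(1)[OF zero that] by simp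
  have add: "x + y \<in> K" if "x \<in> K" "y \<in> K" for x y using cl(1)[OF that(1) neg[OF that(2)]] by simp
  have nat: "of_nat n \<in> K" for n by (induction n) (simp_all add: zero one add)
  have int: "of_int n \<in> K" for n by (cases n) (simp_all add: nat neg del: of_nat_Suc)
  have rat: "of_rat r \<in> K" for r
  proof -
    obtain a b :: int where "r = of_int a / of_int b" using rat_as_fraction by blast
    hence "of_rat r = (of_int a / of_int b :: complex)" by (simp add: of_rat_divide)
    also have "\<dots> = of_int a * inverse (of_int b)" by (rule divide_inverse)
    also have "\<dots> \<in> K" by (intro cl(2) int inv)
    finally show ?thesis .
  qed
  obtain \<alpha> where \<alpha>': "\<alpha> \<in> K" "\<alpha> \<notin> \<real>" using nonreal by blast
  have \<alpha>: "\<alpha> \<in> K" "Im \<alpha> \<noteq> 0" using \<alpha>' by (simp_all add: complex_is_Real_iff)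
  obtain B where B: "B \<subseteq> K" "rat_complex.independent B" "K \<subseteq> rat_complex.span B" "card B = 2"
    using rat_complex.basis_exists[of K] dim by metis
  have finB: "finite B" using B(4) by (metis card.infinite zero_neq_numeral)
  have Im_rat: "Im (of_rat r) = 0" "Re (of_rat r) = of_rat r" for r :: rat
  proof -
    obtain a b :: int where "r = of_int a / of_int b" using rat_as_fraction by blast
    hence "(of_rat r :: complex) = of_real (of_rat r)" by (simp add: of_rat_divide)
    thus "Im (of_rat r) = 0" "Re (of_rat r) = of_rat r" by simp_all
  qed
  have ind1: "rat_complex.independent {1}" by (simp add: rat_complex.dependent_single)
  have "\<alpha> \<notin> rat_complex.span {1}"
  proof
    assume "\<alpha> \<in> rat_complex.span {1}"
    then obtain r where "\<alpha> = of_rat r * 1" unfolding rat_complex.span_singleton by blast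
    thus False using \<alpha>(2) Im_rat by simp
  qed
  hence ind2: "rat_complex.independent {\<alpha>, 1}" using ind1 by (rule rat_complex.independent_insertI)
  have Kspan: "x \<in> rat_complex.span {\<alpha>, 1}" if x: "x \<in> K" for x
  proof (rule ccontr)
    assume n: "x \<notin> rat_complex.span {\<alpha>, 1}"
    hence ind3: "rat_complex.independent {x, \<alpha>, 1}" using ind2 by (rule rat_complex.independent_insertI)
    have "{x, \<alpha>, 1} \<subseteq> rat_complex.span B" using x \<alpha>(1) one B(3) by blast
    from rat_complex.independent_span_bound[OF finB ind3 this] have "card {x, \<alpha>, 1} \<le> 2" using B(4) by simp
    moreover have "x \<noteq> \<alpha>" "x \<noteq> 1" using n rat_complex.span_base by blast+
    moreover have "\<alpha> \<noteq> 1" using \<alpha>(2) by auto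
    ultimately show False by simp
  qed
  have comb: "\<exists>a b. x = of_rat a * \<alpha> + of_rat b" if x: "x \<in> K" for x
  proof -
    obtain a where "x - of_rat a * \<alpha> \<in> rat_complex.span {1}"
      using Kspan[OF x] unfolding rat_complex.span_insert by blast
    then obtain b where "x - of_rat a * \<alpha> = of_rat b * 1" unfolding rat_complex.span_singleton by blast
    hence "x = of_rat a * \<alpha> + of_rat b" by (simp add: algebra_simps)
    thus ?thesis by blast
  qed
  obtain u v where uv: "\<alpha> * \<alpha> = of_rat u * \<alpha> + of_rat v" using comb[OF cl(2)[OF \<alpha>(1) \<alpha>(1)]] by blast
  have "Im (\<alpha> * \<alpha>) = Im (of_rat u * \<alpha> + of_rat v)" by (simp only: uv)
  hence "2 * Re \<alpha> * Im \<alpha> = of_rat u * Im \<alpha>" by (simp add: Im_rat)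
  hence u: "2 * Re \<alpha> = of_rat u" using \<alpha>(2) by simp
  have "Re (\<alpha> * \<alpha>) = Re (of_rat u * \<alpha> + of_rat v)" by (simp only: uv)
  hence "Re \<alpha> * Re \<alpha> - Im \<alpha> * Im \<alpha> = of_rat u * Re \<alpha> + of_rat v" by (simp add: Im_rat)
  hence im2: "Im \<alpha> * Im \<alpha> = of_rat (- (u * u) / 4 - v)"
    unfolding of_rat_diff of_rat_divide of_rat_minus of_rat_mult u[symmetric] by (simp add: algebra_simps)
  obtain m n :: int where mn: "- (u * u) / 4 - v = of_int m / of_int n" "n > 0" using rat_as_fraction by blast
  have im2': "Im \<alpha> * Im \<alpha> = of_int m / of_int n" unfolding im2 mn by (simp add: of_rat_divide)
  define M where "M = m * n"
  have M: "(of_int n * Im \<alpha>) * (of_int n * Im \<alpha>) = of_int M"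
  proof -
    have "(of_int n * Im \<alpha>) * (of_int n * Im \<alpha>) = of_int n * of_int n * (Im \<alpha> * Im \<alpha>)" by (simp only: mult_ac)
    also have "\<dots> = of_int M" unfolding im2' M_def using mn(2) by simp
    finally show ?thesis .
  qed
  have "real_of_int M > 0"
  proof -
    have "of_int n * Im \<alpha> \<noteq> 0" using mn(2) \<alpha>(2) by simp
    thus ?thesis unfolding M[symmetric] by (metis not_real_square_gt_zero)
  qed
  hence Mpos: "M > 0" by simp
  define k where "k = square_part M"
  define d where "d = squarefree_part M"
  have Mdk: "M = d * k ^ 2" unfolding d_def k_def by (rule squarefree_decompose)
  have sqf: "squarefree d" unfolding d_def using Mpos by simp
  have k: "k \<noteq> 0" using Mdk Mpos by auto
  have dpos: "d > 0" using Mdk Mpos k by (metis zero_less_mult_pos2 zero_less_power2)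
  define \<eta> where "\<eta> = \<i> * complex_of_real (sqrt (of_int d))"
  have "(of_int n * Im \<alpha> / of_int k) ^ 2 = of_int d"
  proof -
    have "(of_int n * Im \<alpha> / of_int k) ^ 2 = of_int M / of_int k ^ 2"
      unfolding power_divide power2_eq_square[of "of_int n * Im \<alpha>"] M by (rule refl)
    thus ?thesis using k by (simp add: Mdk)
  qed
  hence "\<bar>of_int n * Im \<alpha> / of_int k\<bar> = sqrt (of_int d)" by (metis real_sqrt_abs)
  hence "of_int n * Im \<alpha> / of_int k = sqrt (of_int d) \<or> of_int n * Im \<alpha> / of_int k = - sqrt (of_int d)" by linarith
  then obtain \<sigma> :: int where \<sigma>: "\<sigma> = 1 \<or> \<sigma> = - 1" "of_int n * Im \<alpha> / of_int k = of_int \<sigma> * sqrt (of_int d)"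
    by (elim disjE) (force, force)
  have Ima: "Im \<alpha> = of_int (\<sigma> * k) / of_int n * sqrt (of_int d)" using \<sigma>(2) k mn(2) by (simp add: field_simps)
  define w where "w = (of_int (\<sigma> * k) / of_int n :: rat)"
  have w: "of_rat w = (of_int (\<sigma> * k) / of_int n :: real)" "w \<noteq> 0"
    unfolding w_def using mn(2) k \<sigma>(1) by (auto simp: of_rat_divide of_rat_mult)
  have \<alpha>w: "\<alpha> = of_rat (u / 2) + of_rat w * \<eta>"
    unfolding complex_eq_iff \<eta>_def using u Ima w(1) by (simp add: Im_rat of_rat_divide)
  have \<eta>K: "\<eta> \<in> K"
  proof -
    have "\<eta> = of_rat (inverse w) * (\<alpha> - of_rat (u / 2))" unfolding \<alpha>w using w(2) by (simp add: of_rat_inverse)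
    also have "\<dots> \<in> K" by (intro cl rat \<alpha>)
    finally show ?thesis .
  qed
  have "K = {of_rat a + of_rat b * \<eta> | a b. True}"
  proof (intro equalityI subsetI)
    fix x assume "x \<in> K"
    then obtain a b where "x = of_rat a * \<alpha> + of_rat b" using comb by blast
    hence "x = of_rat (a * (u / 2) + b) + of_rat (a * w) * \<eta>" unfolding \<alpha>w by (simp only: of_rat_add of_rat_mult algebra_simps)
    thus "x \<in> {of_rat a + of_rat b * \<eta> | a b. True}" by blast
  next
    fix x assume "x \<in> {of_rat a + of_rat b * \<eta> | a b. True}"
    then obtain a b where x: "x = of_rat a + of_rat b * \<eta>" by blast
    show "x \<in> K" unfolding x by (intro add cl rat \<eta>K)
  qed
  thus ?thesis using that[OF dpos sqf] unfolding \<eta>_def by blast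
qed

lemma quadratic_mod_4:
  fixes T r d :: int
  assumes d: "d mod 4 \<noteq> 0"
  shows "(T * T + r * r * d) mod 4 = 0 \<longleftrightarrow> (if d mod 4 = 3 then even (T - r) else even T \<and> even r)"
proof -
  have e: "(T * T + r * r * d) mod 4 = ((T mod 4) * (T mod 4) + (r mod 4) * (r mod 4) * (d mod 4)) mod 4"
    by (intro mod_add_cong mod_mult_cong) simp_all
  have p: "even T \<longleftrightarrow> even (T mod 4)" "even r \<longleftrightarrow> even (r mod 4)" by presburger+
  have c: "T mod 4 = 0 \<or> T mod 4 = 1 \<or> T mod 4 = 2 \<or> T mod 4 = 3"
    "r mod 4 = 0 \<or> r mod 4 = 1 \<or> r mod 4 = 2 \<or> r mod 4 = 3"
    "d mod 4 = 1 \<or> d mod 4 = 2 \<or> d mod 4 = 3" using d by presburger+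
  show ?thesis unfolding e even_diff even_add p using c by (elim disjE) simp_all
qed

text \<open>
  The trace \<open>2 * a\<close> and the norm \<open>a\<^sup>2 + b\<^sup>2 * d\<close> of an algebraic integer \<open>a + b * \<i> * sqrt d\<close> are integers.
  Hence \<open>(2 * b)\<^sup>2 * d\<close> is an integer, and \<open>2 * b\<close> is one because \<open>d\<close> is squarefree.
\<close>
lemma ring_of_integers_characterization:
  assumes d: "d > 0" "squarefree d" and K: "K = {of_rat a + of_rat b * (\<i> * of_real (sqrt (of_int d))) | a b. True}"
  shows "z \<in> ring_of_integers K \<longleftrightarrow>
    (\<exists>T r :: int. z = (of_int T + of_int r * (\<i> * of_real (sqrt (of_int d)))) / 2 \<and> (T * T + r * r * d) mod 4 = 0)"
proof
  define \<eta> where "\<eta> = \<i> * complex_of_real (sqrt (of_int d))"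
  have eta2: "\<eta> * \<eta> = - of_int d"
  proof -
    have "\<eta> * \<eta> = (\<i> * \<i>) * of_real (sqrt (of_int d) * sqrt (of_int d))"
      by (simp only: \<eta>_def of_real_mult mult_ac)
    also have "sqrt (of_int d) * sqrt (of_int d) = of_int d" using d by simp
    finally show ?thesis by simp
  qed
  have Im_rat: "Im (of_rat r) = 0" "Re (of_rat r) = of_rat r" for r :: rat
  proof -
    obtain a b :: int where "r = of_int a / of_int b" using rat_as_fraction by blast
    hence "(of_rat r :: complex) = of_real (of_rat r)" by (simp add: of_rat_divide)
    thus "Im (of_rat r) = 0" "Re (of_rat r) = of_rat r" by simp_all
  qed
  {
    assume "\<exists>T r :: int. z = (of_int T + of_int r * (\<i> * of_real (sqrt (of_int d)))) / 2 \<and> (T * T + r * r * d) mod 4 = 0"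
    then obtain T r :: int where z: "z = (of_int T + of_int r * \<eta>) / 2" "(T * T + r * r * d) mod 4 = 0"
      unfolding \<eta>_def[symmetric] by (elim exE conjE) (rule that)
    have "4 dvd T * T + r * r * d" using z(2) by (simp only: mod_eq_0_iff_dvd)
    then obtain n where n: "T * T + r * r * d = 4 * n" by (elim dvdE)
    have "z * z = (of_int T * of_int T + 2 * (of_int T * of_int r * \<eta>) + of_int r * of_int r * (\<eta> * \<eta>)) / 4"
      unfolding z(1) by (simp add: field_simps)
    hence zz: "z * z = (of_int T * of_int T + 2 * (of_int T * of_int r * \<eta>) - of_int r * of_int r * of_int d) / 4"
      unfolding eta2 by simp
    have "of_int (T * T + r * r * d) = (of_int (4 * n) :: complex)" by (simp only: n)
    hence E: "of_int T * of_int T + of_int r * of_int r * of_int d = (4 * of_int n :: complex)" by simp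
    have "z * z - of_int T * z + of_int n = (4 * of_int n - (of_int T * of_int T + of_int r * of_int r * of_int d)) / 4"
      unfolding zz unfolding z(1) by (simp add: field_simps)
    hence "z * z - of_int T * z + of_int n = 0" unfolding E by simp
    hence "poly (map_poly of_int [:n, - T, 1:]) z = 0" by (simp add: int_eval_pCons algebra_simps)
    hence "algebraic_int z" unfolding algebraic_int_altdef_ipoly by (intro exI[of _ "[:n, - T, 1:]"]) simp
    moreover have "z \<in> K"
    proof -
      have "z = of_rat (of_int T / 2) + of_rat (of_int r / 2) * \<eta>"
        unfolding z(1) by (simp add: of_rat_divide add_divide_distrib)
      thus ?thesis unfolding K \<eta>_def by blast
    qed
    ultimately show "z \<in> ring_of_integers K" unfolding ring_of_integers_def by blast
  }
  {
    assume "z \<in> ring_of_integers K"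
    hence alg: "algebraic_int z" and "z \<in> K" unfolding ring_of_integers_def by blast+
    then obtain a b where z: "z = of_rat a + of_rat b * \<eta>" unfolding K \<eta>_def by blast
    have absd: "\<bar>real_of_int d\<bar> = real_of_int d" by (rule abs_of_pos) (simp add: d(1))
  have sd: "sqrt (of_int d) > 0" using d by simp
    have Re: "Re z = of_rat a" and Imz: "Im z = of_rat b * sqrt (of_int d)"
      unfolding z \<eta>_def by (simp_all add: Im_rat)
    have "\<exists>T r :: int. 2 * a = of_int T \<and> 2 * b = of_int r \<and> (T * T + r * r * d) mod 4 = 0"
    proof (cases "b = 0")
      case True
      hence "z = of_rat a" by (simp add: z)
      moreover have "z \<in> \<rat>" using \<open>z = of_rat a\<close> by simp
      ultimately have "z \<in> \<int>" using rational_algebraic_int_is_int[OF alg] by blast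
      then obtain m where "z = of_int m" by (elim Ints_cases)
      hence "(of_rat a :: complex) = of_rat (of_int m)" using \<open>z = of_rat a\<close> by simp
      hence "a = of_int m" by (simp only: of_rat_eq_iff)
      thus ?thesis using True by (intro exI[of _ "2 * m"] exI[of _ 0]) simp
    next
      case False
      have Im0: "Im z \<noteq> 0" using False sd unfolding Imz by simp
      obtain t1 t2 where t: "2 * a = of_int t1 / (of_int t2 :: rat)" "t2 > 0" using rat_as_fraction by blast
      obtain n1 n2 where n: "a * a + b * b * of_int d = of_int n1 / (of_int n2 :: rat)" "n2 > 0" using rat_as_fraction by blast
      have quad: "z * z - of_rat (2 * a) * z + of_rat (a * a + b * b * of_int d) = 0"
      proof -
        have "z * z = of_rat a * of_rat a + 2 * (of_rat a * of_rat b * \<eta>) + of_rat b * of_rat b * (\<eta> * \<eta>)"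
          unfolding z by (simp add: algebra_simps)
        thus ?thesis unfolding eta2 of_rat_add of_rat_mult by (simp add: z algebra_simps)
      qed
      have tc: "of_rat (2 * a) = (of_int t1 / of_int t2 :: complex)" unfolding t by (simp add: of_rat_divide)
      have nc: "of_rat (a * a + b * b * of_int d) = (of_int n1 / of_int n2 :: complex)" unfolding n by (simp add: of_rat_divide)
      have "of_int (n1 * t2) + of_int (- (t1 * n2)) * z + of_int (t2 * n2) * z ^ 2 = 0"
      proof -
        have nz: "(of_int t2 :: complex) \<noteq> 0" "(of_int n2 :: complex) \<noteq> 0" using t(2) n(2) by simp_all
        have "of_int (t2 * n2) * (z * z - of_int t1 / of_int t2 * z + of_int n1 / of_int n2) = 0"
          using quad unfolding tc nc by simp
        moreover have "of_int (t2 * n2) * (of_int t1 / of_int t2 * z) = of_int (t1 * n2) * z"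
          "of_int (t2 * n2) * (of_int n1 / of_int n2 :: complex) = of_int (n1 * t2)" using nz by simp_all
        ultimately have "of_int (t2 * n2) * (z * z) - of_int (t1 * n2) * z + of_int (n1 * t2) = 0"
          by (simp only: right_diff_distrib distrib_left)
        thus ?thesis by (simp add: power2_eq_square algebra_simps)
      qed
      moreover have "t2 * n2 \<noteq> 0" using t n by simp
      ultimately obtain T N :: int where TN: "z ^ 2 = of_int T * z - of_int N"
        using algebraic_int_quadratic[OF alg Im0] by blast
      have "Im (z ^ 2) = Im (of_int T * z - of_int N)" by (simp only: TN)
      hence "2 * Re z * Im z = of_int T * Im z" by (simp add: power2_eq_square)
      hence ReT: "2 * Re z = of_int T" using Im0 by simp
      have "Re (z ^ 2) = Re (of_int T * z - of_int N)" by (simp only: TN)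
      hence "Re z * Re z - Im z * Im z = of_int T * Re z - of_int N" by (simp add: power2_eq_square)
      hence N: "Re z * Re z + Im z * Im z = of_int N" unfolding ReT[symmetric] by simp
      have aT: "2 * a = of_int T"
      proof -
        have "(of_rat (2 * a) :: real) = of_rat (of_int T)" using ReT unfolding Re by (simp add: of_rat_mult)
        thus ?thesis by (simp only: of_rat_eq_iff)
      qed
      have bN: "(2 * b) * (2 * b) * of_int d = of_int (4 * N - T * T)"
      proof -
        have "Im z * Im z = of_rat b * of_rat b * (sqrt (of_int d) * sqrt (of_int d))" unfolding Imz by (simp only: mult_ac)
        also have "sqrt (of_int d) * sqrt (of_int d) = of_int d" using d by simp
        finally have "(of_rat b * of_rat b * of_int d :: real) = of_int N - Re z * Re z" using N by simp
        hence "4 * (of_rat b * of_rat b * of_int d :: real) = 4 * of_int N - (2 * Re z) * (2 * Re z)" by simp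
        hence "(of_rat ((2 * b) * (2 * b) * of_int d) :: real) = of_rat (of_int (4 * N - T * T))"
          unfolding ReT by (simp add: of_rat_mult of_rat_diff)
        thus ?thesis by (simp only: of_rat_eq_iff)
      qed
      obtain s t where st: "2 * b = of_int s / (of_int t :: rat)" "t > 0" "coprime s t"
        using quotient_of_div[of "2 * b"] quotient_of_denom_pos[of "2 * b"] quotient_of_coprime[of "2 * b"] by (metis surj_pair)
      have "(of_int (s * s * d) :: rat) = of_int ((4 * N - T * T) * (t * t))"
        using bN st(2) unfolding st(1) by (simp add: field_simps)
      hence "s * s * d = (4 * N - T * T) * (t * t)" by (simp only: of_int_eq_iff)
      hence "t ^ 2 dvd s ^ 2 * d" by (simp add: power2_eq_square)
      moreover have "coprime (t ^ 2) (s ^ 2)" using st(3) by (simp add: coprime_commute)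
      ultimately have "t ^ 2 dvd d" by (simp add: coprime_dvd_mult_right_iff)
      hence "t dvd 1" by (rule squarefreeD[OF d(2)])
      hence "t = 1" using st(2) by (simp add: zdvd1_eq)
      hence bs: "2 * b = of_int s" using st(1) by simp
      have "(of_int (s * s * d) :: rat) = of_int (4 * N - T * T)" using bN unfolding bs by simp
      hence "s * s * d = 4 * N - T * T" by (simp only: of_int_eq_iff)
      hence "(T * T + s * s * d) mod 4 = 0" by simp
      thus ?thesis using aT bs by (intro exI[of _ T] exI[of _ s] conjI)
    qed
    then obtain T r :: int where Tr: "2 * a = of_int T" "2 * b = of_int r" "(T * T + r * r * d) mod 4 = 0"
      by (elim exE conjE) (rule that)
    have ab: "a = of_int T / 2" "b = of_int r / 2" using Tr(1,2) by simp_all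
    have "z = (of_int T + of_int r * \<eta>) / 2" unfolding z ab by (simp add: of_rat_divide add_divide_distrib)
    thus "\<exists>T r :: int. z = (of_int T + of_int r * (\<i> * of_real (sqrt (of_int d)))) / 2 \<and> (T * T + r * r * d) mod 4 = 0"
      using Tr(3) unfolding \<eta>_def by (intro exI[of _ T] exI[of _ r] conjI)
  }
qed

context quadratic_integers
begin

text \<open>
  Two integral bases are related by integer matrices that are inverse to each other, so their
  determinant is \<open>1\<close> or \<open>-1\<close> and the squared determinant of the embeddings is the same for both. The value
  for the basis \<open>(1, \<omega>)\<close> is \<open>- (2 * Im \<omega>)\<^sup>2\<close>.
\<close>
lemma discriminant_unique:
  assumes D: "of_int D = - (complex_of_real ((2 * Im \<omega>) ^ 2))"
  shows "discriminant K = D"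
proof -
  define B where "B = (\<lambda>D::int. \<exists>b c. ring_of_integers K = {of_int m * b + of_int n * c | m n :: int. True} \<and>
     of_int D = (b * cnj c - c * cnj b)\<^sup>2)"
  have cross: "(1 * cnj \<omega> - \<omega> * cnj 1) ^ 2 = - (complex_of_real ((2 * Im \<omega>) ^ 2))"
    by (simp add: complex_eq_iff power2_eq_square)
  have cross0: "1 * cnj \<omega> - \<omega> * cnj 1 \<noteq> 0" using Im_pos by (auto simp: complex_eq_iff)
  have uniq: "of_int D = - (complex_of_real ((2 * Im \<omega>) ^ 2))" if "B D" for D
  proof -
    note \<open>B D\<close>
    obtain b c where bc: "\<O> = {of_int m * b + of_int n * c | m n :: int. True}" "of_int D = (b * cnj c - c * cnj b)\<^sup>2"
      using \<open>B D\<close> unfolding B_def ring_of_integers_eq by (elim exE conjE) (rule that)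
    have "b = of_int 1 * b + of_int 0 * c" "c = of_int 0 * b + of_int 1 * c" by simp_all
    hence "b \<in> \<O>" "c \<in> \<O>" unfolding bc(1) by blast+
    then obtain m n k l where mn: "b = of_int m + of_int n * \<omega>" "c = of_int k + of_int l * \<omega>"
      using OE[of b] OE[of c] by metis
    have "1 \<in> \<O>" "\<omega> \<in> \<O>" by simp_all
    then obtain m' n' k' l' :: int where mn': "1 = of_int m' * b + of_int n' * c" "\<omega> = of_int k' * b + of_int l' * c"
      unfolding bc(1) by blast
    have cnj_mn': "cnj 1 = of_int m' * cnj b + of_int n' * cnj c" "cnj \<omega> = of_int k' * cnj b + of_int l' * cnj c"
      using arg_cong[OF mn'(1), of cnj] arg_cong[OF mn'(2), of cnj] by simp_all
    let ?X = "1 * cnj \<omega> - \<omega> * cnj 1" and ?Y = "b * cnj c - c * cnj b"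
    have Y: "?Y = of_int (m * l - n * k) * ?X" unfolding mn by (simp add: algebra_simps)
    have X: "?X = of_int (m' * l' - n' * k') * ?Y"
    proof -
      have "?X = (of_int m' * b + of_int n' * c) * (of_int k' * cnj b + of_int l' * cnj c) -
        (of_int k' * b + of_int l' * c) * (of_int m' * cnj b + of_int n' * cnj c)"
        by (simp only: mn'[symmetric] cnj_mn'[symmetric])
      also have "\<dots> = of_int (m' * l' - n' * k') * ?Y" by (simp add: algebra_simps)
      finally show ?thesis .
    qed
    have "?X = of_int ((m' * l' - n' * k') * (m * l - n * k)) * ?X"
      using X unfolding Y of_int_mult mult.assoc .
    hence "of_int ((m' * l' - n' * k') * (m * l - n * k)) = (1 :: complex)"
      using cross0 by (metis mult_cancel_right1 mult.commute)
    hence "(m' * l' - n' * k') * (m * l - n * k) = 1" using of_int_eq_1_iff by blast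
    hence "m * l - n * k = 1 \<or> m * l - n * k = - 1" by (metis mult.commute zmult_eq_1_iff)
    hence unit: "(m * l - n * k) ^ 2 = 1" by (elim disjE) simp_all
    have "?Y ^ 2 = of_int ((m * l - n * k) ^ 2) * ?X ^ 2" unfolding Y power_mult_distrib of_int_power by (rule refl)
    hence "?Y ^ 2 = ?X ^ 2" unfolding unit by simp
    thus ?thesis unfolding bc(2) cross by simp
  qed
  have exB: "B D" if "of_int D = - (complex_of_real ((2 * Im \<omega>) ^ 2))" for D
  proof -
    have "\<O> = {of_int m * 1 + of_int n * \<omega> | m n :: int. True}"
      unfolding \<O>_def emb_def by (auto simp: image_def)
    thus ?thesis unfolding B_def ring_of_integers_eq using that cross by metis
  qed
  have the: "discriminant K = D" if "B D" for D
    unfolding discriminant_def B_def[symmetric]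
    using that uniq by (intro the_equality) (metis of_int_eq_iff)+
  show ?thesis by (rule the[OF exB[OF D]])
qed

end

lemma imaginary_quadratic_field_lattice:
  assumes K: "imaginary_quadratic_field K"
  obtains \<tau> \<nu> where "quadratic_integers (omega K) \<tau> \<nu> K" "discriminant K \<noteq> 0"
    "(Re (omega K) = 0 \<and> Im (omega K) \<ge> 1) \<or> (Re (omega K) = 1 / 2 \<and> Im (omega K) \<ge> sqrt 3 / 2)"
proof -
  obtain d :: int where d: "d > 0" "squarefree d"
    and Kd: "K = {of_rat a + of_rat b * (\<i> * of_real (sqrt (of_int d))) | a b. True}"
    using imaginary_quadratic_field_generator[OF K] by blast
  define \<eta> where "\<eta> = \<i> * complex_of_real (sqrt (of_int d))"
  have sq: "sqrt (of_int d) * sqrt (of_int d) = of_int d" using d by simp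
  have absd: "\<bar>real_of_int d\<bar> = real_of_int d" by (rule abs_of_pos) (simp add: d(1))
  have sd: "sqrt (of_int d) > 0" "sqrt (of_int d) \<ge> 1" using d by simp_all
  have eta2: "\<eta> * \<eta> = - of_int d"
  proof -
    have "\<eta> * \<eta> = (\<i> * \<i>) * of_real (sqrt (of_int d) * sqrt (of_int d))"
      by (simp only: \<eta>_def of_real_mult mult_ac)
    thus ?thesis unfolding sq by simp
  qed
  have d4: "d mod 4 \<noteq> 0"
  proof
    assume "d mod 4 = 0"
    hence "2 ^ 2 dvd d" by (simp add: mod_eq_0_iff_dvd)
    hence "(2::int) dvd 1" by (rule squarefreeD[OF d(2)])
    thus False by simp
  qed
  note char = ring_of_integers_characterization[OF d Kd, folded \<eta>_def, unfolded quadratic_mod_4[OF d4]]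
  show ?thesis
  proof (cases "d mod 4 = 3")
    case True
    then obtain n where n: "d = 4 * n + 3" by (metis mod_mult_div_eq mult.commute add.commute)
    define w where "w = (1 + \<eta>) / 2"
    have Rew: "Re w = 1 / 2" "Im w = sqrt (of_int d) / 2" by (simp_all add: w_def \<eta>_def)
    have w2: "w * w = of_int 1 * w - of_int (n + 1)"
    proof -
      have "w * w = (1 + 2 * \<eta> + \<eta> * \<eta>) / 4" unfolding w_def by (simp add: field_simps)
      also have "\<dots> = of_int 1 * w - of_int (n + 1)" unfolding eta2 unfolding w_def n by (simp add: field_simps)
      finally show ?thesis .
    qed
    interpret quadratic_lattice w 1 "n + 1" by unfold_locales (simp add: Rew d, rule w2)
    have "ring_of_integers K = \<O>"
    proof (intro set_eqI iffI)
      fix z assume "z \<in> ring_of_integers K"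
      then obtain T r :: int where z: "z = (of_int T + of_int r * \<eta>) / 2" "even (T - r)" unfolding char using True by auto
      then obtain m where "T = r + 2 * m" by (metis dvd_def diff_eq_eq add.commute)
      hence "z = of_int m + of_int r * w" unfolding z(1) w_def by (simp add: field_simps)
      thus "z \<in> \<O>" by (rule OI)
    next
      fix z assume "z \<in> \<O>"
      then obtain m r where "z = of_int m + of_int r * w" by (rule OE)
      hence "z = (of_int (2 * m + r) + of_int r * \<eta>) / 2" unfolding w_def by (simp add: field_simps)
      thus "z \<in> ring_of_integers K" unfolding char using True by (intro exI[of _ "2 * m + r"] exI[of _ r]) simp
    qed
    then interpret quadratic_integers w 1 "n + 1" K by unfold_locales
    have D: "discriminant K = - d"
    proof (rule discriminant_unique)
      have "(2 * Im w) ^ 2 = of_int d" unfolding Rew by (simp add: power2_eq_square absd)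
      thus "of_int (- d) = - complex_of_real ((2 * Im w) ^ 2)" by simp
    qed
    have "(- d) mod 4 \<noteq> 0" using d4 by presburger
    hence om: "omega K = w" unfolding omega_def Let_def D w_def \<eta>_def by (simp add: absd)
    have "n \<ge> 0" using d n by presburger
    hence "sqrt 3 \<le> sqrt (of_int d)" unfolding n by simp
    hence "Im w \<ge> sqrt 3 / 2" unfolding Rew by simp
    thus ?thesis using that[of 1 "n + 1"] quadratic_integers_axioms Rew D d unfolding om by simp
  next
    case False
    interpret quadratic_lattice \<eta> 0 d by unfold_locales (use sd eta2 in \<open>simp_all add: \<eta>_def\<close>)
    have "ring_of_integers K = \<O>"
    proof (intro set_eqI iffI)
      fix z assume "z \<in> ring_of_integers K"
      then obtain T r :: int where z: "z = (of_int T + of_int r * \<eta>) / 2" "even T" "even r" unfolding char using False by auto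
      then obtain m k where "T = 2 * m" "r = 2 * k" by blast
      hence "z = of_int m + of_int k * \<eta>" unfolding z(1) by (simp add: field_simps)
      thus "z \<in> \<O>" by (rule OI)
    next
      fix z assume "z \<in> \<O>"
      then obtain m k where "z = of_int m + of_int k * \<eta>" by (rule OE)
      hence "z = (of_int (2 * m) + of_int (2 * k) * \<eta>) / 2" by (simp add: field_simps)
      thus "z \<in> ring_of_integers K" unfolding char using False by (intro exI[of _ "2 * m"] exI[of _ "2 * k"]) simp
    qed
    then interpret quadratic_integers \<eta> 0 d K by unfold_locales
    have D: "discriminant K = - (4 * d)"
    proof (rule discriminant_unique)
      have "(2 * Im \<eta>) ^ 2 = 4 * of_int d" by (simp add: \<eta>_def power2_eq_square absd)
      thus "of_int (- (4 * d)) = - complex_of_real ((2 * Im \<eta>) ^ 2)" by simp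
    qed
    have om: "omega K = \<eta>"
      unfolding omega_def Let_def D \<eta>_def by (simp add: abs_mult real_sqrt_mult absd)
    have "Re \<eta> = 0" "Im \<eta> \<ge> 1" using sd by (simp_all add: \<eta>_def)
    thus ?thesis using that[of 0 d] quadratic_integers_axioms D d unfolding om by simp
  qed
qed

section \<open>The estimate of the tail\<close>

context quadratic_integers
begin

definition standard_generator :: bool
  where "standard_generator \<longleftrightarrow> (Re \<omega> = 0 \<and> Im \<omega> \<ge> 1) \<or> (Re \<omega> = 1 / 2 \<and> Im \<omega> \<ge> sqrt 3 / 2)"

lemma norm_omega_sq: "(cmod \<omega>) ^ 2 = (Re \<omega>) ^ 2 + (Im \<omega>) ^ 2" by (rule cmod_power2)

lemma standard_generator_norm:
  assumes "standard_generator"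
  shows "cmod \<omega> \<ge> 1" "1 / 4 + (Im \<omega>) ^ 2 / 4 \<le> (cmod \<omega>) ^ 2"
proof -
  have s: "(sqrt 3 / 2) ^ 2 = (3 / 4 :: real)" by (simp add: power_divide)
  have "(cmod \<omega>) ^ 2 \<ge> 1 \<and> 1 / 4 + (Im \<omega>) ^ 2 / 4 \<le> (cmod \<omega>) ^ 2"
    using assms unfolding standard_generator_def
  proof
    assume a: "Re \<omega> = 0 \<and> Im \<omega> \<ge> 1"
    hence "(Im \<omega>) ^ 2 \<ge> 1 ^ 2" by (intro power_mono) auto
    hence "(Im \<omega>) ^ 2 \<ge> 1" by simp
    moreover have "(Re \<omega>) ^ 2 = 0" using a by simp
    ultimately show ?thesis unfolding norm_omega_sq by linarith
  next
    assume a: "Re \<omega> = 1 / 2 \<and> Im \<omega> \<ge> sqrt 3 / 2"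
    hence "(Im \<omega>) ^ 2 \<ge> (sqrt 3 / 2) ^ 2" by (intro power_mono) auto
    hence "(Im \<omega>) ^ 2 \<ge> 3 / 4" unfolding s .
    moreover have "(Re \<omega>) ^ 2 = 1 / 4" unfolding conjunct1[OF a] by (simp add: power2_eq_square)
    ultimately show ?thesis unfolding norm_omega_sq by linarith
  qed
  thus "cmod \<omega> \<ge> 1" "1 / 4 + (Im \<omega>) ^ 2 / 4 \<le> (cmod \<omega>) ^ 2" by (simp_all add: power2_nonneg_ge_1_iff)
qed

text \<open>
  The point is first reduced modulo the lattice to \<open>w\<close> in the rectangle \<open>|Re w| \<le> 1 / 2\<close>,
  \<open>|Im w| \<le> h / 2\<close> with \<open>h = Im \<omega>\<close>, which lies in the disc of radius \<open>|\<omega>|\<close>. If \<open>w\<close> is closer than \<open>1 / 4\<close> to the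
  origin, a neighbouring lattice point replaces the origin, chosen on the side of \<open>w\<close> so that the
  distance does not exceed \<open>|\<omega>|\<close>.
\<close>
lemma lattice_point_in_annulus:
  assumes "standard_generator"
  shows "\<exists>q\<in>\<O>. 1 / 4 \<le> cmod (z - q) \<and> cmod (z - q) \<le> cmod \<omega>"
proof -
  have h34: "Im \<omega> \<ge> 3 / 4"
  proof -
    have "sqrt 3 / 2 \<ge> (3 / 4 :: real)" by (rule power2_le_imp_le) (simp_all add: power_divide)
    thus ?thesis using assms unfolding standard_generator_def by linarith
  qed
  define h where "h = Im \<omega>"
  define n where "n = \<lfloor>Im z / h + 1 / 2\<rfloor>"
  define z1 where "z1 = z - of_int n * \<omega>"
  define m where "m = \<lfloor>Re z1 + 1 / 2\<rfloor>"
  define w where "w = z1 - of_int m"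
  have hpos: "h > 0" using Im_pos by (simp add: h_def)
  have wO: "z - w \<in> \<O>" unfolding w_def z1_def by (rule OI[of _ m n]) simp
  have Rew: "\<bar>Re w\<bar> \<le> 1 / 2" 
  proof -
    have "Re w = Re z1 - of_int \<lfloor>Re z1 + 1 / 2\<rfloor>" unfolding w_def m_def by simp
    thus ?thesis by linarith
  qed
  have Imw: "\<bar>Im w\<bar> \<le> h / 2"
  proof -
    have "Im w = h * (Im z / h - of_int n)" using hpos unfolding w_def z1_def h_def by (simp add: field_simps)
    moreover have "\<bar>Im z / h - of_int n\<bar> \<le> 1 / 2" unfolding n_def by linarith
    ultimately have "\<bar>Im w\<bar> \<le> h * (1 / 2)" using hpos by (simp add: abs_mult)
    thus ?thesis by simp
  qed
  have shift: "\<exists>q\<in>\<O>. 1 / 4 \<le> cmod (z - q) \<and> cmod (z - q) \<le> cmod \<omega>" if "c \<in> \<O>" "1 / 4 \<le> cmod (w - c)" "cmod (w - c) \<le> cmod \<omega>" for c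
  proof -
    have "(z - w) + c \<in> \<O>" by (intro O_add wO that)
    moreover have "z - ((z - w) + c) = w - c" by simp
    ultimately show ?thesis using that(2,3) by metis
  qed
  note ub = power2_le_imp_le[OF _ norm_ge_zero]
  show ?thesis
  proof (cases "1 / 4 \<le> cmod w")
    case True
    have "(cmod w) ^ 2 \<le> (1 / 2) ^ 2 + (h / 2) ^ 2"
      unfolding cmod_power2 using Rew Imw hpos by (intro add_mono) (simp_all add: abs_le_square_iff[symmetric])
    also have "\<dots> \<le> (cmod \<omega>) ^ 2"
      using standard_generator_norm(2)[OF assms] by (simp add: h_def power_divide power2_eq_square)
    finally have "cmod w \<le> cmod \<omega>" by (rule ub)
    thus ?thesis using shift[of 0] True by simp
  next
    case False
    define a b where "a = \<bar>Re w\<bar>" and "b = \<bar>Im w\<bar>"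
    \<comment> \<open>The signs reduce the choice of the neighbour to \<open>w = a + b * \<i>\<close> in the first quadrant.\<close>
    define \<sigma> \<epsilon> :: int where "\<sigma> = (if Re w \<ge> 0 then 1 else - 1)" and "\<epsilon> = (if Im w \<ge> 0 then 1 else - 1)"
    have ab: "0 \<le> a" "0 \<le> b" "a < 1 / 4" "b < 1 / 4"
      using False abs_Re_le_cmod[of w] abs_Im_le_cmod[of w] unfolding a_def b_def by linarith+
    have sa: "Re w = of_int \<sigma> * a" "Im w = of_int \<epsilon> * b" unfolding a_def b_def \<sigma>_def \<epsilon>_def by auto
    have sq: "of_int \<sigma> * of_int \<sigma> = (1 :: real)" "of_int \<epsilon> * of_int \<epsilon> = (1 :: real)" unfolding \<sigma>_def \<epsilon>_def by auto
    have nrm: "(cmod (w - c)) ^ 2 = (a - x) ^ 2 + (b - y) ^ 2" if "Re c = of_int \<sigma> * x" "Im c = of_int \<epsilon> * y" for c x y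
    proof -
      have "(cmod (w - c)) ^ 2 = (of_int \<sigma> * of_int \<sigma>) * (a - x) ^ 2 + (of_int \<epsilon> * of_int \<epsilon>) * (b - y) ^ 2"
        unfolding cmod_power2 minus_complex.sel sa that by (simp add: power2_eq_square algebra_simps)
      thus ?thesis unfolding sq by simp
    qed
    have low: "1 / 4 \<le> cmod (w - c)" if "Im c = of_int \<epsilon> * y" "y \<ge> 3 / 4" for c y
    proof -
      have "Im (w - c) = of_int \<epsilon> * (b - y)" using that(1) sa by (simp add: algebra_simps)
      hence "\<bar>Im (w - c)\<bar> = \<bar>b - y\<bar>" unfolding \<epsilon>_def by auto
      thus ?thesis using abs_Im_le_cmod[of "w - c"] ab that(2) by linarith
    qed
    \<comment> \<open>The neighbour is \<open>\<omega>\<close> or \<open>1\<close> in a rectangular lattice, according to the direction in which \<open>w\<close> is further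
  from the origin; otherwise it is \<open>\<omega>\<close> itself, above the middle of the unit interval.\<close>
    consider (rect) "Re \<omega> = 0" "h \<ge> 1" "a \<le> b" | (rect') "Re \<omega> = 0" "h \<ge> 1" "b \<le> a" | (tri) "Re \<omega> = 1 / 2"
      using assms unfolding standard_generator_def h_def by linarith
    thus ?thesis
    proof cases
      case rect
      define c where "c = of_int \<epsilon> * \<omega>"
      have c: "Re c = of_int \<sigma> * 0" "Im c = of_int \<epsilon> * h" unfolding c_def h_def using rect by simp_all
      have "c \<in> \<O>" unfolding c_def by (intro O_mult O_of_int O_omega)
      moreover have "1 / 4 \<le> cmod (w - c)" by (rule low[OF c(2)]) (use rect in simp)
      moreover have "cmod (w - c) \<le> cmod \<omega>"
      proof (rule ub)
        have "a * a \<le> b * b" using rect(3) ab by (intro mult_mono) auto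
        moreover have "b * b \<le> b * (1 / 4)" using ab by (intro mult_left_mono) auto
        moreover have "b * 1 \<le> b * h" using ab rect by (intro mult_left_mono) auto
        ultimately have "a * a + b * b \<le> 2 * (b * h)" using ab by linarith
        thus "(cmod (w - c)) ^ 2 \<le> (cmod \<omega>) ^ 2"
          unfolding nrm[OF c] norm_omega_sq h_def[symmetric] rect(1) by (simp add: power2_eq_square algebra_simps)
      qed
      ultimately show ?thesis by (rule shift)
    next
      case rect'
      define c :: complex where "c = of_int \<sigma>"
      have c: "Re c = of_int \<sigma> * 1" "Im c = of_int \<epsilon> * 0" unfolding c_def by simp_all
      have "c \<in> \<O>" unfolding c_def by (rule O_of_int)
      moreover have "1 / 4 \<le> cmod (w - c)"
      proof -
        have "Re (w - c) = of_int \<sigma> * (a - 1)" using c sa by (simp add: algebra_simps)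
        hence "\<bar>Re (w - c)\<bar> = \<bar>a - 1\<bar>" unfolding \<sigma>_def by auto
        thus ?thesis using abs_Re_le_cmod[of "w - c"] ab by linarith
      qed
      moreover have "cmod (w - c) \<le> cmod \<omega>"
      proof (rule ub)
        have "b * b \<le> a * a" using rect'(3) ab by (intro mult_mono) auto
        moreover have "a * a \<le> a * (1 / 4)" using ab by (intro mult_left_mono) auto
        ultimately have "a * a + b * b \<le> 2 * a" using ab by linarith
        moreover have "1 * 1 \<le> h * h" using rect' by (intro mult_mono) auto
        ultimately show "(cmod (w - c)) ^ 2 \<le> (cmod \<omega>) ^ 2"
          unfolding nrm[OF c] norm_omega_sq h_def[symmetric] rect'(1) by (simp add: power2_eq_square algebra_simps)
      qed
      ultimately show ?thesis by (rule shift)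
    next
      case tri
      define c where "c = (if \<sigma> = \<epsilon> then of_int \<epsilon> * \<omega> else of_int \<epsilon> * (\<omega> - 1))"
      have se: "\<sigma> = \<epsilon> \<or> \<sigma> = - \<epsilon>" unfolding \<sigma>_def \<epsilon>_def by auto
      have "Re c = (if \<sigma> = \<epsilon> then of_int \<epsilon> * Re \<omega> else of_int \<epsilon> * (Re \<omega> - 1))" unfolding c_def by simp
      hence c1: "Re c = of_int \<sigma> * (1 / 2)" unfolding tri using se by auto
      have c2: "Im c = of_int \<epsilon> * h" unfolding c_def h_def by simp
      note c = c1 c2
      have "c \<in> \<O>" unfolding c_def by (auto intro!: O_mult O_diff)
      moreover have "1 / 4 \<le> cmod (w - c)" by (rule low[OF c(2)]) (use h34 in \<open>simp add: h_def\<close>)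
      moreover have "cmod (w - c) \<le> cmod \<omega>"
      proof (rule ub)
        have "(a - 1 / 2) ^ 2 \<le> (1 / 2) ^ 2" using ab by (simp only: abs_le_square_iff[symmetric])
        moreover have "(b - h) ^ 2 \<le> h ^ 2" using ab h34 unfolding h_def by (simp only: abs_le_square_iff[symmetric])
        ultimately show "(cmod (w - c)) ^ 2 \<le> (cmod \<omega>) ^ 2"
          unfolding nrm[OF c] norm_omega_sq h_def[symmetric] tri by linarith
      qed
      ultimately show ?thesis by (rule shift)
    qed
  qed
qed

text \<open>
  With \<open>u = exp (s / 2)\<close>, the annuli for \<open>P = 1\<close> are centred at all lattice points and have radii \<open>u\<^sup>2 / d\<close>
  and \<open>u\<close>. If \<open>u \<le> 4 * |\<omega>|\<close>, then the hypothesis on \<open>d\<close> makes the inner radius at most \<open>1 / 4\<close>, and a lattice point in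
  the annulus of radii \<open>1 / 4\<close> and \<open>|\<omega>|\<close> serves. For larger \<open>u\<close> the annulus has width at least
  \<open>2 * |\<omega>|\<close>, so the annulus about \<open>z\<close> contains a disc of radius \<open>|\<omega>|\<close> and hence a lattice point. The
  width condition \<open>u * (d - u) \<ge> 2 * |\<omega>| * d\<close> holds because both factors are at least \<open>4 * |\<omega>|\<close> and
  the larger one is at least \<open>d / 2\<close>.
\<close>
lemma uncovered_empty:
  assumes gen: "standard_generator" and d: "d \<ge> 64 * (cmod \<omega>) ^ 2"
    and s: "2 * ln (cmod \<omega>) \<le> s" "s \<le> 2 * ln (d - 4 * cmod \<omega>)"
  shows "uncovered d (exp (- s / 2)) = {}"
proof -
  define R where "R = cmod \<omega>"
  define u where "u = exp (s / 2)"
  have R: "R \<ge> 1" "d \<ge> 64 * R ^ 2" using standard_generator_norm(1)[OF gen] d by (simp_all add: R_def)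
  have RR: "R \<le> R ^ 2" using R(1) by (simp add: power2_eq_square)
  have dR: "d \<ge> 64 * R" using R(2) RR by linarith
  have d0: "d > 0" using dR R(1) by linarith
  have uR: "R \<le> u"
  proof -
    have "ln R \<le> s / 2" using s(1) by (simp add: R_def)
    hence "exp (ln R) \<le> exp (s / 2)" by (simp only: exp_le_cancel_iff)
    thus ?thesis using R(1) by (simp add: u_def)
  qed
  have ud: "u \<le> d - 4 * R"
  proof -
    have "d - 4 * R > 0" using dR R(1) by linarith
    moreover have "s / 2 \<le> ln (d - 4 * R)" using s(2) by (simp add: R_def)
    hence "exp (s / 2) \<le> exp (ln (d - 4 * R))" by (simp only: exp_le_cancel_iff)
    ultimately show ?thesis by (simp add: u_def)
  qed
  have rho: "exp (- s / 2) = 1 / u" by (simp add: u_def exp_minus inverse_eq_divide)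
  have u0: "u > 0" by (simp add: u_def)
  have key: "\<exists>q\<in>\<O>. u ^ 2 / d \<le> cmod (z - q) \<and> cmod (z - q) \<le> u" for z
  proof (cases "u \<le> 4 * R")
    case True
    have "u ^ 2 \<le> (4 * R) ^ 2" using True u0 by (intro power_mono) auto
    also have "\<dots> \<le> 1 / 4 * d" using R(2) by (simp add: power2_eq_square)
    finally have "u ^ 2 / d \<le> 1 / 4" using d0 by (simp add: pos_divide_le_eq)
    moreover obtain q where "q \<in> \<O>" "1 / 4 \<le> cmod (z - q)" "cmod (z - q) \<le> R"
      using lattice_point_in_annulus[OF gen] unfolding R_def by blast
    ultimately show ?thesis using uR by (intro bexI[of _ q] conjI) linarith+
  next
    case False
    have width: "u ^ 2 / d + 2 * R \<le> u"
    proof -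
      have "u ^ 2 + 2 * R * d \<le> u * d"
      proof (cases "u \<le> d / 2")
        case True
        have "u * (d / 2) \<le> u * (d - u)" using True u0 by (intro mult_left_mono) auto
        moreover have "4 * R * (d / 2) \<le> u * (d / 2)" using False d0 by (intro mult_right_mono) auto
        ultimately show ?thesis by (simp add: power2_eq_square algebra_simps)
      next
        case False
        have "d / 2 * (4 * R) \<le> u * (d - u)" using False ud R(1) d0 by (intro mult_mono) auto
        thus ?thesis by (simp add: power2_eq_square algebra_simps)
      qed
      hence "(u ^ 2 + 2 * R * d) / d \<le> u" using d0 by (simp add: pos_divide_le_eq)
      thus ?thesis using d0 by (simp add: add_divide_distrib)
    qed
    \<comment> \<open>\<open>y\<close> is the centre of a disc of radius \<open>R\<close> that touches the inner circle of the annulus about \<open>z\<close>.\<close>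
    define y where "y = z + of_real (u ^ 2 / d + R)"
    obtain q where q: "q \<in> \<O>" "cmod (y - q) \<le> R"
      using lattice_point_in_annulus[OF gen, of y] unfolding R_def by blast
    have ry: "cmod (of_real (u ^ 2 / d + R)) = u ^ 2 / d + R"
    proof -
      have "u ^ 2 / d + R \<ge> 0" using d0 R(1) by simp
      thus ?thesis by (simp only: norm_of_real abs_of_nonneg)
    qed
    have "y - q = (z - q) + of_real (u ^ 2 / d + R)" unfolding y_def by simp
    hence eq: "z - q = (y - q) - of_real (u ^ 2 / d + R)" "of_real (u ^ 2 / d + R) = (y - q) - (z - q)" by simp_all
    have "cmod (z - q) \<le> cmod (y - q) + (u ^ 2 / d + R)"
      using norm_triangle_ineq4[of "y - q" "of_real (u ^ 2 / d + R)"] unfolding eq(1)[symmetric] ry .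
    moreover have "u ^ 2 / d + R \<le> cmod (y - q) + cmod (z - q)"
      using norm_triangle_ineq4[of "y - q" "z - q"] unfolding eq(2)[symmetric] ry .
    ultimately show ?thesis using q width by (intro bexI[OF _ q(1)]) linarith
  qed
  have "covered d (psi x * of_real (1 / u)) (of_real (1 / u))" for x
  proof -
    obtain q where q: "q \<in> \<O>" "u ^ 2 / d \<le> cmod (psi x - q)" "cmod (psi x - q) \<le> u" using key by blast
    define t where "t = cmod (psi x - q)"
    have "1 * (psi x * of_real (1 / u)) - q * of_real (1 / u) = (psi x - q) * of_real (1 / u)" by (simp add: algebra_simps)
    hence e: "cmod (1 * (psi x * of_real (1 / u)) - q * of_real (1 / u)) = t / u"
      using u0 by (simp only: norm_mult norm_of_real t_def) simp
    have e2: "cmod (of_real (1 / u) :: complex) = 1 / u" using u0 by (simp add: norm_divide)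
    have "t / u \<le> 1" using q(3) u0 by (simp add: t_def)
    moreover have "cmod 1 \<le> d * (1 / u) * (t / u)"
    proof -
      have "u ^ 2 \<le> t * d" using q(2) d0 by (simp add: t_def pos_divide_le_eq)
      hence "1 \<le> t * d / u ^ 2" using u0 by (subst pos_le_divide_eq) simp_all
      also have "t * d / u ^ 2 = d * (1 / u) * (t / u)" by (simp add: power2_eq_square)
      finally show ?thesis by simp
    qed
    moreover have "unimodular 1 q" unfolding unimodular_def
      by (rule bexI[OF _ O_1], rule bexI[OF _ O_0]) simp
    ultimately show ?thesis unfolding covered_def using q(1) e e2
      by (intro bexI[OF _ O_1] bexI[OF _ q(1)]) (simp only: e e2 not_False_eq_True one_neq_zero simp_thms)
  qed
  thus ?thesis unfolding rho uncovered_def by blast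
qed

text \<open>
  An annulus about \<open>Q / P\<close> is nonempty only if \<open>exp (s / 2) * |P| \<le> d\<close>, and \<open>|P| \<ge> 1\<close>.
\<close>
lemma uncovered_full:
  assumes d: "d > 0" and s: "2 * ln d < s"
  shows "uncovered d (exp (- s / 2)) = open_square"
proof -
  have "\<not> covered d (psi x * of_real (exp (- s / 2))) (of_real (exp (- s / 2)))" for x
  proof
    assume "covered d (psi x * of_real (exp (- s / 2))) (of_real (exp (- s / 2)))"
    then obtain P Q where PQ: "P \<in> \<O>" "P \<noteq> 0" "cmod (P * (psi x * of_real (exp (- s / 2))) - Q * of_real (exp (- s / 2))) \<le> 1"
      "cmod P \<le> d * cmod (of_real (exp (- s / 2))) * cmod (P * (psi x * of_real (exp (- s / 2))) - Q * of_real (exp (- s / 2)))"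
      unfolding covered_def by blast
    have "1 \<le> cmod P" using O_norm_ge_1 PQ(1,2) by blast
    also have "\<dots> \<le> d * exp (- s / 2) * 1" 
    proof -
      have "d * cmod (of_real (exp (- s / 2)) :: complex) * cmod (P * (psi x * of_real (exp (- s / 2))) - Q * of_real (exp (- s / 2)))
        \<le> d * cmod (of_real (exp (- s / 2)) :: complex) * 1" by (intro mult_left_mono PQ(3)) (use d in simp)
      thus ?thesis using PQ(4) by simp
    qed
    finally have "1 \<le> d * exp (- s / 2)" by simp
    moreover have "d * exp (- s / 2) < 1"
    proof -
      have "ln d < s / 2" using s by simp
      hence "exp (ln d) < exp (s / 2)" by (simp only: exp_less_cancel_iff)
      hence "d < exp (s / 2)" using d by simp
      thus ?thesis by (simp add: exp_minus field_simps)
    qed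
    ultimately show False by linarith
  qed
  thus ?thesis unfolding uncovered_def by auto
qed

definition uncovered_area :: "real \<Rightarrow> real \<Rightarrow> real"
  where "uncovered_area d s = measure lborel (uncovered d (exp (- s / 2)))"

lemma uncovered_le: "emeasure lborel (uncovered d \<rho>) \<le> 1"
proof -
  have "emeasure lborel (uncovered d \<rho>) \<le> emeasure lborel open_square"
    by (rule emeasure_mono) (use borel_open[OF open_open_square] in \<open>auto simp: uncovered_def\<close>)
  thus ?thesis by (simp only: emeasure_open_square)
qed

lemma uncovered_area_emeasure: "emeasure lborel (uncovered d (exp (- s / 2))) = ennreal (uncovered_area d s)"
  unfolding uncovered_area_def
  by (rule emeasure_eq_ennreal_measure) (use uncovered_le[of d "exp (- s / 2)"] in \<open>auto simp: top_unique\<close>)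

lemma uncovered_area_bounds: "0 \<le> uncovered_area d s" "uncovered_area d s \<le> 1"
proof -
  show "0 \<le> uncovered_area d s" by (simp add: uncovered_area_def)
  have "ennreal (uncovered_area d s) \<le> ennreal 1"
    using uncovered_le[of d "exp (- s / 2)"] unfolding uncovered_area_emeasure by simp
  thus "uncovered_area d s \<le> 1" by (subst (asm) ennreal_le_iff) simp_all
qed

lemma uncovered_area_borel: "uncovered_area d \<in> borel_measurable borel"
  unfolding uncovered_area_def measure_def by measurable

lemma exp_tail_integral:
  "(\<integral>\<^sup>+s. ennreal (2 * exp (- 2 * s)) * indicator {a<..} s \<partial>lborel) = ennreal (exp (- 2 * a))" if "a \<ge> 0"
proof -
  have "ennreal (exp (- 2 * a)) = emeasure (density lborel (exponential_density 2)) {a<..}"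
    unfolding exponential_tail using that by simp
  also have "\<dots> = (\<integral>\<^sup>+s. ennreal (exponential_density 2 s) * indicator {a<..} s \<partial>lborel)"
    by (intro emeasure_density) simp_all
  also have "\<dots> = (\<integral>\<^sup>+s. ennreal (2 * exp (- 2 * s)) * indicator {a<..} s \<partial>lborel)"
    using that by (intro nn_integral_cong) (auto simp: exponential_density_def indicator_def mult.commute)
  finally show ?thesis by simp
qed

lemma gap_tail_split:
  assumes L: "L \<ge> 0"
  shows "enn2real (gap_tail d) = 2 * (LBINT s:{0..L}. uncovered_area d s * exp (- 2 * s)) +
     enn2real (\<integral>\<^sup>+s. ennreal (2 * exp (- 2 * s) * uncovered_area d s) * indicator {L<..} s \<partial>lborel)"
    "(\<integral>\<^sup>+s. ennreal (2 * exp (- 2 * s) * uncovered_area d s) * indicator {L<..} s \<partial>lborel) \<le> 1"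
proof -
  have [measurable]: "uncovered_area d \<in> borel_measurable borel" by (rule uncovered_area_borel)
  define g where "g = (\<lambda>s. 2 * exp (- 2 * s) * uncovered_area d s)"
  have [measurable]: "g \<in> borel_measurable borel" unfolding g_def by measurable
  have g0: "g s \<ge> 0" for s using uncovered_area_bounds by (simp add: g_def)
  have "gap_tail d = (\<integral>\<^sup>+s. ennreal (g s) * indicator {0..} s \<partial>lborel)"
    unfolding gap_tail_def uncovered_area_emeasure
  proof (intro nn_integral_cong)
    fix s
    have "ennreal (exponential_density 2 s) * ennreal (uncovered_area d s) = ennreal (exponential_density 2 s * uncovered_area d s)"
      by (rule ennreal_mult[symmetric]) (simp_all add: exponential_density_nonneg uncovered_area_bounds)
    thus "ennreal (exponential_density 2 s) * ennreal (uncovered_area d s) = ennreal (g s) * indicator {0..} s"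
      by (auto simp: g_def exponential_density_def indicator_def mult_ac)
  qed
  also have "\<dots> = (\<integral>\<^sup>+s. ennreal (g s) * indicator {0..L} s + ennreal (g s) * indicator {L<..} s \<partial>lborel)"
    using L by (intro nn_integral_cong) (auto simp: indicator_def)
  also have "\<dots> = (\<integral>\<^sup>+s. ennreal (g s) * indicator {0..L} s \<partial>lborel) + (\<integral>\<^sup>+s. ennreal (g s) * indicator {L<..} s \<partial>lborel)"
    by (rule nn_integral_add) measurable
  finally have sum: "gap_tail d = (\<integral>\<^sup>+s. ennreal (g s) * indicator {0..L} s \<partial>lborel) + (\<integral>\<^sup>+s. ennreal (g s) * indicator {L<..} s \<partial>lborel)" .
  have "(\<integral>\<^sup>+s. ennreal (g s) * indicator {L<..} s \<partial>lborel) \<le> (\<integral>\<^sup>+s. ennreal (2 * exp (- 2 * s)) * indicator {L<..} s \<partial>lborel)"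
    using uncovered_area_bounds by (intro nn_integral_mono mult_right_mono ennreal_leI) (simp_all add: g_def)
  also have "\<dots> = ennreal (exp (- 2 * L))" by (rule exp_tail_integral[OF L])
  also have "\<dots> \<le> 1" using L by simp
  finally have le1: "(\<integral>\<^sup>+s. ennreal (g s) * indicator {L<..} s \<partial>lborel) \<le> 1" .
  thus "(\<integral>\<^sup>+s. ennreal (2 * exp (- 2 * s) * uncovered_area d s) * indicator {L<..} s \<partial>lborel) \<le> 1"
    unfolding g_def .
  have gi: "\<bar>indicator {0..L} s * g s\<bar> \<le> 2" for s
  proof (cases "s \<in> {0..L}")
    case True
    hence "2 * exp (- 2 * s) * uncovered_area d s \<le> 2 * 1 * 1"
      using uncovered_area_bounds by (intro mult_mono) auto
    thus ?thesis using True g0[of s] by (simp add: g_def)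
  qed simp
  have int: "integrable lborel (\<lambda>s. indicator {0..L} s * g s)"
  proof (rule Bochner_Integration.integrable_bound[of lborel "\<lambda>s. 2 * indicator {0..L} s :: real"])
    show "integrable lborel (\<lambda>s. 2 * indicator {0..L} s :: real)"
      by (intro integrable_mult_right integrable_real_indicator) (simp_all add: L)
    show "AE s in lborel. norm (indicator {0..L} s * g s) \<le> norm (2 * indicator {0..L} s :: real)"
    proof (rule AE_I2)
      fix s
      show "norm (indicator {0..L} s * g s) \<le> norm (2 * indicator {0..L} s :: real)"
        using gi[of s] by (cases "s \<in> {0..L}") simp_all
    qed
  qed measurable
  have "(\<integral>\<^sup>+s. ennreal (g s) * indicator {0..L} s \<partial>lborel) = (\<integral>\<^sup>+s. ennreal (indicator {0..L} s * g s) \<partial>lborel)"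
    by (intro nn_integral_cong) (auto simp: indicator_def)
  also have "\<dots> = ennreal (\<integral>s. indicator {0..L} s * g s \<partial>lborel)"
    by (rule nn_integral_eq_integral[OF int]) (use g0 in auto)
  also have "(\<integral>s. indicator {0..L} s * g s \<partial>lborel) = 2 * (LBINT s:{0..L}. uncovered_area d s * exp (- 2 * s))"
  proof -
    have "(\<integral>s. indicator {0..L} s * g s \<partial>lborel) = (\<integral>s. 2 * (indicator {0..L} s *\<^sub>R (uncovered_area d s * exp (- 2 * s))) \<partial>lborel)"
      by (intro Bochner_Integration.integral_cong) (simp_all add: g_def mult_ac)
    thus ?thesis unfolding set_lebesgue_integral_def by simp
  qed
  finally have first: "(\<integral>\<^sup>+s. ennreal (g s) * indicator {0..L} s \<partial>lborel) = ennreal (2 * (LBINT s:{0..L}. uncovered_area d s * exp (- 2 * s)))" .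
  have nonneg: "0 \<le> (LBINT s:{0..L}. uncovered_area d s * exp (- 2 * s))"
    unfolding set_lebesgue_integral_def
    by (intro Bochner_Integration.integral_nonneg) (use uncovered_area_bounds in simp)
  show "enn2real (gap_tail d) = 2 * (LBINT s:{0..L}. uncovered_area d s * exp (- 2 * s)) +
     enn2real (\<integral>\<^sup>+s. ennreal (2 * exp (- 2 * s) * uncovered_area d s) * indicator {L<..} s \<partial>lborel)"
  proof -
    have "(\<integral>\<^sup>+s. ennreal (g s) * indicator {L<..} s \<partial>lborel) < \<top>"
      using le1 ennreal_one_less_top by (rule le_less_trans)
    hence "enn2real (gap_tail d) = 2 * (LBINT s:{0..L}. uncovered_area d s * exp (- 2 * s)) +
       enn2real (\<integral>\<^sup>+s. ennreal (g s) * indicator {L<..} s \<partial>lborel)"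
      unfolding sum first using nonneg by (subst enn2real_plus) simp_all
    thus ?thesis unfolding g_def .
  qed
qed

text \<open>
  Beyond \<open>2 * ln |\<omega>|\<close> the uncovered area is \<open>1\<close> for \<open>s > 2 * ln d\<close> and \<open>0\<close> up to \<open>2 * ln (d - 4 * |\<omega>|)\<close>. The
  tail integral therefore lies between \<open>1 / d\<^sup>4\<close> and \<open>1 / (d - 4 * |\<omega>|)\<^sup>4\<close>, and
  \<open>1 / (1 - y)\<^sup>4 \<le> 1 + 8 * y\<close> for \<open>y = 4 * |\<omega>| / d \<le> 1 / 16\<close> gives the constant \<open>8 * 4 = 32\<close>.
\<close>
lemma gap_tail_estimate:
  assumes gen: "standard_generator" and d: "d \<ge> 64 * (cmod \<omega>) ^ 2"
  defines "E \<equiv> enn2real (gap_tail d) - 2 * (LBINT s:{0..2 * ln (cmod \<omega>)}. uncovered_area d s * exp (- 2 * s))"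
  shows "1 / d ^ 4 \<le> E" "E \<le> 1 / d ^ 4 + 32 * (cmod \<omega> / d ^ 5)"
proof -
  define R where "R = cmod \<omega>"
  define L where "L = 2 * ln R"
  have R: "R \<ge> 1" "d \<ge> 64 * R ^ 2" using standard_generator_norm(1)[OF gen] d by (simp_all add: R_def)
  have RR: "R \<le> R ^ 2" using R(1) by (simp add: power2_eq_square)
  have dR: "d \<ge> 64 * R" using R(2) RR by linarith
  have d0: "d \<ge> 1" "d - 4 * R \<ge> R" "d - 4 * R > 0" using dR R(1) by linarith+
  have L0: "L \<ge> 0" using R(1) by (simp add: L_def)
  define J where "J = (\<integral>\<^sup>+s. ennreal (2 * exp (- 2 * s) * uncovered_area d s) * indicator {L<..} s \<partial>lborel)"
  have E: "E = enn2real J" unfolding E_def gap_tail_split(1)[OF L0] J_def L_def R_def by simp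
  have J1: "J \<le> 1" unfolding J_def by (rule gap_tail_split(2)[OF L0])
  have ea: "ennreal (exp (- 2 * (2 * ln x))) = ennreal (1 / x ^ 4)" if "x > 0" for x :: real
  proof -
    have "exp (- 2 * (2 * ln x)) = inverse (exp (4 * ln x))" by (simp add: exp_minus[symmetric])
    also have "exp (4 * ln x) = x ^ 4" using that exp_of_nat_mult[of 4 "ln x"] by simp
    finally show ?thesis by (simp add: inverse_eq_divide)
  qed
  have lower: "ennreal (1 / d ^ 4) \<le> J"
  proof -
    have "ennreal (1 / d ^ 4) = (\<integral>\<^sup>+s. ennreal (2 * exp (- 2 * s)) * indicator {2 * ln d<..} s \<partial>lborel)"
      using d0 by (subst exp_tail_integral) (simp_all add: ea[symmetric])
    also have "\<dots> \<le> J" unfolding J_def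
    proof (intro nn_integral_mono)
      fix s
      show "ennreal (2 * exp (- 2 * s)) * indicator {2 * ln d<..} s \<le> ennreal (2 * exp (- 2 * s) * uncovered_area d s) * indicator {L<..} s"
      proof (cases "2 * ln d < s")
        case True
        have "uncovered d (exp (- s / 2)) = open_square" by (rule uncovered_full[OF _ True]) (use d0 in simp)
        hence "uncovered_area d s = 1" by (simp add: uncovered_area_def measure_def emeasure_open_square)
        moreover have "L \<le> 2 * ln d" unfolding L_def using R(1) dR by simp
        hence "L < s" using True by linarith
        ultimately show ?thesis using True by simp
      qed simp
    qed
    finally show ?thesis .
  qed
  have upper: "J \<le> ennreal (1 / (d - 4 * R) ^ 4)"
  proof -
    have "J \<le> (\<integral>\<^sup>+s. ennreal (2 * exp (- 2 * s)) * indicator {2 * ln (d - 4 * R)<..} s \<partial>lborel)"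
      unfolding J_def
    proof (intro nn_integral_mono)
      fix s
      show "ennreal (2 * exp (- 2 * s) * uncovered_area d s) * indicator {L<..} s \<le> ennreal (2 * exp (- 2 * s)) * indicator {2 * ln (d - 4 * R)<..} s"
      proof (cases "2 * ln (d - 4 * R) < s")
        case True
        have "ennreal (2 * exp (- 2 * s) * uncovered_area d s) \<le> ennreal (2 * exp (- 2 * s))"
          using uncovered_area_bounds by (intro ennreal_leI) simp
        thus ?thesis using True by (auto simp: indicator_def)
      next
        case False
        show ?thesis
        proof (cases "L < s")
          case True
          have "uncovered d (exp (- s / 2)) = {}"
            by (rule uncovered_empty[OF gen d]) (use True False in \<open>simp_all add: L_def R_def\<close>)
          thus ?thesis by (simp add: uncovered_area_def)
        qed simp
      qed
    qed
    also have "\<dots> = ennreal (exp (- 2 * (2 * ln (d - 4 * R))))"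
      using d0 R(1) by (intro exp_tail_integral) simp
    also have "\<dots> = ennreal (1 / (d - 4 * R) ^ 4)" by (rule ea[OF d0(3)])
    finally show ?thesis .
  qed
  have "J < \<top>" using J1 ennreal_one_less_top by (rule le_less_trans)
  hence Jr: "J = ennreal E" unfolding E by simp
  have E0: "E \<ge> 0" unfolding E by simp
  show "1 / d ^ 4 \<le> E" using lower E0 unfolding Jr by simp
  have "E \<le> 1 / (d - 4 * R) ^ 4" using upper unfolding Jr by (subst (asm) ennreal_le_iff) simp_all
  also have "\<dots> \<le> 1 / d ^ 4 + 32 * (R / d ^ 5)"
  proof -
    define y where "y = 4 * R / d"
    have y: "0 \<le> y" "y \<le> 1 / 16" using dR d0 R(1) by (simp_all add: y_def field_simps)
    have dy: "d - 4 * R = d * (1 - y)" using d0 by (simp add: y_def field_simps)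
    have b: "1 - 4 * y \<le> (1 - y) ^ 4"
      using Bernoulli_inequality[of "- y" 4] y by simp
    have "1 \<le> (1 + 8 * y) * (1 - 4 * y)"
    proof -
      have "(1 + 8 * y) * (1 - 4 * y) = 1 + 4 * y - 32 * (y * y)" by (simp add: algebra_simps)
      moreover have "y * y \<le> y * (1 / 16)" using y by (intro mult_left_mono) auto
      ultimately show ?thesis using y by linarith
    qed
    also have "\<dots> \<le> (1 + 8 * y) * (1 - y) ^ 4" using b y by (intro mult_left_mono) auto
    finally have "1 / (1 - y) ^ 4 \<le> 1 + 8 * y" using y by (subst pos_divide_le_eq) auto
    hence "1 / (1 - y) ^ 4 / d ^ 4 \<le> (1 + 8 * y) / d ^ 4" using d0 by (intro divide_right_mono) auto
    also have "(1 + 8 * y) / d ^ 4 = 1 / d ^ 4 + 32 * (R / d ^ 5)"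
      using d0 by (simp add: y_def field_simps eval_nat_numeral)
    finally have "1 / (1 - y) ^ 4 / d ^ 4 \<le> 1 / d ^ 4 + 32 * (R / d ^ 5)" .
    moreover have "1 / (d * (1 - y)) ^ 4 = 1 / (1 - y) ^ 4 / d ^ 4"
      by (simp only: power_mult_distrib divide_divide_eq_left mult.commute)
    ultimately show ?thesis unfolding dy by simp
  qed
  finally show "E \<le> 1 / d ^ 4 + 32 * (cmod \<omega> / d ^ 5)" unfolding R_def .
qed

end

theorem corollary3p4:
  shows "\<exists>C::real. \<forall>(K::complex set) (\<mu>::real measure).
    imaginary_quadratic_field K \<longrightarrow> is_limit_gap_measure K \<mu> \<longrightarrow>
    (\<forall>\<^sub>F \<delta>::real in at_top.
      (let E = measure \<mu> {\<delta><..} -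
               2 * (LBINT s:{0..2 * ln (cmod (omega K))}. (1 - covered_fraction K s \<delta>) * exp (- 2 * s))
       in 1 / \<delta>^4 \<le> E \<and> E \<le> 1 / \<delta>^4 + C * (cmod (omega K) / \<delta>^5)))"
proof (intro exI[of _ 32] allI impI)
  fix K :: "complex set" and \<mu> :: "real measure"
  assume K: "imaginary_quadratic_field K" and mu: "is_limit_gap_measure K \<mu>"
  obtain \<tau> \<nu> where q: "quadratic_integers (omega K) \<tau> \<nu> K" and D: "discriminant K \<noteq> 0"
    and gen: "(Re (omega K) = 0 \<and> Im (omega K) \<ge> 1) \<or> (Re (omega K) = 1 / 2 \<and> Im (omega K) \<ge> sqrt 3 / 2)"
    using imaginary_quadratic_field_lattice[OF K] by blast
  interpret quadratic_integers "omega K" \<tau> \<nu> K by (rule q)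
  have gen': standard_generator unfolding standard_generator_def by (rule gen)
  show "\<forall>\<^sub>F \<delta> in at_top. (let E = measure \<mu> {\<delta><..} -
      2 * (LBINT s:{0..2 * ln (cmod (omega K))}. (1 - covered_fraction K s \<delta>) * exp (- 2 * s))
     in 1 / \<delta> ^ 4 \<le> E \<and> E \<le> 1 / \<delta> ^ 4 + 32 * (cmod (omega K) / \<delta> ^ 5))"
    using eventually_ge_at_top[of "64 * (cmod (omega K)) ^ 2"] eventually_gt_at_top[of 0]
  proof eventually_elim
    case (elim \<delta>)
    have "1 - covered_fraction K s \<delta> = uncovered_area \<delta> s" for s
      unfolding uncovered_area_def by (rule covered_fraction_eq[OF elim(2) D])
    thus ?case
      unfolding Let_def limit_gap_measure_tail[OF mu elim(2)]
      using gap_tail_estimate[OF gen' elim(1)] by simp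
  qed
qed

end
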